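(* Let $f$ be a nonnegative function on $\mathbb{R}^n$ and let $(f_t)_{t\ge0}$ denote its evolution along the heat flow ($f_t=E_tf$) or the Fokker-Planck flow ($f_t=P_tf$). Then the function $$t\mapsto M(f_t)=\Big(\int_{\mathbb{R}^n}f\Big)\ \inf_{z\in\mathbb{R}^n}\Big(\int_{\mathbb{R}^n}(\tau_z f_t)^{\square}(x)\,dx\Big)$$ is increasing (in the weak sense) on $[0,\infty)$ and is dominated by $M(\gamma_1)$.
   Context: All functions are Borel measurable. $\tau_z g(x)=g(x-z)$. The essential polar of a nonnegative function $g$ is $g^{\square}(x)=\operatorname{ess\,inf}_{y\in\mathbb{R}^n}\frac{e^{-x\cdot y}}{g(y)}$ (with $1/0=\infty$, $1/\infty=0$), and $M(g)=\big(\int g\big)\inf_z\int(\tau_z g)^{\square}$, with the convention $\infty\times0=0$; one has $\int f_t=\int f$. $\gamma_1(x)=e^{-|x|^2/2}$, for which $M(\gamma_1)=(2\pi)^n$. "Increasing" means non-decreasing. The flows are defined for any nonnegative $f$ by the integral formulas (possibly with value $\infty$): $P_0f=E_0f=f$ and, for $t>0$, $$P_tf(x)=e^{nt/2}\int_{\mathbb{R}^n}f(y)\,e^{-\frac{|e^{t/2}x-y|^2}{2(e^t-1)}}\frac{dy}{(2\pi(e^t-1))^{n/2}},\qquad E_tf(x)=\int_{\mathbb{R}^n}f(u)\,e^{-\frac{|x-u|^2}{2t}}\frac{du}{(2\pi t)^{n/2}}.$$ *)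

theory Defs
  imports "HOL-Analysis.Analysis"
begin

text \<open>Nonnegative functions take values in \<^typ>\<open>ennreal\<close>, since the flows and the polar may be
  infinite. The arithmetic of \<^typ>\<open>ennreal\<close> provides the conventions used below: \<open>a / 0 = \<infinity>\<close>
  for \<open>a \<noteq> 0\<close>, \<open>a / \<infinity> = 0\<close> for finite \<open>a\<close>, and \<open>\<infinity> * 0 = 0\<close>.\<close>

definition essinf :: "'a measure \<Rightarrow> ('a \<Rightarrow> ennreal) \<Rightarrow> ennreal" where
  "essinf M h = Sup {c. AE y in M. c \<le> h y}"

definition translate :: "real ^ 'n \<Rightarrow> (real ^ 'n \<Rightarrow> ennreal) \<Rightarrow> real ^ 'n \<Rightarrow> ennreal" where
  "translate z g x = g (x - z)"

definition ess_polar :: "(real ^ 'n \<Rightarrow> ennreal) \<Rightarrow> real ^ 'n \<Rightarrow> ennreal" where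
  "ess_polar g x = essinf lborel (\<lambda>y. ennreal (exp (- (x \<bullet> y))) / g y)"

definition volume_product :: "(real ^ 'n \<Rightarrow> ennreal) \<Rightarrow> ennreal" where
  "volume_product g =
     (\<integral>\<^sup>+x. g x \<partial>lborel) * (INF z. \<integral>\<^sup>+x. ess_polar (translate z g) x \<partial>lborel)"

definition heat_flow :: "real \<Rightarrow> (real ^ 'n \<Rightarrow> ennreal) \<Rightarrow> real ^ 'n \<Rightarrow> ennreal" where
  "heat_flow t f x =
     (if t = 0 then f x
      else \<integral>\<^sup>+u. f u * ennreal (exp (- (norm (x - u))\<^sup>2 / (2 * t))
                              / (2 * pi * t) powr (real CARD('n) / 2)) \<partial>lborel)"

definition fokker_planck_flow :: "real \<Rightarrow> (real ^ 'n \<Rightarrow> ennreal) \<Rightarrow> real ^ 'n \<Rightarrow> ennreal" where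
  "fokker_planck_flow t f x =
     (if t = 0 then f x
      else ennreal (exp (real CARD('n) * t / 2)) *
           (\<integral>\<^sup>+y. f y * ennreal (exp (- (norm (exp (t / 2) *\<^sub>R x - y))\<^sup>2 / (2 * (exp t - 1)))
                              / (2 * pi * (exp t - 1)) powr (real CARD('n) / 2)) \<partial>lborel))"

definition std_gaussian :: "real ^ 'n \<Rightarrow> ennreal" where
  "std_gaussian x = ennreal (exp (- (norm x)\<^sup>2 / 2))"

end

theory Submission
  imports Defs "HOL-Probability.Distributions"
begin

text \<open>Write \<open>f\<^sup>\<box>\<close> for the essential polar. Translating \<open>f\<close> by \<open>z\<close> multiplies \<open>f\<^sup>\<box>(x)\<close> by
  \<open>exp(- x \<bullet> z)\<close> (\<open>ess_polar_translate\<close>), both flows preserve the integral, and the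
  Fokker-Planck flow at time \<open>t\<close> is the heat flow at time \<open>e\<^sup>t - 1\<close> composed with a dilation, under
  which the volume product is invariant. So everything reduces to the claim that heating \<open>f\<close> does
  not decrease the infimum over \<open>z\<close> of the integral of \<open>(\<tau>\<^sub>z f)\<^sup>\<box>\<close>. By the semigroup property a single
  heating step suffices, and since the Gaussian kernel is a product one may heat in one direction
  \<open>b\<close> at a time. The resulting inequality, \<open>min_polar_mass_le_directional_heat\<close>, is the heart of
  the matter.

  The argument is a functional Steiner symmetrization. With the one-dimensional Gaussian density
  \<open>g\<close> of variance \<open>t\<close>, put \<open>F(x,u) = f(x - ub) g(u)\<close>. The heated function \<open>h\<close> is the marginal of
  \<open>F\<close> in \<open>u\<close>, and \<open>G(y,s) = f\<^sup>\<box>(y) \<gamma>(y \<bullet> b + s)\<close> with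
  \<open>\<gamma>\<close> the polar of \<open>g\<close> satisfies \<open>F(x,u) G(y,s) \<le> exp(- x \<bullet> y - us)\<close>. Let \<open>k(y,r)\<close> be the largest
  function of \<open>r > 0\<close> with \<open>k(y,r) min(F(x,u), F(x,v)) \<le> exp(- x \<bullet> y - (u - v) r / 2)\<close> for all \<open>x\<close> and
  all \<open>u \<ge> v\<close>: it is the polar of the function obtained by symmetrizing \<open>F\<close> in \<open>u\<close>. Two estimates
  squeeze the integral of \<open>k\<close>.

  \<^item> From above: on every fibre, the one-dimensional Brunn-Minkowski inequality and the
    multiplicative form of the Prekopa-Leindler inequality give \<open>\<integral>k(y,r) dr \<le> \<pi> h\<^sup>\<box>(y)\<close>
    (\<open>polar_of_differences\<close>).

  \<^item> From below: taking a weighted geometric mean of the bounds for \<open>G(y,s)\<close> and \<open>G(y',-s')\<close> shows that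
    \<open>k\<close>, at the harmonic mean \<open>r\<close> of \<open>s\<close> and \<open>s'\<close> and the matching convex combination of \<open>y\<close> and
    \<open>y'\<close>, dominates that weighted geometric mean. Integrating in \<open>y\<close> by the Prekopa-Leindler
    inequality (\<open>prekopa_leindler\<close>) and in \<open>r\<close> by an inequality of Ball (\<open>ball_harmonic_mean\<close>)
    yields a real \<open>d\<close> for which the integral of \<open>G(y,s) exp(ds)\<close> is at most twice the integral
    of \<open>k\<close>.

  The Gaussian factor \<open>\<gamma>\<close> contributes at least \<open>2\<pi>\<close> to the integral of \<open>G(y,s) exp(ds)\<close>, and what
  remains is the integral of the polar of a translate of \<open>f\<close>. Hence that integral is at most the one of
  \<open>h\<^sup>\<box>\<close>.

  The bound by the Gaussian is the functional Blaschke-Santalo inequality, and it follows from this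
  monotonicity: for compactly supported \<open>f\<close>, the heated function at a large time \<open>t\<close> dominates
  a multiple of a Gaussian of variance close to \<open>t\<close>, whose polar is explicit;
  letting \<open>t\<close> tend to infinity gives \<open>(2\<pi>)\<^sup>n\<close> (\<open>blaschke_santalo\<close>). The general case follows by
  truncation.\<close>

section \<open>Brunn-Minkowski and Prekopa-Leindler inequalities\<close>

lemma emeasure_lborel_greaterThan: "emeasure lborel {a::real<..} = \<infinity>"
proof -
  have "of_nat n \<le> emeasure lborel {a<..}" for n
  proof -
    have "of_nat n = emeasure lborel {a<..<a + real n}"
      by (simp add: ennreal_of_nat_eq_real_of_nat)
    also have "\<dots> \<le> emeasure lborel {a<..}" by (intro emeasure_mono) auto
    finally show ?thesis .
  qed
  then show ?thesis
    by (metis ennreal_Ex_less_of_nat infinity_ennreal_def not_less top.not_eq_extremum)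
qed

lemma nn_integral_layer_cake:
  fixes f :: "real \<Rightarrow> ennreal"
  assumes [measurable]: "f \<in> borel_measurable borel"
  shows "(\<integral>\<^sup>+x. f x \<partial>lborel) =
    (\<integral>\<^sup>+l. emeasure lborel {x. ennreal l < f x} * indicator {0<..} l \<partial>lborel)"
proof -
  have slice: "c = (\<integral>\<^sup>+l. indicator {l. 0 < l \<and> ennreal l < c} l \<partial>lborel)" for c :: ennreal
  proof (cases c)
    case (real r)
    then have "{l. 0 < l \<and> ennreal l < c} = {0<..<r}"
      by (auto simp: ennreal_less_iff)
    then show ?thesis using real by simp
  next
    case top
    then have "{l::real. 0 < l \<and> ennreal l < c} = {0<..}"
      by auto
    then show ?thesis using top by (simp add: emeasure_lborel_greaterThan)
  qed
  have "(\<integral>\<^sup>+x. f x \<partial>lborel) =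
      (\<integral>\<^sup>+x. (\<integral>\<^sup>+l. indicator {l. 0 < l \<and> ennreal l < f x} l \<partial>lborel) \<partial>lborel)"
    by (rule nn_integral_cong) (rule slice)
  also have "\<dots> = (\<integral>\<^sup>+x. (\<integral>\<^sup>+l. (if 0 < l \<and> ennreal l < f x then 1 else 0) \<partial>lborel) \<partial>lborel)"
    by (intro nn_integral_cong) (simp add: indicator_def)
  also have "\<dots> = (\<integral>\<^sup>+l. (\<integral>\<^sup>+x. (if 0 < l \<and> ennreal l < f x then 1 else 0) \<partial>lborel) \<partial>lborel)"
    by (rule lborel_pair.Fubini') measurable
  also have "\<dots> = (\<integral>\<^sup>+l. (\<integral>\<^sup>+x. indicator {x. ennreal l < f x} x * indicator {0<..} l \<partial>lborel) \<partial>lborel)"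
    by (intro nn_integral_cong) (auto simp: indicator_def)
  also have "\<dots> = (\<integral>\<^sup>+l. emeasure lborel {x. ennreal l < f x} * indicator {0<..} l \<partial>lborel)"
    by (intro nn_integral_cong, subst nn_integral_multc) auto
  finally show ?thesis .
qed

lemma emeasure_eq_SUP_atMost:
  fixes A :: "real set"
  assumes [measurable]: "A \<in> sets borel" and "A \<noteq> {}"
  shows "emeasure lborel A = (SUP a\<in>A. emeasure lborel (A \<inter> {..a}))"
proof (cases "\<exists>m\<in>A. \<forall>x\<in>A. x \<le> m")
  case True
  then obtain m where m: "m \<in> A" "\<And>x. x \<in> A \<Longrightarrow> x \<le> m" by auto
  then have "A \<inter> {..m} = A" by auto
  then have "emeasure lborel A \<le> (SUP a\<in>A. emeasure lborel (A \<inter> {..a}))"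
    using m(1) by (metis SUP_upper)
  moreover have "(SUP a\<in>A. emeasure lborel (A \<inter> {..a})) \<le> emeasure lborel A"
    by (intro SUP_least emeasure_mono) auto
  ultimately show ?thesis by (rule antisym)
next
  case False
  obtain D where D: "countable D" "D \<subseteq> A" "A \<subseteq> closure D"
    using separable by blast
  have "D \<noteq> {}" using D(3) \<open>A \<noteq> {}\<close> by auto
  have cof: "\<exists>d\<in>D. x \<le> d" if x: "x \<in> A" for x
  proof -
    obtain y where y: "y \<in> A" "x < y" using False x by (meson not_le)
    then have "y \<in> closure D" "open {x<..}" "y \<in> {x<..}" using D by auto
    then have "{x<..} \<inter> D \<noteq> {}" by (meson open_Int_closure_eq_empty disjoint_iff)
    then show ?thesis by (auto intro: less_imp_le)
  qed
  define e where "e = from_nat_into D"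
  have e: "range e = D" unfolding e_def using \<open>D \<noteq> {}\<close> D(1) by (rule range_from_nat_into)
  define a where "a n = Max (e ` {..n})" for n
  have aD: "a n \<in> D" for n
  proof -
    have "a n \<in> e ` {..n}" unfolding a_def by (intro Max_in) auto
    then show ?thesis using e by auto
  qed
  have mono: "incseq (\<lambda>n. A \<inter> {..a n})"
  proof (rule incseq_SucI)
    fix n
    have "a n \<le> a (Suc n)" unfolding a_def by (intro Max_mono) auto
    then show "A \<inter> {..a n} \<subseteq> A \<inter> {..a (Suc n)}" by auto
  qed
  have "(\<Union>n. A \<inter> {..a n}) = A"
  proof safe
    fix x assume "x \<in> A"
    then obtain d where "d \<in> D" "x \<le> d" using cof by auto
    then obtain n where "e n = d" using e by auto
    then have "d \<le> a n" unfolding a_def by (intro Max_ge) auto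
    then have "x \<le> a n" using \<open>x \<le> d\<close> by simp
    then show "x \<in> (\<Union>n. A \<inter> {..a n})" using \<open>x \<in> A\<close> by auto
  qed
  then have "emeasure lborel A = (SUP n. emeasure lborel (A \<inter> {..a n}))"
    using SUP_emeasure_incseq[OF _ mono, of lborel] by (auto simp: image_subset_iff)
  also have "\<dots> \<le> (SUP a\<in>A. emeasure lborel (A \<inter> {..a}))"
    using aD D(2) by (intro SUP_mono) auto
  finally show ?thesis
    by (rule antisym) (auto intro!: SUP_least emeasure_mono)
qed

lemma emeasure_lborel_affine_image:
  fixes A :: "real set"
  assumes [measurable]: "A \<in> sets borel" and "c \<noteq> 0"
  shows "emeasure lborel {x. (x - t) / c \<in> A} = ennreal \<bar>c\<bar> * emeasure lborel A"
proof -
  have m: "{x. (x - t) / c \<in> A} \<in> sets lborel" by measurable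
  have "emeasure lborel {x. (x - t) / c \<in> A} = (\<integral>\<^sup>+x. indicator A ((x - t) / c) \<partial>lborel)"
    unfolding nn_integral_indicator[symmetric, OF m] by (rule nn_integral_cong) (auto split: split_indicator)
  also have "\<dots> = \<bar>c\<bar> * (\<integral>\<^sup>+x. indicator A ((t + c * x - t) / c) \<partial>lborel)"
    by (rule nn_integral_real_affine) (use assms in auto)
  also have "\<dots> = \<bar>c\<bar> * emeasure lborel A"
    using \<open>c \<noteq> 0\<close> by simp
  finally show ?thesis .
qed

text \<open>For \<open>a \<in> A\<close> and \<open>b \<in> B\<close>, the set \<open>C\<close> contains a copy of \<open>\<theta>A\<close> cut off above \<open>a\<close> and a copy of
  \<open>(1 - \<theta>)B\<close> cut off below \<open>b\<close>, on opposite sides of the point \<open>\<theta>a + (1 - \<theta>)b\<close>. Exhausting \<open>A\<close> and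
  \<open>B\<close> by such pieces gives the full lengths.\<close>

lemma brunn_minkowski_real:
  fixes A B C :: "real set"
  assumes [measurable]: "A \<in> sets borel" "B \<in> sets borel" "C \<in> sets borel"
    and ne: "A \<noteq> {}" "B \<noteq> {}" and th: "0 < \<theta>" "\<theta> < 1"
    and C: "\<And>a b. a \<in> A \<Longrightarrow> b \<in> B \<Longrightarrow> \<theta> * a + (1 - \<theta>) * b \<in> C"
  shows "ennreal \<theta> * emeasure lborel A + ennreal (1 - \<theta>) * emeasure lborel B \<le> emeasure lborel C"
proof -
  let ?B' = "{x. - x \<in> B}"
  have B'[measurable]: "?B' \<in> sets borel" by measurable
  have B'ne: "?B' \<noteq> {}" using ne(2) by (metis (mono_tags, lifting) empty_Collect_eq ex_in_conv minus_minus)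
  have eB': "emeasure lborel ?B' = emeasure lborel B"
    using emeasure_lborel_affine_image[OF assms(2), of "-1" 0] by simp
  have *: "ennreal \<theta> * emeasure lborel (A \<inter> {..a}) + ennreal (1 - \<theta>) * emeasure lborel (?B' \<inter> {..b})
      \<le> emeasure lborel C" if ab: "a \<in> A" "b \<in> ?B'" for a b
  proof -
    let ?X = "{x. (x - (1-\<theta>) * (-b)) / \<theta> \<in> A \<inter> {..a}}"
    let ?Y = "{x. (x - \<theta> * a) / (-(1-\<theta>)) \<in> ?B' \<inter> {..b} - {b}}"
    have "emeasure lborel (?B' \<inter> {..b} - {b}) = emeasure lborel (?B' \<inter> {..b})"
      by (subst emeasure_Diff_null_set) (auto simp: null_sets_def)
    then have eY: "emeasure lborel ?Y = ennreal (1-\<theta>) * emeasure lborel (?B' \<inter> {..b})"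
      using th by (subst emeasure_lborel_affine_image) auto
    have eX: "emeasure lborel ?X = ennreal \<theta> * emeasure lborel (A \<inter> {..a})"
      using th by (subst emeasure_lborel_affine_image) auto
    have Xm: "?X \<in> sets lborel" "?Y \<in> sets lborel" by measurable
    have disj: "?X \<inter> ?Y = {}"
    proof (rule ccontr)
      assume "?X \<inter> ?Y \<noteq> {}"
      then obtain x where "x \<in> ?X" "x \<in> ?Y" by auto
      then have 1: "(x - (1-\<theta>) * (-b)) / \<theta> \<le> a" and 2: "(x - \<theta> * a) / (-(1-\<theta>)) < b" by auto
      from 1 have "x \<le> \<theta> * a - (1-\<theta>) * b" using th by (simp add: field_simps)
      moreover from 2 have "x - \<theta> * a > - (1-\<theta>) * b" using th
        by (simp add: divide_minus_right field_simps)
      ultimately show False by simp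
    qed
    have sub: "?X \<union> ?Y \<subseteq> C"
    proof
      fix x assume "x \<in> ?X \<union> ?Y"
      then consider "(x - (1-\<theta>) * (-b)) / \<theta> \<in> A" | "- ((x - \<theta> * a) / (-(1-\<theta>))) \<in> B"
        by auto
      then show "x \<in> C"
      proof cases
        case 1
        from C[OF this, of "-b"] ab show "x \<in> C" using th by simp
      next
        case 2
        from C[OF ab(1) this] have "\<theta> * a + (1-\<theta>) * - ((x - \<theta> * a) / (-(1-\<theta>))) \<in> C" .
        moreover have "\<theta> * a + (1-\<theta>) * - ((x - \<theta> * a) / (-(1-\<theta>))) = x"
          using th by (simp add: field_simps)
        ultimately show "x \<in> C" by simp
      qed
    qed
    have "emeasure lborel ?X + emeasure lborel ?Y = emeasure lborel (?X \<union> ?Y)"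
      using Xm disj by (rule plus_emeasure)
    also have "\<dots> \<le> emeasure lborel C"
      using sub by (intro emeasure_mono) auto
    finally show ?thesis unfolding eX eY .
  qed
  have "ennreal \<theta> * emeasure lborel A + ennreal (1 - \<theta>) * emeasure lborel B =
     (SUP a\<in>A. ennreal \<theta> * emeasure lborel (A \<inter> {..a})) +
     (SUP b\<in>?B'. ennreal (1 - \<theta>) * emeasure lborel (?B' \<inter> {..b}))"
    unfolding SUP_mult_left_ennreal[symmetric]
    by (simp only: emeasure_eq_SUP_atMost[OF assms(1) ne(1), symmetric]
        emeasure_eq_SUP_atMost[OF B' B'ne, symmetric] eB')
  also have "\<dots> = (SUP b\<in>?B'. (SUP a\<in>A. ennreal \<theta> * emeasure lborel (A \<inter> {..a})
      + ennreal (1 - \<theta>) * emeasure lborel (?B' \<inter> {..b})))"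
    using ne(1) B'ne by (simp add: ennreal_SUP_add_left ennreal_SUP_add_right)
  also have "\<dots> \<le> emeasure lborel C"
    using * by (intro SUP_least) auto
  finally show ?thesis .
qed


lemma borel_measurable_emeasure_superlevel[measurable]:
  fixes f :: "real \<Rightarrow> ennreal"
  assumes [measurable]: "f \<in> borel_measurable borel"
  shows "(\<lambda>l. emeasure lborel {x. ennreal l < f x}) \<in> borel_measurable borel"
proof -
  have "emeasure lborel {x. ennreal l < f x} = (\<integral>\<^sup>+x. (if ennreal l < f x then 1 else 0) \<partial>lborel)" for l
  proof -
    have m: "{x. ennreal l < f x} \<in> sets lborel" by measurable
    show ?thesis
      unfolding nn_integral_indicator[OF m, symmetric] by (rule nn_integral_cong) (auto split: split_indicator)
  qed
  moreover have "(\<lambda>l. \<integral>\<^sup>+x. (if ennreal l < f x then 1 else 0) \<partial>lborel) \<in> borel_measurable borel"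
    by measurable
  ultimately show ?thesis by simp
qed

text \<open>Below the height \<open>M\<close> no superlevel set of \<open>a\<close> or \<open>b\<close> is empty, so the inequality for sets applies
  to every level; it would fail at the levels where only one of the two sets is empty. This is
  why both functions are cut at the common height \<open>M\<close>.\<close>

lemma brunn_minkowski_functions:
  fixes a b k :: "real \<Rightarrow> ennreal"
  assumes [measurable]: "a \<in> borel_measurable borel" "b \<in> borel_measurable borel" "k \<in> borel_measurable borel"
    and th: "0 < \<theta>" "\<theta> < 1"
    and le: "\<And>x y. min (a x) (b y) \<le> k (\<theta> * x + (1 - \<theta>) * y)"
    and a: "\<And>m. m < M \<Longrightarrow> \<exists>x. m < a x" and b: "\<And>m. m < M \<Longrightarrow> \<exists>y. m < b y"
  shows "ennreal \<theta> * (\<integral>\<^sup>+x. min (a x) M \<partial>lborel) + ennreal (1 - \<theta>) * (\<integral>\<^sup>+y. min (b y) M \<partial>lborel)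
    \<le> (\<integral>\<^sup>+x. k x \<partial>lborel)"
proof -
  let ?E = "\<lambda>f l. emeasure lborel {x. ennreal l < f x}"
  have level: "ennreal \<theta> * ?E (\<lambda>x. min (a x) M) l + ennreal (1-\<theta>) * ?E (\<lambda>x. min (b x) M) l \<le> ?E k l" for l
  proof (cases "ennreal l < M")
    case True
    have "ennreal \<theta> * emeasure lborel {x. ennreal l < min (a x) M}
        + ennreal (1-\<theta>) * emeasure lborel {x. ennreal l < min (b x) M} \<le> emeasure lborel {x. ennreal l < k x}"
    proof (rule brunn_minkowski_real[OF _ _ _ _ _ th])
      fix x y assume "x \<in> {x. ennreal l < min (a x) M}" "y \<in> {x. ennreal l < min (b x) M}"
      then have "ennreal l < min (a x) (b y)" by simp
      also have "\<dots> \<le> k (\<theta> * x + (1 - \<theta>) * y)" by (rule le)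
      finally show "\<theta> * x + (1 - \<theta>) * y \<in> {x. ennreal l < k x}" by simp
    qed (use a[OF True] b[OF True] True in \<open>auto simp: ex_in_conv[symmetric]\<close>)
    then show ?thesis .
  next
    case False
    then show ?thesis by simp
  qed
  have "ennreal \<theta> * (\<integral>\<^sup>+x. min (a x) M \<partial>lborel) + ennreal (1 - \<theta>) * (\<integral>\<^sup>+y. min (b y) M \<partial>lborel)
     = (\<integral>\<^sup>+l. ennreal \<theta> * (?E (\<lambda>x. min (a x) M) l * indicator {0<..} l)
          + ennreal (1-\<theta>) * (?E (\<lambda>x. min (b x) M) l * indicator {0<..} l) \<partial>lborel)"
    by (subst (1 2) nn_integral_layer_cake) (simp_all add: nn_integral_add nn_integral_cmult)
  also have "\<dots> \<le> (\<integral>\<^sup>+l. ?E k l * indicator {0<..} l \<partial>lborel)"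
    using level by (intro nn_integral_mono) (auto split: split_indicator)
  also have "\<dots> = (\<integral>\<^sup>+x. k x \<partial>lborel)"
    by (rule nn_integral_layer_cake[symmetric]) simp
  finally show ?thesis .
qed

lemma SUP_min_of_nat: "(SUP N. min c (of_nat N)) = (c::ennreal)"
proof (rule antisym)
  show "c \<le> (SUP N. min c (of_nat N))"
  proof (rule dense_le)
    fix d assume "d < c"
    then have "d \<noteq> top" by auto
    then obtain N where "d < of_nat N"
      using ennreal_Ex_less_of_nat[of d] by (auto simp: less_top)
    with \<open>d < c\<close> have "d \<le> min c (of_nat N)" by (auto intro: less_imp_le)
    also have "\<dots> \<le> (SUP N. min c (of_nat N))" by (rule SUP_upper) simp
    finally show "d \<le> (SUP N. min c (of_nat N))" .
  qed
qed (auto intro!: SUP_least)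

lemma nn_integral_SUP_truncate:
  assumes [measurable]: "f \<in> borel_measurable M"
  shows "(SUP N. \<integral>\<^sup>+x. min (f x) (of_nat N) \<partial>M) = (\<integral>\<^sup>+x. f x \<partial>M)"
proof -
  have "(\<integral>\<^sup>+x. f x \<partial>M) = (\<integral>\<^sup>+x. (SUP N. min (f x) (of_nat N)) \<partial>M)"
    by (simp add: SUP_min_of_nat)
  also have "\<dots> = (SUP N. \<integral>\<^sup>+x. min (f x) (of_nat N) \<partial>M)"
    by (rule nn_integral_monotone_convergence_SUP)
       (unfold incseq_def le_fun_def, intro allI impI min.mono order_refl of_nat_mono, simp_all)
  finally show ?thesis by simp
qed

lemma weighted_exp_sum_ge_1:
  fixes \<theta> l :: real
  assumes "0 < \<theta>" "\<theta> < 1"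
  shows "1 \<le> \<theta> * exp ((1-\<theta>) * l) + (1-\<theta>) * exp (- \<theta> * l)"
proof -
  have "\<theta> * (1 + (1-\<theta>) * l) \<le> \<theta> * exp ((1-\<theta>) * l)"
    using assms by (intro mult_left_mono exp_ge_add_one_self) auto
  moreover have "(1-\<theta>) * (1 + (- \<theta> * l)) \<le> (1-\<theta>) * exp (- \<theta> * l)"
    using assms by (intro mult_left_mono exp_ge_add_one_self) auto
  ultimately show ?thesis by (simp add: algebra_simps)
qed

text \<open>The weighted geometric mean of positive reals \<open>p\<close> and \<open>q\<close> is the supremum over real \<open>l\<close> of the minimum of
  \<open>p exp((1 - \<theta>) l)\<close> and \<open>q exp(- \<theta> l)\<close>. Writing the hypothesis with these minima avoids powers
  of extended nonnegative reals; since the hypothesis is stable under the rescaling by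
  \<open>l\<close>, the minimum of the two integrals in the conclusion is as strong as their geometric mean.

  The choice of \<open>l\<close> that gives the rescaled functions the same supremum reduces the claim to
  \<open>brunn_minkowski_functions\<close>, and \<open>weighted_exp_sum_ge_1\<close> undoes the rescaling.\<close>

lemma prekopa_leindler_bounded:
  fixes f g h :: "real \<Rightarrow> ennreal"
  assumes [measurable]: "f \<in> borel_measurable borel" "g \<in> borel_measurable borel" "h \<in> borel_measurable borel"
    and th: "0 < \<theta>" "\<theta> < 1"
    and le: "\<And>x y l. min (f x * ennreal (exp ((1-\<theta>) * l))) (g y * ennreal (exp (- \<theta> * l)))
        \<le> h (\<theta> * x + (1 - \<theta>) * y)"
    and bd: "\<And>x. f x \<le> of_nat N" "\<And>y. g y \<le> of_nat N"
  shows "min (\<integral>\<^sup>+x. f x \<partial>lborel) (\<integral>\<^sup>+x. g x \<partial>lborel) \<le> (\<integral>\<^sup>+x. h x \<partial>lborel)"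
proof -
  have zero: "(\<integral>\<^sup>+x. u x \<partial>lborel) = 0" if "(SUP x. u x) = 0" for u :: "real \<Rightarrow> ennreal"
  proof -
    have "u x = 0" for x using that by (metis SUP_upper UNIV_I le_zero_eq)
    then show ?thesis by simp
  qed
  have "(SUP x. f x) \<le> of_nat N" "(SUP x. g x) \<le> of_nat N" using bd by (auto intro!: SUP_least)
  then have fin: "(SUP x. f x) \<noteq> top" "(SUP x. g x) \<noteq> top"
    by (metis ennreal_of_nat_neq_top neq_top_trans infinity_ennreal_def)+
  obtain p where p: "0 \<le> p" "(SUP x. f x) = ennreal p" using fin(1) by (cases "SUP x. f x") auto
  obtain q where q: "0 \<le> q" "(SUP x. g x) = ennreal q" using fin(2) by (cases "SUP x. g x") auto
  show ?thesis
  proof (cases "p = 0 \<or> q = 0")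
    case True
    then show ?thesis using zero[of f] zero[of g] p q by auto
  next
    case False
    define l where "l = ln (q / p)"
    have pq: "0 < p" "0 < q" using False p q by auto
    then have "p * exp l = q" by (simp add: l_def)
    moreover have "exp ((1-\<theta>) * l) = exp l * exp (- \<theta> * l)"
      by (simp add: algebra_simps flip: exp_add)
    ultimately have bal: "p * exp ((1-\<theta>) * l) = q * exp (- \<theta> * l)" by simp
    define e1 where "e1 = ennreal (exp ((1-\<theta>) * l))"
    define e2 where "e2 = ennreal (exp (- \<theta> * l))"
    define M where "M = (SUP x. f x * e1)"
    have "M = ennreal p * e1" unfolding M_def by (simp only: SUP_mult_right_ennreal[symmetric] p)
    also have "\<dots> = ennreal q * e2"
      unfolding e1_def e2_def using bal p q by (simp flip: ennreal_mult)
    also have "\<dots> = (SUP x. g x * e2)" by (simp only: SUP_mult_right_ennreal[symmetric] q)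
    finally have M2: "M = (SUP x. g x * e2)" .
    have "ennreal \<theta> * (\<integral>\<^sup>+x. min (f x * e1) M \<partial>lborel) + ennreal (1 - \<theta>) * (\<integral>\<^sup>+y. min (g y * e2) M \<partial>lborel)
      \<le> (\<integral>\<^sup>+x. h x \<partial>lborel)"
    proof (rule brunn_minkowski_functions[OF _ _ _ th])
      show "min (f x * e1) (g y * e2) \<le> h (\<theta> * x + (1 - \<theta>) * y)" for x y
        unfolding e1_def e2_def by (rule le)
      show "\<exists>x. m < f x * e1" if "m < M" for m using that unfolding M_def by (simp add: less_SUP_iff)
      show "\<exists>x. m < g x * e2" if "m < M" for m using that unfolding M2 by (simp add: less_SUP_iff)
    qed auto
    moreover have "min (f x * e1) M = f x * e1" for x
      unfolding M_def by (intro min_absorb1 SUP_upper) simp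
    moreover have "min (g x * e2) M = g x * e2" for x
      unfolding M2 by (intro min_absorb1 SUP_upper) simp
    ultimately have *: "ennreal \<theta> * ((\<integral>\<^sup>+x. f x \<partial>lborel) * e1) + ennreal (1 - \<theta>) * ((\<integral>\<^sup>+y. g y \<partial>lborel) * e2)
      \<le> (\<integral>\<^sup>+x. h x \<partial>lborel)"
      by (simp add: nn_integral_multc)
    let ?m = "min (\<integral>\<^sup>+x. f x \<partial>lborel) (\<integral>\<^sup>+x. g x \<partial>lborel)"
    have "?m = ?m * 1" by simp
    also have "\<dots> \<le> ?m * ennreal (\<theta> * exp ((1-\<theta>) * l) + (1-\<theta>) * exp (- \<theta> * l))"
      using weighted_exp_sum_ge_1[OF th, of l] by (intro mult_left_mono) auto
    also have "\<dots> = ennreal \<theta> * (?m * e1) + ennreal (1-\<theta>) * (?m * e2)"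
      unfolding e1_def e2_def using th by (simp add: ennreal_mult ennreal_plus distrib_left mult.commute mult.left_commute)
    also have "\<dots> \<le> ennreal \<theta> * ((\<integral>\<^sup>+x. f x \<partial>lborel) * e1) + ennreal (1 - \<theta>) * ((\<integral>\<^sup>+y. g y \<partial>lborel) * e2)"
      by (intro add_mono mult_left_mono mult_right_mono) auto
    finally show ?thesis using * by (rule order_trans)
  qed
qed

lemma prekopa_leindler_real:
  fixes f g h :: "real \<Rightarrow> ennreal"
  assumes [measurable]: "f \<in> borel_measurable borel" "g \<in> borel_measurable borel" "h \<in> borel_measurable borel"
    and th: "0 < \<theta>" "\<theta> < 1"
    and le: "\<And>x y l. min (f x * ennreal (exp ((1-\<theta>) * l))) (g y * ennreal (exp (- \<theta> * l)))
        \<le> h (\<theta> * x + (1 - \<theta>) * y)"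
  shows "min (\<integral>\<^sup>+x. f x \<partial>lborel) (\<integral>\<^sup>+x. g x \<partial>lborel) \<le> (\<integral>\<^sup>+x. h x \<partial>lborel)"
proof (rule dense_le)
  fix c assume c: "c < min (\<integral>\<^sup>+x. f x \<partial>lborel) (\<integral>\<^sup>+x. g x \<partial>lborel)"
  have "c < (SUP N. \<integral>\<^sup>+x. min (f x) (of_nat N) \<partial>lborel)" "c < (SUP N. \<integral>\<^sup>+x. min (g x) (of_nat N) \<partial>lborel)"
    using c by (simp_all add: nn_integral_SUP_truncate)
  then obtain N1 N2 where N1: "c < (\<integral>\<^sup>+x. min (f x) (of_nat N1) \<partial>lborel)"
    and N2: "c < (\<integral>\<^sup>+x. min (g x) (of_nat N2) \<partial>lborel)"
    by (auto simp: less_SUP_iff)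
  let ?N = "max N1 N2"
  have "c < (\<integral>\<^sup>+x. min (f x) (of_nat ?N) \<partial>lborel)"
    by (rule less_le_trans[OF N1], intro nn_integral_mono min.mono) auto
  moreover have "c < (\<integral>\<^sup>+x. min (g x) (of_nat ?N) \<partial>lborel)"
    by (rule less_le_trans[OF N2], intro nn_integral_mono min.mono) auto
  moreover have "min (\<integral>\<^sup>+x. min (f x) (of_nat ?N) \<partial>lborel) (\<integral>\<^sup>+x. min (g x) (of_nat ?N) \<partial>lborel)
      \<le> (\<integral>\<^sup>+x. h x \<partial>lborel)"
  proof (rule prekopa_leindler_bounded[OF _ _ _ th])
    fix x y l
    have "min (min (f x) (of_nat ?N) * ennreal (exp ((1-\<theta>) * l))) (min (g y) (of_nat ?N) * ennreal (exp (- \<theta> * l)))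
      \<le> min (f x * ennreal (exp ((1-\<theta>) * l))) (g y * ennreal (exp (- \<theta> * l)))"
      by (intro min.mono mult_right_mono) auto
    also have "\<dots> \<le> h (\<theta> * x + (1 - \<theta>) * y)" by (rule le)
    finally show "min (min (f x) (of_nat ?N) * ennreal (exp ((1-\<theta>) * l))) (min (g y) (of_nat ?N) * ennreal (exp (- \<theta> * l)))
      \<le> h (\<theta> * x + (1 - \<theta>) * y)" .
    show "min (f x) (of_nat ?N) \<le> of_nat ?N" "min (g y) (of_nat ?N) \<le> of_nat ?N"
      by (rule min.cobounded2)+
  qed auto
  ultimately show "c \<le> (\<integral>\<^sup>+x. h x \<partial>lborel)"
    by (meson less_imp_le less_le_trans min_less_iff_conj order.strict_implies_order min.bounded_iff order_trans)
qed

text \<open>Induction on the number of coordinates: the parameter \<open>l\<close> of the outer coordinate is absorbed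
  by the inner hypothesis, because the exponents simply add.\<close>

lemma prekopa_leindler_PiM:
  fixes f g h :: "('i \<Rightarrow> real) \<Rightarrow> ennreal"
  assumes "finite I" and th: "0 < \<theta>" "\<theta> < 1"
    and "f \<in> borel_measurable (PiM I (\<lambda>_. lborel))" "g \<in> borel_measurable (PiM I (\<lambda>_. lborel))"
      "h \<in> borel_measurable (PiM I (\<lambda>_. lborel))"
    and "\<And>x y l. x \<in> space (PiM I (\<lambda>_. lborel)) \<Longrightarrow> y \<in> space (PiM I (\<lambda>_. lborel)) \<Longrightarrow>
       min (f x * ennreal (exp ((1-\<theta>) * l))) (g y * ennreal (exp (- \<theta> * l)))
        \<le> h (\<lambda>i\<in>I. \<theta> * x i + (1 - \<theta>) * y i)"
  shows "min (\<integral>\<^sup>+x. f x \<partial>PiM I (\<lambda>_. lborel)) (\<integral>\<^sup>+x. g x \<partial>PiM I (\<lambda>_. lborel))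
      \<le> (\<integral>\<^sup>+x. h x \<partial>PiM I (\<lambda>_. lborel))"
  using assms(1,4-)
proof (induction I arbitrary: f g h rule: finite_induct)
  interpret product_sigma_finite "\<lambda>_::'i. lborel :: real measure" by standard
  {
    case empty
    show ?case using empty(4)[of "\<lambda>_. undefined" "\<lambda>_. undefined" 0]
      by (simp add: nn_integral_empty space_PiM restrict_def)
  next
    case (insert i I)
    note [measurable] = insert.prems(1-3)
    note fin = \<open>finite I\<close>[simp]
    note rev = product_nn_integral_insert_rev[OF insert.hyps(1,2)]
    have M: "(\<lambda>s. \<integral>\<^sup>+x. u (x(i := s)) \<partial>PiM I (\<lambda>_. lborel)) \<in> borel_measurable borel"
      if [measurable]: "u \<in> borel_measurable (PiM (insert i I) (\<lambda>_. lborel))" for u :: "('i \<Rightarrow> real) \<Rightarrow> ennreal"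
    proof -
      interpret I: finite_product_sigma_finite "\<lambda>_. lborel :: real measure" I by standard simp
      have "(\<lambda>(s, x). u (x(i := s))) \<in> borel_measurable (lborel \<Otimes>\<^sub>M PiM I (\<lambda>_. lborel))"
        by measurable
      then have "(\<lambda>s. \<integral>\<^sup>+x. u (x(i := s)) \<partial>PiM I (\<lambda>_. lborel)) \<in> borel_measurable lborel"
        by (rule I.borel_measurable_nn_integral)
      then show ?thesis by simp
    qed
    have M2: "(\<lambda>x. u (x(i := s))) \<in> borel_measurable (PiM I (\<lambda>_. lborel))"
      if [measurable]: "u \<in> borel_measurable (PiM (insert i I) (\<lambda>_. lborel))" for u :: "('i \<Rightarrow> real) \<Rightarrow> ennreal" and s
      by measurable
    show ?case
      unfolding rev[OF insert.prems(1)] rev[OF insert.prems(2)] rev[OF insert.prems(3)]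
    proof (rule prekopa_leindler_real[OF _ _ _ th])
      fix s t l
      have "min (\<integral>\<^sup>+x. f (x(i := s)) * ennreal (exp ((1-\<theta>) * l)) \<partial>PiM I (\<lambda>_. lborel))
              (\<integral>\<^sup>+y. g (y(i := t)) * ennreal (exp (- \<theta> * l)) \<partial>PiM I (\<lambda>_. lborel))
            \<le> (\<integral>\<^sup>+z. h (z(i := \<theta> * s + (1-\<theta>) * t)) \<partial>PiM I (\<lambda>_. lborel))"
      proof (rule insert.IH)
        fix x y l'
        assume xy: "x \<in> space (PiM I (\<lambda>_. lborel :: real measure))" "y \<in> space (PiM I (\<lambda>_. lborel :: real measure))"
        have e1: "exp ((1-\<theta>) * (l + l')) = exp ((1-\<theta>) * l) * exp ((1-\<theta>) * l')"
          and e2: "exp (- \<theta> * (l + l')) = exp (- \<theta> * l) * exp (- \<theta> * l')"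
          by (simp_all only: distrib_left exp_add)
        have "min (f (x(i:=s)) * ennreal (exp ((1-\<theta>) * (l + l')))) (g (y(i:=t)) * ennreal (exp (- \<theta> * (l + l'))))
          \<le> h (\<lambda>j\<in>insert i I. \<theta> * (x(i:=s)) j + (1 - \<theta>) * (y(i:=t)) j)"
          using xy by (intro insert.prems(4)) (auto simp: space_PiM PiE_def extensional_def)
        also have "(\<lambda>j\<in>insert i I. \<theta> * (x(i:=s)) j + (1 - \<theta>) * (y(i:=t)) j) =
            (\<lambda>j\<in>I. \<theta> * x j + (1 - \<theta>) * y j)(i := \<theta> * s + (1-\<theta>) * t)"
          using insert.hyps(2) by (auto simp: fun_eq_iff restrict_def)
        finally show "min (f (x(i := s)) * ennreal (exp ((1-\<theta>) * l)) * ennreal (exp ((1-\<theta>) * l')))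
              (g (y(i := t)) * ennreal (exp (- \<theta> * l)) * ennreal (exp (- \<theta> * l')))
            \<le> h ((\<lambda>j\<in>I. \<theta> * x j + (1 - \<theta>) * y j)(i := \<theta> * s + (1-\<theta>) * t))"
          unfolding e1 e2 by (simp only: ennreal_mult[OF exp_ge_zero exp_ge_zero] mult.assoc)
      qed (intro borel_measurable_times_ennreal borel_measurable_const
            M2[OF insert.prems(1)] M2[OF insert.prems(2)] M2[OF insert.prems(3)])+
      then show "min ((\<integral>\<^sup>+x. f (x(i := s)) \<partial>PiM I (\<lambda>_. lborel)) * ennreal (exp ((1-\<theta>) * l)))
              ((\<integral>\<^sup>+y. g (y(i := t)) \<partial>PiM I (\<lambda>_. lborel)) * ennreal (exp (- \<theta> * l)))
            \<le> (\<integral>\<^sup>+z. h (z(i := \<theta> * s + (1-\<theta>) * t)) \<partial>PiM I (\<lambda>_. lborel))"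
        by (simp only: nn_integral_multc[OF M2[OF insert.prems(1)]] nn_integral_multc[OF M2[OF insert.prems(2)]])
    qed (use M in auto)
  }
qed

theorem prekopa_leindler:
  fixes f g h :: "'a::euclidean_space \<Rightarrow> ennreal"
  assumes [measurable]: "f \<in> borel_measurable borel" "g \<in> borel_measurable borel" "h \<in> borel_measurable borel"
    and th: "0 < \<theta>" "\<theta> < 1"
    and le: "\<And>x y l. min (f x * ennreal (exp ((1-\<theta>) * l))) (g y * ennreal (exp (- \<theta> * l)))
        \<le> h (\<theta> *\<^sub>R x + (1 - \<theta>) *\<^sub>R y)"
  shows "min (\<integral>\<^sup>+x. f x \<partial>lborel) (\<integral>\<^sup>+x. g x \<partial>lborel) \<le> (\<integral>\<^sup>+x. h x \<partial>lborel)"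
proof -
  let ?P = "PiM (Basis :: 'a set) (\<lambda>_. lborel :: real measure)"
  let ?S = "\<lambda>x. \<Sum>b\<in>Basis. x b *\<^sub>R (b::'a)"
  have int: "(\<integral>\<^sup>+x. u x \<partial>lborel) = (\<integral>\<^sup>+x. u (?S x) \<partial>?P)"
    if [measurable]: "u \<in> borel_measurable borel" for u :: "'a \<Rightarrow> ennreal"
    by (subst lborel_eq, subst nn_integral_distr) auto
  have comb: "?S (\<lambda>i\<in>Basis. \<theta> * x i + (1 - \<theta>) * y i) = \<theta> *\<^sub>R ?S x + (1 - \<theta>) *\<^sub>R ?S y" for x y
    by (simp add: scaleR_sum_right algebra_simps sum.distrib sum_subtractf)
  show ?thesis
    unfolding int[OF assms(1)] int[OF assms(2)] int[OF assms(3)]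
  proof (rule prekopa_leindler_PiM[OF _ th])
    fix x y l
    show "min (f (?S x) * ennreal (exp ((1-\<theta>) * l))) (g (?S y) * ennreal (exp (- \<theta> * l)))
        \<le> h (?S (\<lambda>i\<in>Basis. \<theta> * x i + (1 - \<theta>) * y i))"
      unfolding comb by (rule le)
  qed auto
qed


section \<open>Polarity on the line\<close>

lemma le_exp_divide_iff: "x \<le> ennreal (exp a) / c \<longleftrightarrow> x * c \<le> ennreal (exp a)"
proof (cases c)
  case (real r)
  show ?thesis
  proof (cases "r = 0")
    case True
    then show ?thesis using real by (simp add: ennreal_divide_self)
  next
    case False
    then have r: "0 < r" using real by simp
    show ?thesis
    proof (cases x)
      case (real y)
      then show ?thesis using r \<open>c = ennreal r\<close>
        by (simp add: divide_ennreal ennreal_le_iff pos_le_divide_eq flip: ennreal_mult)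
    next
      case top
      then show ?thesis using r \<open>c = ennreal r\<close>
        by (simp add: divide_ennreal ennreal_top_mult top_unique)
    qed
  qed
next
  case top
  then show ?thesis by (cases "x = 0") (auto simp: ennreal_mult_eq_top_iff top_unique ennreal_mult_top)
qed

lemma continuous_on_exp_divide:
  assumes "continuous_on S \<phi>"
  shows "continuous_on S (\<lambda>x. ennreal (exp (\<phi> x)) / c)"
proof (cases c)
  case (real r)
  show ?thesis
  proof (cases "r = 0")
    case True
    then have "(\<lambda>x. ennreal (exp (\<phi> x)) / c) = (\<lambda>x. top)"
      using real by (auto simp: fun_eq_iff)
    then show ?thesis by (simp only: continuous_on_const)
  next
    case False
    then have r: "0 < r" using real by simp
    then have "(\<lambda>x. ennreal (exp (\<phi> x)) / c) = (\<lambda>x. ennreal (exp (\<phi> x) / r))"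
      using real by (simp add: divide_ennreal)
    moreover have "continuous_on S (\<lambda>x. ennreal (exp (\<phi> x) / r))"
      using r assms by (intro continuous_on_ennreal continuous_intros) auto
    ultimately show ?thesis by (simp only:)
  qed
next
  case top
  then show ?thesis by simp
qed

lemma borel_measurable_INF_continuous:
  fixes h :: "'i \<Rightarrow> 'a::topological_space \<Rightarrow> ennreal"
  assumes "\<And>i. i \<in> I \<Longrightarrow> continuous_on UNIV (h i)"
  shows "(\<lambda>x. INF i\<in>I. h i x) \<in> borel_measurable borel"
proof (rule borel_measurableI_less)
  fix y
  have "{x. (INF i\<in>I. h i x) < y} = (\<Union>i\<in>I. {x. h i x < y})"
    by (auto simp: INF_less_iff)
  also have "open \<dots>"
    using assms by (intro open_UN ballI open_Collect_less) auto
  finally show "{x \<in> space borel. (INF i\<in>I. h i x) < y} \<in> sets borel" by simp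
qed

lemma nn_integral_incseq_sets:
  assumes [measurable]: "f \<in> borel_measurable M" "\<And>n. A n \<in> sets M" and "incseq A"
  shows "(\<integral>\<^sup>+x. f x * indicator (\<Union>n. A n) x \<partial>M) = (SUP n. \<integral>\<^sup>+x. f x * indicator (A n) x \<partial>M)"
  using SUP_emeasure_incseq[of A "density M f"] assms
  by (simp add: emeasure_density image_subset_iff)

text \<open>The substitution theorem for intervals extends to the whole half-line by exhaustion.\<close>

lemma nn_integral_exp_substitution:
  fixes f :: "real \<Rightarrow> ennreal"
  assumes [measurable]: "f \<in> borel_measurable borel"
  shows "(\<integral>\<^sup>+x. f x * indicator {0<..} x \<partial>lborel) = (\<integral>\<^sup>+x. f (exp x) * ennreal (exp x) \<partial>lborel)"
proof -
  have sub: "(\<integral>\<^sup>+x. f x * indicator {exp (- real (Suc n))..exp (real (Suc n))} x \<partial>lborel) =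
      (\<integral>\<^sup>+x. f (exp x) * ennreal (exp x) * indicator {- real (Suc n)..real (Suc n)} x \<partial>lborel)" for n
    by (rule nn_integral_substitution_aux) (auto intro!: derivative_eq_intros continuous_intros)
  have "(\<Union>n. {exp (- real (Suc n))..exp (real (Suc n))}) = {0<..}"
  proof safe
    fix x :: real assume "0 < x"
    obtain n where "\<bar>ln x\<bar> \<le> real n" using real_arch_simple by blast
    then have "- real (Suc n) \<le> ln x" "ln x \<le> real (Suc n)" by auto
    then have "exp (- real (Suc n)) \<le> x" "x \<le> exp (real (Suc n))"
      using \<open>0 < x\<close> by (metis exp_le_cancel_iff exp_ln)+
    then show "x \<in> (\<Union>n. {exp (- real (Suc n))..exp (real (Suc n))})" by auto
  qed (auto intro: less_le_trans[OF exp_gt_zero])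
  then have "(\<integral>\<^sup>+x. f x * indicator {0<..} x \<partial>lborel) =
      (SUP n. \<integral>\<^sup>+x. f x * indicator {exp (- real (Suc n))..exp (real (Suc n))} x \<partial>lborel)"
    by (subst nn_integral_incseq_sets[symmetric]) (auto simp: incseq_def)
  also have "\<dots> = (SUP n. \<integral>\<^sup>+x. f (exp x) * ennreal (exp x) * indicator {- real (Suc n)..real (Suc n)} x \<partial>lborel)"
    by (simp only: sub)
  also have "\<dots> = (\<integral>\<^sup>+x. f (exp x) * ennreal (exp x) * indicator (\<Union>n. {- real (Suc n)..real (Suc n)}) x \<partial>lborel)"
    by (rule nn_integral_incseq_sets[symmetric]) (auto simp: incseq_def)
  also have "(\<Union>n. {- real (Suc n)..real (Suc n)}) = UNIV"
  proof safe
    fix x :: real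
    obtain n where "\<bar>x\<bar> \<le> real n" using real_arch_simple by blast
    then have "x \<in> {- real (Suc n)..real (Suc n)}" by auto
    then show "x \<in> (\<Union>n. {- real (Suc n)..real (Suc n)})" by blast
  qed auto
  finally show ?thesis by simp
qed

lemma nn_integral_uminus:
  fixes f :: "real \<Rightarrow> ennreal"
  assumes [measurable]: "f \<in> borel_measurable borel"
  shows "(\<integral>\<^sup>+x. f (- x) \<partial>lborel) = (\<integral>\<^sup>+x. f x \<partial>lborel)"
  using nn_integral_real_affine[OF assms, of "-1" 0] by simp

text \<open>In the logarithmic variable the inversion is the reflection \<open>x \<mapsto> - x\<close>.\<close>

lemma nn_integral_inverse_substitution:
  fixes f :: "real \<Rightarrow> ennreal"
  assumes [measurable]: "f \<in> borel_measurable borel"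
  shows "(\<integral>\<^sup>+x. f x * indicator {0<..} x \<partial>lborel) =
     (\<integral>\<^sup>+x. f (1 / x) * ennreal (1 / x\<^sup>2) * indicator {0<..} x \<partial>lborel)"
proof -
  have "(\<integral>\<^sup>+x. f x * indicator {0<..} x \<partial>lborel) = (\<integral>\<^sup>+x. f (exp x) * ennreal (exp x) \<partial>lborel)"
    by (rule nn_integral_exp_substitution) simp
  also have "\<dots> = (\<integral>\<^sup>+x. f (exp (-x)) * ennreal (exp (-x)) \<partial>lborel)"
    by (rule nn_integral_uminus[symmetric]) simp
  also have "\<dots> = (\<integral>\<^sup>+x. f (1 / exp x) * ennreal (1 / (exp x)\<^sup>2) * ennreal (exp x) \<partial>lborel)"
    by (intro nn_integral_cong) 
       (simp add: exp_minus inverse_eq_divide power2_eq_square mult.assoc flip: ennreal_mult)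
  also have "\<dots> = (\<integral>\<^sup>+x. f (1 / x) * ennreal (1 / x\<^sup>2) * indicator {0<..} x \<partial>lborel)"
    by (rule nn_integral_exp_substitution[symmetric]) measurable
  finally show ?thesis .
qed

lemma nn_integral_split_halves:
  fixes f :: "real \<Rightarrow> ennreal"
  assumes [measurable]: "f \<in> borel_measurable borel"
  shows "(\<integral>\<^sup>+x. f x \<partial>lborel) = (\<integral>\<^sup>+x. f x * indicator {0<..} x \<partial>lborel)
      + (\<integral>\<^sup>+x. f (- x) * indicator {0<..} x \<partial>lborel)"
proof -
  have "(\<integral>\<^sup>+x. f x \<partial>lborel) = (\<integral>\<^sup>+x. f x * indicator {0<..} x + f x * indicator {..<0} x \<partial>lborel)"
    by (intro nn_integral_cong_AE AE_I[of _ _ "{0}"]) (auto split: split_indicator)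
  also have "\<dots> = (\<integral>\<^sup>+x. f x * indicator {0<..} x \<partial>lborel) + (\<integral>\<^sup>+x. f x * indicator {..<0} x \<partial>lborel)"
    by (rule nn_integral_add) auto
  also have "(\<integral>\<^sup>+x. f x * indicator {..<0} x \<partial>lborel) = (\<integral>\<^sup>+x. f (-x) * indicator {..<0} (-x) \<partial>lborel)"
    by (rule nn_integral_uminus[symmetric]) simp
  also have "\<dots> = (\<integral>\<^sup>+x. f (- x) * indicator {0<..} x \<partial>lborel)"
    by (intro nn_integral_cong) (auto split: split_indicator)
  finally show ?thesis .
qed

lemma nn_integral_gaussian_real:
  assumes "0 < a"
  shows "(\<integral>\<^sup>+x. ennreal (exp (- (x::real)\<^sup>2 / (2 * a))) \<partial>lborel) = ennreal (sqrt (2 * pi * a))"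
proof -
  have eq: "exp (- x\<^sup>2 / (2 * a)) = sqrt (2 * pi * a) * normal_density 0 (sqrt a) x" for x
    using assms by (simp add: normal_density_def)
  have "(\<integral>\<^sup>+x. ennreal (normal_density 0 (sqrt a) x) \<partial>lborel) = ennreal (\<integral>x. normal_density 0 (sqrt a) x \<partial>lborel)"
    using assms by (intro nn_integral_eq_integral) auto
  then have "(\<integral>\<^sup>+x. ennreal (normal_density 0 (sqrt a) x) \<partial>lborel) = 1"
    using assms by simp
  then show ?thesis
    unfolding eq using assms by (simp add: ennreal_mult nn_integral_cmult)
qed

text \<open>Recovers the product form from the minimum form of a geometric mean: \<open>c\<close> is chosen to balance
  the two factors.\<close>

lemma ennreal_mult_le_square_of_min:
  assumes "\<And>c. min (U * ennreal (exp c)) (V * ennreal (exp (- c))) \<le> ennreal J" "0 \<le> J"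
  shows "U * V \<le> ennreal (J\<^sup>2)"
proof -
  have top: "U * V \<le> ennreal (J\<^sup>2)" if V: "V \<noteq> 0" "U = top" and le: "\<And>c. min (U * ennreal (exp c)) (V * ennreal (exp (- c))) \<le> ennreal J"
    for U V :: ennreal
  proof -
    obtain v where v: "0 < v" "ennreal v \<le> V"
    proof (cases V)
      case (real r) then show ?thesis using that[of r] V by auto
    next
      case top then show ?thesis using that[of 1] by simp
    qed
    define c where "c = - ln ((J + 1) / v)"
    have "ennreal (J + 1) = ennreal v * ennreal (exp (-c))"
      using v assms(2) by (simp add: c_def flip: ennreal_mult)
    also have "\<dots> \<le> V * ennreal (exp (- c))" using v by (intro mult_right_mono) auto
    finally have "ennreal (J + 1) \<le> min (U * ennreal (exp c)) (V * ennreal (exp (- c)))"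
      using V by (simp add: ennreal_top_mult)
    also have "\<dots> \<le> ennreal J" by (rule le)
    finally show ?thesis using assms(2) by simp
  qed
  consider "U = 0 \<or> V = 0" | "U = top" "V \<noteq> 0" | "V = top" "U \<noteq> 0" | "U \<noteq> 0" "V \<noteq> 0" "U \<noteq> top" "V \<noteq> top" by auto
  then show ?thesis
  proof cases
    case 1 then show ?thesis by auto
  next
    case 2 then show ?thesis using top[of V U] assms(1) by simp
  next
    case 3
    have "V * U \<le> ennreal (J\<^sup>2)"
      by (rule top[OF 3(2,1)]) (use assms(1)[of "- c" for c] in \<open>simp add: min.commute\<close>)
    then show ?thesis by (simp add: mult.commute)
  next
    case 4
    obtain u where u: "0 < u" "U = ennreal u" using 4 by (cases U) auto
    obtain v where v: "0 < v" "V = ennreal v" using 4 by (cases V) auto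
    define c where "c = ln (v / u) / 2"
    have c2: "exp c * exp c = v / u" using u v by (simp add: c_def flip: exp_add)
    have "u * exp c = v * exp (- c)" using c2 u by (simp add: exp_minus field_simps)
    then have "ennreal (u * exp c) \<le> ennreal J"
      using assms(1)[of c] u v by (simp flip: ennreal_mult)
    then have le: "u * exp c \<le> J" using assms(2) by (simp add: ennreal_le_iff)
    have "u * v = (u * exp c)\<^sup>2" using c2 u by (simp add: power2_eq_square field_simps)
    also have "\<dots> \<le> J\<^sup>2" using le u by (intro power_mono) auto
    finally show ?thesis using u v by (simp flip: ennreal_mult)
  qed
qed

lemma ennreal_min_le_of_mult_le:
  assumes "u * v \<le> ennreal (h\<^sup>2)" "0 \<le> h"
  shows "min u v \<le> ennreal h"
proof (rule ccontr)
  assume "\<not> ?thesis"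
  then obtain c where c: "ennreal h < c" "c < min u v" using dense by (meson not_le)
  then obtain r where r: "0 \<le> r" "c = ennreal r" by (cases c) auto
  have "ennreal (r\<^sup>2) = c * c" using r by (simp add: power2_eq_square ennreal_mult)
  also have "\<dots> \<le> u * v" using c(2) by (intro mult_mono) (auto intro: less_imp_le)
  also have "\<dots> \<le> ennreal (h\<^sup>2)" by (rule assms)
  finally have "r\<^sup>2 \<le> h\<^sup>2" by simp
  then have "r \<le> h" using assms(2) by (rule power2_le_imp_le)
  then show False using c(1) r by (simp add: ennreal_less_iff)
qed

text \<open>The substitution \<open>w = exp a\<close>, \<open>r = exp b\<close> turns the constraint into one that depends on \<open>a + b\<close> only, to
  which the additive inequality with weight one half applies. The extremal pair is the Gaussian
  with itself, whence the constant is the square of its integral over the half-line.\<close>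

lemma polar_halfline:
  fixes S k :: "real \<Rightarrow> ennreal"
  assumes [measurable]: "S \<in> borel_measurable borel" "k \<in> borel_measurable borel"
    and le: "\<And>w r. 0 < w \<Longrightarrow> 0 < r \<Longrightarrow> S w * k r \<le> ennreal (exp (- (w * r)))"
  shows "(\<integral>\<^sup>+w. S w * indicator {0<..} w \<partial>lborel) * (\<integral>\<^sup>+r. k r * indicator {0<..} r \<partial>lborel) \<le> ennreal (pi / 2)"
proof -
  let ?U = "\<integral>\<^sup>+a. S (exp a) * ennreal (exp a) \<partial>lborel"
  let ?V = "\<integral>\<^sup>+a. k (exp a) * ennreal (exp a) \<partial>lborel"
  let ?g = "\<lambda>x::real. exp (- x\<^sup>2 / 2)"
  let ?h = "\<lambda>m::real. ?g (exp m) * exp m"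
  let ?I = "\<integral>\<^sup>+x. ennreal (?g x) * indicator {0<..} x \<partial>lborel"
  have "ennreal (sqrt (2 * pi)) = (\<integral>\<^sup>+x. ennreal (?g x) \<partial>lborel)"
    using nn_integral_gaussian_real[of 1] by simp
  also have "\<dots> = ?I + (\<integral>\<^sup>+x. ennreal (?g (- x)) * indicator {0<..} x \<partial>lborel)"
    by (rule nn_integral_split_halves) measurable
  also have "\<dots> = 2 * ?I" unfolding power2_minus mult_2 ..
  finally have g2: "ennreal (sqrt (2 * pi)) = 2 * ?I" .
  have half: "?I = ennreal (sqrt (pi / 2))"
  proof (cases ?I)
    case (real r)
    have "ennreal (sqrt (2 * pi)) = ennreal (2 * r)"
      unfolding g2 real(2) using real(1) by (simp add: ennreal_mult)
    then have "sqrt (2 * pi) = 2 * r" using real(1) by (subst (asm) ennreal_inj) simp_all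
    moreover have "sqrt (2 * pi) = 2 * sqrt (pi / 2)"
      using real_sqrt_mult[of 4 "pi / 2"] by simp
    ultimately show ?thesis unfolding real(2) by simp
  next
    case top
    then show ?thesis using g2 by (simp add: ennreal_mult_top)
  qed
  have J: "(\<integral>\<^sup>+m. ennreal (?h m) \<partial>lborel) = ennreal (sqrt (pi / 2))"
  proof -
    have "?I = (\<integral>\<^sup>+m. ennreal (?g (exp m)) * ennreal (exp m) \<partial>lborel)"
      by (rule nn_integral_exp_substitution) measurable
    also have "\<dots> = (\<integral>\<^sup>+m. ennreal (?h m) \<partial>lborel)"
      by (intro nn_integral_cong ennreal_mult[symmetric]) auto
    finally show ?thesis using half by (rule trans[OF sym])
  qed
  have "?U * ?V \<le> ennreal ((sqrt (pi / 2))\<^sup>2)"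
  proof (rule ennreal_mult_le_square_of_min)
    fix c
    have "min (\<integral>\<^sup>+a. S (exp a) * ennreal (exp a) * ennreal (exp c) \<partial>lborel)
         (\<integral>\<^sup>+a. k (exp a) * ennreal (exp a) * ennreal (exp (-c)) \<partial>lborel) \<le> (\<integral>\<^sup>+m. ennreal (?h m) \<partial>lborel)"
    proof (rule prekopa_leindler_real[where \<theta> = "1/2"])
      fix a b l :: real
      let ?m = "1/2 * a + (1 - 1/2) * b"
      let ?u = "S (exp a) * ennreal (exp a) * ennreal (exp c) * ennreal (exp ((1 - 1/2) * l))"
      let ?v = "k (exp b) * ennreal (exp b) * ennreal (exp (-c)) * ennreal (exp (- (1/2) * l))"
      have "?u * ?v = (S (exp a) * k (exp b)) * (ennreal (exp a) * ennreal (exp c) * ennreal (exp ((1 - 1/2) * l)) *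
          (ennreal (exp b) * ennreal (exp (-c)) * ennreal (exp (- (1/2) * l))))"
        by (simp only: mult.assoc mult.commute mult.left_commute)
      also have "\<dots> = (S (exp a) * k (exp b)) * ennreal (exp (a + b))"
      proof -
        have "a + c + (1 - 1/2) * l + (b + - c + - (1/2) * l) = a + b" by simp
        then have "exp a * exp c * exp ((1 - 1/2) * l) * (exp b * exp (- c) * exp (- (1/2) * l)) = exp (a + b)"
          unfolding exp_add[symmetric] by (rule arg_cong)
        then show ?thesis by (simp only: ennreal_mult'[symmetric] exp_ge_zero mult_nonneg_nonneg)
      qed
      also have "\<dots> \<le> ennreal (exp (- (exp a * exp b))) * ennreal (exp (a + b))"
        by (intro mult_right_mono le) auto
      also have "\<dots> = ennreal ((?h ?m)\<^sup>2)"
      proof -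
        have "(exp ?m)\<^sup>2 = exp (2 * ?m)" by (simp only: exp_double)
        also have "2 * ?m = a + b" by simp
        finally have m: "(exp ?m)\<^sup>2 = exp (a + b)" .
        have "(?h ?m)\<^sup>2 = exp (2 * (- (exp ?m)\<^sup>2 / 2)) * (exp ?m)\<^sup>2"
          by (simp only: power_mult_distrib exp_double)
        also have "\<dots> = exp (- (exp a * exp b)) * exp (a + b)"
          unfolding m by (simp add: exp_add)
        finally show ?thesis by (simp only: ennreal_mult'[symmetric] exp_ge_zero)
      qed
      finally show "min ?u ?v \<le> ennreal (?h ?m)" by (rule ennreal_min_le_of_mult_le) simp
    qed auto
    then show "min (?U * ennreal (exp c)) (?V * ennreal (exp (- c))) \<le> ennreal (sqrt (pi / 2))"
      unfolding J by (simp add: nn_integral_multc)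
  qed simp
  then show ?thesis
    by (simp add: nn_integral_exp_substitution)
qed

text \<open>A one-dimensional Santalo inequality. In place of choosing a centre for \<open>F\<close>, one tests \<open>k\<close> against
  differences \<open>u - v\<close> only, that is, against the symmetrization of \<open>F\<close>. Replacing this symmetrization
  by the larger \<open>S\<close>, the polar of \<open>k\<close>, settles its measurability. By the Brunn-Minkowski inequality
  for \<open>F\<close> and its reflection, \<open>w \<mapsto> S \<bar>w\<bar>\<close> has at least the integral of \<open>F\<close>.\<close>

lemma polar_of_differences:
  fixes F k :: "real \<Rightarrow> ennreal"
  assumes [measurable]: "F \<in> borel_measurable borel" "k \<in> borel_measurable borel"
    and le: "\<And>u v r. v \<le> u \<Longrightarrow> 0 < r \<Longrightarrow> min (F u) (F v) * k r \<le> ennreal (exp (- ((u - v) * r / 2)))"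
  shows "(\<integral>\<^sup>+u. F u \<partial>lborel) * (\<integral>\<^sup>+r. k r * indicator {0<..} r \<partial>lborel) \<le> ennreal pi"
proof -
  define S where "S w = (INF r\<in>{0<..}. ennreal (exp (- (w * r))) / k r)" for w
  have [measurable]: "S \<in> borel_measurable borel"
    unfolding S_def by (intro borel_measurable_INF_continuous continuous_on_exp_divide continuous_intros)
  have Sk: "S w * k r \<le> ennreal (exp (- (w * r)))" if "0 < r" for w r
    using that unfolding le_exp_divide_iff[symmetric] S_def by (intro INF_lower) auto
  have SF: "min (F x) (F (- y)) \<le> S \<bar>1/2 * x + (1 - 1/2) * y\<bar>" for x y
    unfolding S_def
  proof (rule INF_greatest, unfold le_exp_divide_iff)
    fix r :: real assume "r \<in> {0<..}"
    then have r: "0 < r" by simp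
    show "min (F x) (F (- y)) * k r \<le> ennreal (exp (- (\<bar>1/2 * x + (1 - 1/2) * y\<bar> * r)))"
    proof (cases "- y \<le> x")
      case True
      then have "\<bar>1/2 * x + (1 - 1/2) * y\<bar> * r = (x - - y) * r / 2" by simp
      then show ?thesis using le[OF True r] by (simp only:)
    next
      case False
      then have "\<bar>1/2 * x + (1 - 1/2) * y\<bar> = (- y - x) / 2" by simp
      then have "\<bar>1/2 * x + (1 - 1/2) * y\<bar> * r = (- y - x) * r / 2" by simp
      moreover have "x \<le> - y" using False by simp
      ultimately show ?thesis using le[of x "- y" r] r by (simp only: min.commute)
    qed
  qed
  define M where "M = (SUP x. F x)"
  have "ennreal (1/2) * (\<integral>\<^sup>+x. min (F x) M \<partial>lborel) + ennreal (1 - 1/2) * (\<integral>\<^sup>+y. min (F (- y)) M \<partial>lborel)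
    \<le> (\<integral>\<^sup>+w. S \<bar>w\<bar> \<partial>lborel)"
  proof (rule brunn_minkowski_functions)
    show "\<exists>x. m < F x" if "m < M" for m using that unfolding M_def by (simp add: less_SUP_iff)
    then show "\<exists>x. m < F (- x)" if "m < M" for m using that by (metis minus_minus)
  qed (use SF in auto)
  moreover have "min (F x) M = F x" for x unfolding M_def by (intro min_absorb1 SUP_upper) simp
  ultimately have "ennreal (1/2) * (\<integral>\<^sup>+x. F x \<partial>lborel) + ennreal (1/2) * (\<integral>\<^sup>+x. F x \<partial>lborel) \<le> (\<integral>\<^sup>+w. S \<bar>w\<bar> \<partial>lborel)"
    by (simp add: nn_integral_uminus)
  moreover have "ennreal (1/2) * X + ennreal (1/2) * X = X" for X
  proof -
    have "ennreal (1/2) + ennreal (1/2) = 1" by (subst ennreal_plus[symmetric]) simp_all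
    then show ?thesis by (simp only: distrib_right[symmetric] mult_1_left)
  qed
  moreover have "(\<integral>\<^sup>+w. S \<bar>w\<bar> \<partial>lborel) = 2 * (\<integral>\<^sup>+w. S w * indicator {0<..} w \<partial>lborel)"
  proof -
    have "(\<integral>\<^sup>+w. S \<bar>w\<bar> * indicator {0<..} w \<partial>lborel) = (\<integral>\<^sup>+w. S w * indicator {0<..} w \<partial>lborel)"
      by (intro nn_integral_cong) (auto split: split_indicator)
    then show ?thesis by (subst nn_integral_split_halves) (simp_all add: mult_2)
  qed
  ultimately have "(\<integral>\<^sup>+x. F x \<partial>lborel) \<le> 2 * (\<integral>\<^sup>+w. S w * indicator {0<..} w \<partial>lborel)" by simp
  then have "(\<integral>\<^sup>+u. F u \<partial>lborel) * (\<integral>\<^sup>+r. k r * indicator {0<..} r \<partial>lborel)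
     \<le> 2 * (\<integral>\<^sup>+w. S w * indicator {0<..} w \<partial>lborel) * (\<integral>\<^sup>+r. k r * indicator {0<..} r \<partial>lborel)"
    by (rule mult_right_mono) simp
  also have "\<dots> \<le> 2 * ennreal (pi / 2)"
    unfolding mult.assoc using Sk by (intro mult_left_mono polar_halfline) auto
  also have "\<dots> = ennreal pi"
    by (simp add: ennreal_mult'[symmetric] flip: ennreal_numeral)
  finally show ?thesis .
qed


section \<open>Ball's inequality for harmonic means\<close>

text \<open>Integrability of \<open>K\<close> forces an exponential bound on \<open>A\<close>. Being monotone, \<open>K\<close> is at most \<open>J / r\<close>
  at \<open>r\<close>; comparing \<open>A s\<close> with \<open>B 1\<close>, where the parameter \<open>d\<close> is chosen to make the second entry of the
  minimum exceed the bound on \<open>K\<close>, bounds \<open>A s\<close> exponentially. The factor \<open>s\<^sup>2\<close> is the Jacobian of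
  the inversion \<open>s \<mapsto> 1 / s\<close> and compensates the singularity at \<open>0\<close>.\<close>

lemma decay_of_harmonic_mean_bound:
  fixes A B K :: "real \<Rightarrow> ennreal"
  assumes [measurable]: "K \<in> borel_measurable borel"
    and anti: "\<And>r r'. 0 < r \<Longrightarrow> r \<le> r' \<Longrightarrow> K r' \<le> K r"
    and B1: "0 < B 1"
    and J: "(\<integral>\<^sup>+r. K r * indicator {0<..} r \<partial>lborel) \<le> ennreal J" "0 \<le> J"
    and le: "\<And>s d. 0 < s \<Longrightarrow> min (A s * ennreal (exp (d * s))) (B 1 * ennreal (exp (- d))) \<le> K (2 * s / (s + 1))"
  shows "\<exists>d C. \<forall>s>0. A s * ennreal (s\<^sup>2 * exp (d * s)) \<le> ennreal C"
proof -
  obtain \<beta> where \<beta>: "0 < \<beta>" "\<beta> \<le> 1" "ennreal \<beta> \<le> B 1"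
  proof (cases "B 1")
    case (real b)
    then show ?thesis using that[of "min b 1"] B1 by auto
  next
    case top
    then show ?thesis using that[of 1] by simp
  qed
  define J' where "J' = J + 1"
  define L where "L = ln (J' / \<beta>)"
  have J': "J < J'" "1 \<le> J'" using J(2) by (auto simp: J'_def)
  have expL: "exp L = J' / \<beta>" unfolding L_def using J' \<beta> by (intro exp_ln) auto
  have ratio: "1 \<le> J' / \<beta>" using J' \<beta> by (simp add: pos_le_divide_eq)
  have JJ: "0 \<le> J * (J' / \<beta>)" using J(2) ratio by (intro mult_nonneg_nonneg) auto
  have Ks: "K s \<le> ennreal (J / s)" if s: "0 < s" for s
  proof -
    have "K s * ennreal s = (\<integral>\<^sup>+r. K s * indicator {0<..<s} r \<partial>lborel)"
      using s by (simp add: nn_integral_cmult)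
    also have "\<dots> \<le> (\<integral>\<^sup>+r. K r * indicator {0<..} r \<partial>lborel)"
      by (intro nn_integral_mono) (auto split: split_indicator intro: anti)
    also have "\<dots> \<le> ennreal J" by (rule J)
    finally have *: "K s * ennreal s \<le> ennreal J" .
    show ?thesis
    proof (cases "K s")
      case (real k)
      then have "k * s \<le> J" using * s J(2) by (simp add: ennreal_le_iff flip: ennreal_mult)
      then have "k \<le> J / s" using s by (simp add: pos_le_divide_eq)
      then show ?thesis using real by (simp add: ennreal_leI)
    next
      case top
      then show ?thesis using * s by (simp add: ennreal_top_mult top_unique)
    qed
  qed
  have key: "A s * ennreal (exp (D * s)) \<le> ennreal k"
    if s: "0 < s" and Kr: "K (2 * s / (s + 1)) \<le> ennreal k" and k: "0 \<le> k" "k < \<beta> * exp (- D)" for s k D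
  proof -
    have "min (A s * ennreal (exp (D * s))) (B 1 * ennreal (exp (- D))) \<le> ennreal k"
      using le[OF s] Kr by (rule order_trans)
    moreover have "ennreal k < B 1 * ennreal (exp (- D))"
    proof -
      have "ennreal k < ennreal (\<beta> * exp (- D))" using k by (simp add: ennreal_less_iff)
      also have "\<dots> = ennreal \<beta> * ennreal (exp (- D))" using \<beta> by (simp add: ennreal_mult)
      also have "\<dots> \<le> B 1 * ennreal (exp (- D))" using \<beta> by (intro mult_right_mono) auto
      finally show ?thesis .
    qed
    ultimately show ?thesis by (metis min_def not_le)
  qed
  have "A s * ennreal (s\<^sup>2 * exp ((- L - 1) * s)) \<le> ennreal (2 * J + J * (J' / \<beta>))" if s: "0 < s" for s
  proof (cases "1 \<le> s")
    case True
    then have "1 \<le> 2 * s / (s + 1)" by (simp add: pos_le_divide_eq)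
    then have "K (2 * s / (s + 1)) \<le> K 1" by (intro anti) auto
    also have "\<dots> \<le> ennreal J" using Ks[of 1] by simp
    finally have "A s * ennreal (exp (- L * s)) \<le> ennreal J"
      by (rule key[OF s]) (use J J' expL \<beta> in auto)
    moreover have "s\<^sup>2 * exp (- s) \<le> 2"
    proof -
      have "s\<^sup>2 \<le> 2 * exp s" using exp_lower_Taylor_quadratic[of s] s by simp
      then show ?thesis by (simp add: exp_minus field_simps)
    qed
    ultimately have "A s * ennreal (exp (- L * s)) * ennreal (s\<^sup>2 * exp (- s)) \<le> ennreal J * ennreal 2"
      by (intro mult_mono ennreal_leI) auto
    also have "A s * ennreal (exp (- L * s)) * ennreal (s\<^sup>2 * exp (- s)) = A s * ennreal (s\<^sup>2 * exp ((- L - 1) * s))"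
    proof -
      have "exp ((- L - 1) * s) = exp (- L * s) * exp (- s)"
        unfolding exp_add[symmetric] by (rule arg_cong[where f=exp]) (simp add: algebra_simps)
      then have eq: "exp (- L * s) * (s\<^sup>2 * exp (- s)) = s\<^sup>2 * exp ((- L - 1) * s)" by simp
      show ?thesis
        unfolding mult.assoc eq[symmetric] by (subst (2) ennreal_mult) simp_all
    qed
    also have "ennreal J * ennreal 2 = ennreal (2 * J)"
      using J by (subst ennreal_mult[symmetric]) (simp_all add: mult.commute)
    also have "\<dots> \<le> ennreal (2 * J + J * (J' / \<beta>))" using JJ by (intro ennreal_leI) linarith
    finally show ?thesis .
  next
    case False
    define D where "D = - (L - ln s)"
    have "s \<le> 2 * s / (s + 1)" using s False by (simp add: pos_le_divide_eq field_simps mult_left_le)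
    then have "K (2 * s / (s + 1)) \<le> K s" using s by (intro anti) auto
    also have "\<dots> \<le> ennreal (J / s)" using Ks[OF s] .
    finally have Kr: "K (2 * s / (s + 1)) \<le> ennreal (J / s)" .
    have "exp (- D) = J' / \<beta> / s" using s expL by (simp add: D_def exp_diff)
    then have "J / s < \<beta> * exp (- D)" using J' \<beta> s by (simp add: divide_strict_right_mono)
    with Kr have "A s * ennreal (exp (D * s)) \<le> ennreal (J / s)"
      by (intro key[OF s]) (use J s in auto)
    moreover have "s\<^sup>2 * exp ((- L - 1) * s) \<le> exp (D * s) * (s * (J' / \<beta>))"
    proof -
      have "ln s \<le> s * ln s" using s False by (simp add: mult_le_cancel_right1)
      then have "s \<le> exp (s * ln s)" using s by (metis exp_le_cancel_iff exp_ln)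
      then have "s * exp (- s) \<le> exp (s * ln s) * (J' / \<beta>)"
        using ratio s by (intro mult_mono order_trans[OF _ ratio]) auto
      then have "exp (- L * s) * s * (s * exp (- s)) \<le> exp (- L * s) * s * (exp (s * ln s) * (J' / \<beta>))"
        using s by (intro mult_left_mono) auto
      moreover have "exp (- L * s) * s * (s * exp (- s)) = s\<^sup>2 * exp ((- L - 1) * s)"
      proof -
        have "exp ((- L - 1) * s) = exp (- L * s) * exp (- s)"
          unfolding exp_add[symmetric] by (rule arg_cong[where f=exp]) (simp add: algebra_simps)
        then show ?thesis by (simp add: power2_eq_square)
      qed
      moreover have "exp (D * s) = exp (- L * s) * exp (s * ln s)"
        unfolding exp_add[symmetric] D_def by (rule arg_cong[where f=exp]) (simp add: algebra_simps)
      ultimately show ?thesis by (simp add: mult.assoc mult.left_commute)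
    qed
    ultimately have "A s * ennreal (s\<^sup>2 * exp ((- L - 1) * s)) \<le> ennreal (J / s) * ennreal (s * (J' / \<beta>))"
    proof -
      assume 1: "A s * ennreal (exp (D * s)) \<le> ennreal (J / s)" and 2: "s\<^sup>2 * exp ((- L - 1) * s) \<le> exp (D * s) * (s * (J' / \<beta>))"
      have "A s * ennreal (s\<^sup>2 * exp ((- L - 1) * s)) \<le> A s * ennreal (exp (D * s) * (s * (J' / \<beta>)))"
        using 2 by (intro mult_left_mono ennreal_leI) auto
      also have "\<dots> = A s * ennreal (exp (D * s)) * ennreal (s * (J' / \<beta>))"
      proof -
        have "0 \<le> s * (J' / \<beta>)" using s ratio by (intro mult_nonneg_nonneg) auto
        then show ?thesis by (subst ennreal_mult) (auto simp: mult.assoc)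
      qed
      also have "\<dots> \<le> ennreal (J / s) * ennreal (s * (J' / \<beta>))"
        using 1 by (rule mult_right_mono) simp
      finally show ?thesis .
    qed
    also have "\<dots> = ennreal (J * (J' / \<beta>))"
      using s J ratio ennreal_mult[of "J / s" "s * (J' / \<beta>)"] mult_nonneg_nonneg[of s "J' / \<beta>"] by simp
    also have "\<dots> \<le> ennreal (2 * J + J * (J' / \<beta>))" using J by (intro ennreal_leI) auto
    finally show ?thesis .
  qed
  then show ?thesis by blast
qed

text \<open>For \<open>d < d0\<close> the supremum of \<open>a d\<close> is the smaller one, so the cut-off in \<open>core\<close> does not affect \<open>a d\<close>;
  monotone convergence as \<open>d\<close> increases to \<open>d0\<close> preserves this for \<open>a\<close>. The lemma is applied once to
  \<open>(a, b)\<close> and once, after reversing \<open>d\<close>, to \<open>(b, a)\<close>; whichever supremum is larger at \<open>d0\<close>,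
  one of the two results has no cut-off left. Working from both sides takes care of jumps of the
  suprema at \<open>d0\<close>, where one of them may become \<open>\<infinity>\<close>.\<close>

lemma balance_from_left:
  fixes a b :: "real \<Rightarrow> real \<Rightarrow> ennreal"
  assumes [measurable]: "\<And>d. a d \<in> borel_measurable borel" "\<And>d. b d \<in> borel_measurable borel"
    and a_mono: "\<And>d d' x. d \<le> d' \<Longrightarrow> a d x \<le> a d' x"
    and b_anti: "\<And>d d' x. d \<le> d' \<Longrightarrow> b d' x \<le> b d x"
    and a_left: "\<And>x. a d0 x = (SUP n. a (d0 - 1 / real (Suc n)) x)"
    and core: "\<And>d. (\<integral>\<^sup>+x. min (a d x) (min (SUP x. a d x) (SUP x. b d x)) \<partial>lborel)
        + (\<integral>\<^sup>+x. min (b d x) (min (SUP x. a d x) (SUP x. b d x)) \<partial>lborel) \<le> C"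
    and below: "\<And>d. d < d0 \<Longrightarrow> (SUP x. a d x) \<le> (SUP x. b d x)"
  shows "(\<integral>\<^sup>+x. a d0 x \<partial>lborel) + (\<integral>\<^sup>+x. min (b d0 x) (SUP x. a d0 x) \<partial>lborel) \<le> C"
proof -
  define e where "e n = d0 - 1 / real (Suc n)" for n
  have e_mono: "e m \<le> e n" if "m \<le> n" for m n
    using that unfolding e_def by (intro diff_left_mono divide_left_mono) simp_all
  have e_less: "e n < d0" for n unfolding e_def by simp
  define p where "p n = (SUP x. a (e n) x)" for n
  have p: "(SUP x. a d0 x) = (SUP n. p n)"
    unfolding p_def e_def a_left by (rule SUP_commute)
  have p_mono: "p m \<le> p n" if "m \<le> n" for m n
    unfolding p_def by (rule SUP_mono) (use a_mono[OF e_mono[OF that]] in blast)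
  have le: "(\<integral>\<^sup>+x. a (e n) x \<partial>lborel) + (\<integral>\<^sup>+x. min (b d0 x) (p n) \<partial>lborel) \<le> C" for n
  proof -
    have pn: "min (SUP x. a (e n) x) (SUP x. b (e n) x) = p n"
      unfolding p_def using below[OF e_less] by (rule min_absorb1)
    have "(\<integral>\<^sup>+x. a (e n) x \<partial>lborel) = (\<integral>\<^sup>+x. min (a (e n) x) (p n) \<partial>lborel)"
      unfolding p_def by (intro nn_integral_cong min_absorb1[symmetric] SUP_upper) simp
    moreover have "(\<integral>\<^sup>+x. min (b d0 x) (p n) \<partial>lborel) \<le> (\<integral>\<^sup>+x. min (b (e n) x) (p n) \<partial>lborel)"
      by (intro nn_integral_mono min.mono b_anti less_imp_le[OF e_less] order_refl)
    ultimately have "(\<integral>\<^sup>+x. a (e n) x \<partial>lborel) + (\<integral>\<^sup>+x. min (b d0 x) (p n) \<partial>lborel)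
        \<le> (\<integral>\<^sup>+x. min (a (e n) x) (p n) \<partial>lborel) + (\<integral>\<^sup>+x. min (b (e n) x) (p n) \<partial>lborel)"
      by (intro add_mono) simp_all
    also have "\<dots> \<le> C" using core[of "e n"] unfolding pn .
    finally show ?thesis .
  qed
  have "(\<integral>\<^sup>+x. a d0 x \<partial>lborel) = (SUP n. \<integral>\<^sup>+x. a (e n) x \<partial>lborel)"
    unfolding a_left e_def[symmetric]
    by (rule nn_integral_monotone_convergence_SUP, unfold incseq_def le_fun_def,
        intro allI impI a_mono e_mono) simp_all
  moreover have "(\<integral>\<^sup>+x. min (b d0 x) (SUP x. a d0 x) \<partial>lborel) = (SUP n. \<integral>\<^sup>+x. min (b d0 x) (p n) \<partial>lborel)"
  proof -
    have "min c (SUP n. p n) = (SUP n. min c (p n))" for c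
    proof (rule antisym)
      show "min c (SUP n. p n) \<le> (SUP n. min c (p n))"
      proof (rule dense_le)
        fix z assume "z < min c (SUP n. p n)"
        then obtain n where "z < c" "z < p n" by (auto simp: less_SUP_iff)
        then have "z \<le> min c (p n)" by (auto intro: less_imp_le)
        also have "\<dots> \<le> (SUP n. min c (p n))" by (rule SUP_upper) simp
        finally show "z \<le> (SUP n. min c (p n))" .
      qed
    next
      show "(SUP n. min c (p n)) \<le> min c (SUP n. p n)"
        by (intro SUP_least min.mono order_refl SUP_upper) simp
    qed
    then show ?thesis unfolding p
      by (simp only:, intro nn_integral_monotone_convergence_SUP,
          unfold incseq_def le_fun_def, intro allI impI min.mono order_refl p_mono) simp_all
  qed
  moreover have "(SUP n. \<integral>\<^sup>+x. a (e n) x \<partial>lborel) + (SUP n. \<integral>\<^sup>+x. min (b d0 x) (p n) \<partial>lborel)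
     = (SUP n. (\<integral>\<^sup>+x. a (e n) x \<partial>lborel) + (\<integral>\<^sup>+x. min (b d0 x) (p n) \<partial>lborel))"
  proof (rule ennreal_SUP_add[symmetric])
    show "incseq (\<lambda>n. \<integral>\<^sup>+x. a (e n) x \<partial>lborel)"
      unfolding incseq_def by (intro allI impI nn_integral_mono a_mono e_mono)
    show "incseq (\<lambda>n. \<integral>\<^sup>+x. min (b d0 x) (p n) \<partial>lborel)"
      unfolding incseq_def by (intro allI impI nn_integral_mono min.mono order_refl p_mono)
  qed
  ultimately show ?thesis using le by (simp only:) (rule SUP_least)
qed

lemma SUP_mult_exp_from_left:
  assumes "0 \<le> (x::real)"
  shows "c * ennreal (exp (d * x)) = (SUP n. c * ennreal (exp ((d - 1 / real (Suc n)) * x)))"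
proof -
  let ?X = "\<lambda>n. ennreal (exp ((d - 1 / real (Suc n)) * x))"
  have "incseq ?X"
    unfolding incseq_def
  proof (intro allI impI)
    fix m n :: nat assume "m \<le> n"
    then have "1 / real (Suc n) \<le> 1 / real (Suc m)" by (intro divide_left_mono) auto
    then have "(d - 1 / real (Suc m)) * x \<le> (d - 1 / real (Suc n)) * x"
      using assms by (intro mult_right_mono) linarith+
    then show "?X m \<le> ?X n" by (intro ennreal_leI) (simp only: exp_le_cancel_iff)
  qed
  then have "?X \<longlonglongrightarrow> (SUP n. ?X n)"
    by (rule LIMSEQ_SUP)
  moreover have "?X \<longlonglongrightarrow> ennreal (exp ((d - 0) * x))"
    by (intro tendsto_ennrealI tendsto_exp tendsto_mult tendsto_diff tendsto_const LIMSEQ_Suc[OF lim_1_over_n])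
  ultimately have "ennreal (exp ((d - 0) * x)) = (SUP n. ?X n)"
    by (metis LIMSEQ_unique)
  then have "ennreal (exp (d * x)) = (SUP n. ?X n)" by (simp only: diff_zero)
  then show ?thesis by (simp only: SUP_mult_left_ennreal)
qed

text \<open>With \<open>x = 1 / s\<close> and \<open>y = 1 / t\<close>, the shift of \<open>d\<close> by \<open>y - x\<close> pays for the Jacobians \<open>1 / x\<^sup>2\<close> of the
  inversion. It is the inequality between weighted geometric and harmonic means, in the form
  \<open>1 + u \<le> exp u\<close> at \<open>u = (y - x) / (2x)\<close>.\<close>

lemma harmonic_weight_inequality:
  fixes x y c :: real
  assumes "0 < x" "0 < y"
  shows "1 / x\<^sup>2 * exp (c * (1 / x)) \<le> 1 / ((x + y) / 2)\<^sup>2 * exp ((c + y - x) * (1 / x))"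
proof -
  let ?u = "(y - x) / (2 * x)"
  have "(x + y) / 2 / x = 1 + ?u" using assms by (simp add: field_simps)
  also have "\<dots> \<le> exp ?u" by (rule exp_ge_add_one_self)
  finally have "((x + y) / 2 / x)\<^sup>2 \<le> (exp ?u)\<^sup>2"
    using assms by (intro power_mono) auto
  also have "(exp ?u)\<^sup>2 = exp (2 * ?u)" by (simp only: exp_double)
  also have "2 * ?u = (y - x) * (1 / x)" using assms by (simp add: field_simps)
  finally have "((x + y) / 2)\<^sup>2 / x\<^sup>2 \<le> exp ((y - x) * (1 / x))" by (simp only: power_divide)
  then have "1 / x\<^sup>2 \<le> 1 / ((x + y) / 2)\<^sup>2 * exp ((y - x) * (1 / x))"
    using assms by (simp add: pos_le_divide_eq pos_divide_le_eq mult.commute)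
  then have "1 / x\<^sup>2 * exp (c * (1 / x)) \<le> 1 / ((x + y) / 2)\<^sup>2 * exp ((y - x) * (1 / x)) * exp (c * (1 / x))"
    by (rule mult_right_mono) simp
  also have "\<dots> = 1 / ((x + y) / 2)\<^sup>2 * exp ((c + y - x) * (1 / x))"
  proof -
    have "(c + y - x) * (1 / x) = (y - x) * (1 / x) + c * (1 / x)" by (simp only: distrib_right[symmetric]) simp
    then show ?thesis by (simp only: exp_add mult.assoc)
  qed
  finally show ?thesis .
qed

text \<open>The inversion \<open>s \<mapsto> 1 / s\<close> turns harmonic means into arithmetic means. The transformed functions
  satisfy the hypothesis of \<open>brunn_minkowski_functions\<close> for every tilt \<open>d\<close>, and it remains to
  find a tilt at which the suprema of the two functions agree, or at least change their order,
  since then cutting at the smaller height loses nothing (\<open>balance_from_left\<close>). This is the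
  supremum \<open>d0\<close> of the tilts for which the supremum belonging to \<open>A\<close> is not the larger one; it is
  finite because each supremum is finite for some tilt
  (\<open>decay_of_harmonic_mean_bound\<close>) and unbounded in the opposite direction.\<close>

theorem ball_harmonic_mean:
  fixes A B K :: "real \<Rightarrow> ennreal"
  assumes [measurable]: "A \<in> borel_measurable borel" "B \<in> borel_measurable borel" "K \<in> borel_measurable borel"
    and posA: "\<And>s. 0 < s \<Longrightarrow> 0 < A s" and posB: "\<And>s. 0 < s \<Longrightarrow> 0 < B s"
    and anti: "\<And>r r'. 0 < r \<Longrightarrow> r \<le> r' \<Longrightarrow> K r' \<le> K r"
    and fin: "(\<integral>\<^sup>+r. K r * indicator {0<..} r \<partial>lborel) \<noteq> \<infinity>"
    and le: "\<And>s t d. 0 < s \<Longrightarrow> 0 < t \<Longrightarrow>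
      min (A s * ennreal (exp (d * s))) (B t * ennreal (exp (- d * t))) \<le> K (2 * s * t / (s + t))"
  shows "\<exists>d. (\<integral>\<^sup>+s. A s * ennreal (exp (d * s)) * indicator {0<..} s \<partial>lborel)
      + (\<integral>\<^sup>+s. B s * ennreal (exp (- d * s)) * indicator {0<..} s \<partial>lborel)
     \<le> 2 * (\<integral>\<^sup>+r. K r * indicator {0<..} r \<partial>lborel)"
proof -
  let ?J = "\<integral>\<^sup>+r. K r * indicator {0<..} r \<partial>lborel"
  obtain J where J: "?J = ennreal J" "0 \<le> J" using fin by (cases ?J) auto
  define w where "w x = ennreal (1 / x\<^sup>2) * indicator {0<..} x" for x :: real
  have [measurable]: "w \<in> borel_measurable borel" unfolding w_def by measurable
  define a where "a d x = A (1 / x) * w x * ennreal (exp (d * (1 / x)))" for d x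
  define b where "b d x = B (1 / x) * w x * ennreal (exp (- d * (1 / x)))" for d x
  define k where "k x = K (1 / x) * w x" for x
  have [measurable]: "a d \<in> borel_measurable borel" "b d \<in> borel_measurable borel" "k \<in> borel_measurable borel" for d
    unfolding a_def b_def k_def by measurable
  have int_a: "(\<integral>\<^sup>+s. A s * ennreal (exp (d * s)) * indicator {0<..} s \<partial>lborel) = (\<integral>\<^sup>+x. a d x \<partial>lborel)" for d
    by (subst nn_integral_inverse_substitution, measurable) (rule nn_integral_cong, simp only: a_def w_def mult_ac)
  have int_b: "(\<integral>\<^sup>+s. B s * ennreal (exp (- d * s)) * indicator {0<..} s \<partial>lborel) = (\<integral>\<^sup>+x. b d x \<partial>lborel)" for d
    by (subst nn_integral_inverse_substitution, measurable) (rule nn_integral_cong, simp only: b_def w_def mult_ac)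
  have int_k: "?J = (\<integral>\<^sup>+x. k x \<partial>lborel)"
    by (subst nn_integral_inverse_substitution, measurable) (rule nn_integral_cong, simp only: k_def w_def mult_ac)
  have w0: "w x = 0" if "x \<le> 0" for x using that by (simp add: w_def)
  have conv: "min (a d x) (b d y) \<le> k (1/2 * x + (1 - 1/2) * y)" for d x y
  proof (cases "0 < x \<and> 0 < y")
    case False
    then have "a d x = 0 \<or> b d y = 0" unfolding a_def b_def using w0[of x] w0[of y] by auto
    then show ?thesis by auto
  next
    case True
    define z where "z = (x + y) / 2"
    have z: "0 < z" "1/2 * x + (1 - 1/2) * y = z" using True by (auto simp: z_def)
    have mw: "min (p * q) (r * q) \<le> min p r * q" for p q r :: ennreal
      using linear[of p r] by (elim disjE) (simp_all only: min.absorb1 min.absorb2 min.cobounded1 min.cobounded2)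
    have W: "ennreal p * ennreal (exp u) \<le> ennreal q * ennreal (exp v)"
      if "p * exp u \<le> q * exp v" "0 \<le> p" "0 \<le> q" for p q u v
      using ennreal_leI[OF that(1)] that(2,3) by (simp add: ennreal_mult)
    have wx: "w x = ennreal (1 / x\<^sup>2)" "w y = ennreal (1 / y\<^sup>2)" "w z = ennreal (1 / z\<^sup>2)"
      using True z by (auto simp: w_def)
    have "w x * ennreal (exp (d * (1 / x))) \<le> w z * ennreal (exp ((d + y - x) * (1 / x)))"
      unfolding wx using harmonic_weight_inequality[of x y d, folded z_def] True by (intro W) auto
    then have "A (1 / x) * (w x * ennreal (exp (d * (1 / x)))) \<le> A (1 / x) * (w z * ennreal (exp ((d + y - x) * (1 / x))))"
      by (rule mult_left_mono) simp
    then have a: "a d x \<le> A (1 / x) * ennreal (exp ((d + y - x) * (1 / x))) * w z"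
      by (simp only: a_def mult_ac)
    have eq: "(y + x) / 2 = z" "- d + x - y = - (d + y - x)" by (simp_all add: z_def)
    have "w y * ennreal (exp (- d * (1 / y))) \<le> w z * ennreal (exp (- (d + y - x) * (1 / y)))"
      unfolding wx by (rule W, rule harmonic_weight_inequality[of y x "- d", unfolded eq]) (use True in simp_all)
    then have "B (1 / y) * (w y * ennreal (exp (- d * (1 / y)))) \<le> B (1 / y) * (w z * ennreal (exp (- (d + y - x) * (1 / y))))"
      by (rule mult_left_mono) simp
    then have b: "b d y \<le> B (1 / y) * ennreal (exp (- (d + y - x) * (1 / y))) * w z"
      by (simp only: b_def mult_ac)
    have "min (a d x) (b d y) \<le>
        min (A (1 / x) * ennreal (exp ((d + y - x) * (1 / x))) * w z) (B (1 / y) * ennreal (exp (- (d + y - x) * (1 / y))) * w z)"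
      using a b by (rule min.mono)
    also have "\<dots> \<le> min (A (1 / x) * ennreal (exp ((d + y - x) * (1 / x)))) (B (1 / y) * ennreal (exp (- (d + y - x) * (1 / y)))) * w z"
      by (rule mw)
    also have "\<dots> \<le> K (2 * (1 / x) * (1 / y) / (1 / x + 1 / y)) * w z"
      using True by (intro mult_right_mono le) auto
    also have "2 * (1 / x) * (1 / y) / (1 / x + 1 / y) = 1 / z"
      using True by (simp add: z_def field_simps)
    finally show ?thesis unfolding z(2) k_def .
  qed
  define P where "P d = (SUP x. a d x)" for d
  define Q where "Q d = (SUP x. b d x)" for d
  have core: "(\<integral>\<^sup>+x. min (a d x) (min (P d) (Q d)) \<partial>lborel)
        + (\<integral>\<^sup>+x. min (b d x) (min (P d) (Q d)) \<partial>lborel) \<le> 2 * ?J" for d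
  proof -
    let ?X = "\<integral>\<^sup>+x. min (a d x) (min (P d) (Q d)) \<partial>lborel"
    let ?Y = "\<integral>\<^sup>+x. min (b d x) (min (P d) (Q d)) \<partial>lborel"
    have "ennreal (1/2) * ?X + ennreal (1 - 1/2) * ?Y \<le> (\<integral>\<^sup>+x. k x \<partial>lborel)"
    proof (rule brunn_minkowski_functions)
      show "\<exists>x. m < a d x" "\<exists>x. m < b d x" if "m < min (P d) (Q d)" for m
        using that by (auto simp: P_def Q_def less_SUP_iff)
    qed (use conv in auto)
    then have "2 * (ennreal (1/2) * ?X + ennreal (1 - 1/2) * ?Y) \<le> 2 * ?J"
      unfolding int_k by (rule mult_left_mono) simp
    also have "2 * (ennreal (1/2) * ?X + ennreal (1 - 1/2) * ?Y) = ?X + ?Y"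
    proof -
      have "2 * ennreal (1/2) = 1" "2 * ennreal (1 - 1/2) = 1"
        using ennreal_mult[of 2 "1/2"] by simp_all
      then show ?thesis by (simp only: distrib_left mult.assoc[symmetric] mult_1_left)
    qed
    finally show ?thesis .
  qed
  have a_mono: "a d x \<le> a d' x" if "d \<le> d'" for d d' x
  proof (cases "0 < x")
    case True
    then show ?thesis unfolding a_def using that
      by (intro mult_left_mono ennreal_leI) (auto intro!: divide_right_mono)
  qed (simp add: a_def w0)
  have b_anti: "b d' x \<le> b d x" if "d \<le> d'" for d d' x
  proof (cases "0 < x")
    case True
    then show ?thesis unfolding b_def using that
      by (intro mult_left_mono ennreal_leI) (auto intro!: divide_right_mono)
  qed (simp add: b_def w0)
  have P_mono: "P d \<le> P d'" if "d \<le> d'" for d d'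
    unfolding P_def by (rule SUP_mono) (use a_mono[OF that] in blast)
  have Q_anti: "Q d' \<le> Q d" if "d \<le> d'" for d d'
    unfolding Q_def by (rule SUP_mono) (use b_anti[OF that] in blast)
  obtain d1 C1 where "\<forall>s>0. A s * ennreal (s\<^sup>2 * exp (d1 * s)) \<le> ennreal C1"
    using decay_of_harmonic_mean_bound[of K B J A] anti posB[of 1] J le[of _ 1] by auto
  then have P1: "P d1 \<le> ennreal C1"
    unfolding P_def
  proof (intro SUP_least)
    fix x assume C: "\<forall>s>0. A s * ennreal (s\<^sup>2 * exp (d1 * s)) \<le> ennreal C1"
    show "a d1 x \<le> ennreal C1"
    proof (cases "0 < x")
      case True
      have "a d1 x = A (1 / x) * ennreal ((1 / x)\<^sup>2 * exp (d1 * (1 / x)))"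
      proof -
        have "ennreal (1 / x\<^sup>2) * ennreal (exp (d1 * (1 / x))) = ennreal ((1 / x)\<^sup>2 * exp (d1 * (1 / x)))"
          by (subst ennreal_mult[symmetric]) (simp_all add: power_divide)
        then show ?thesis using True by (simp add: a_def w_def mult.assoc)
      qed
      then show ?thesis using C[rule_format, of "1 / x"] True by (simp only: zero_less_divide_1_iff)
    qed (simp add: a_def w0)
  qed
  obtain d2 C2 where "\<forall>s>0. B s * ennreal (s\<^sup>2 * exp (d2 * s)) \<le> ennreal C2"
  proof -
    have "min (B s * ennreal (exp (d * s))) (A 1 * ennreal (exp (- d))) \<le> K (2 * s / (s + 1))" if "0 < s" for s d
      using le[of 1 s "- d"] that by (simp add: min.commute add.commute)
    then show ?thesis
      using that decay_of_harmonic_mean_bound[of K A J B] anti posA[of 1] J by auto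
  qed
  then have Q2: "Q (- d2) \<le> ennreal C2"
    unfolding Q_def
  proof (intro SUP_least)
    fix x assume C: "\<forall>s>0. B s * ennreal (s\<^sup>2 * exp (d2 * s)) \<le> ennreal C2"
    show "b (- d2) x \<le> ennreal C2"
    proof (cases "0 < x")
      case True
      have "b (- d2) x = B (1 / x) * ennreal ((1 / x)\<^sup>2 * exp (d2 * (1 / x)))"
      proof -
        have "ennreal (1 / x\<^sup>2) * ennreal (exp (d2 * (1 / x))) = ennreal ((1 / x)\<^sup>2 * exp (d2 * (1 / x)))"
          by (subst ennreal_mult[symmetric]) (simp_all add: power_divide)
        then show ?thesis using True by (simp add: b_def w_def mult.assoc)
      qed
      then show ?thesis using C[rule_format, of "1 / x"] True by (simp only: zero_less_divide_1_iff)
    qed (simp add: b_def w0)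
  qed
  have blow_up: "\<exists>l. \<forall>d\<ge>l. ennreal C < v * ennreal (exp d)" if v: "0 < v" for v :: ennreal and C
  proof -
    obtain r where r: "0 < r" "ennreal r \<le> v"
    proof (cases v)
      case (real r) then show ?thesis using that[of r] v by auto
    next
      case top then show ?thesis using that[of 1] by simp
    qed
    have "ennreal C < v * ennreal (exp d)" if d: "ln ((max C 0 + 1) / r) \<le> d" for d
    proof -
      have "(max C 0 + 1) / r = exp (ln ((max C 0 + 1) / r))" using r by simp
      also have "\<dots> \<le> exp d" using d by simp
      finally have "(max C 0 + 1) / r \<le> exp d" .
      then have "max C 0 < r * exp d" using r by (simp add: pos_divide_le_eq mult.commute)
      then have "ennreal C < ennreal (r * exp d)" by (intro ennreal_lessI) (use r in auto)
      also have "\<dots> = ennreal r * ennreal (exp d)" using r by (simp add: ennreal_mult)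
      also have "\<dots> \<le> v * ennreal (exp d)" using r by (intro mult_right_mono) auto
      finally show ?thesis .
    qed
    then show ?thesis by blast
  qed
  have a1: "A 1 * ennreal (exp d) \<le> P d" for d
    using SUP_upper[of 1 UNIV "a d"] by (simp add: a_def w_def P_def)
  have b1: "B 1 * ennreal (exp (- d)) \<le> Q d" for d
    using SUP_upper[of 1 UNIV "b d"] by (simp add: b_def w_def Q_def)
  \<comment> \<open>The set \<open>D\<close> is an interval that extends to the left; its right end point is the balancing tilt.\<close>
  define D where "D = {d. P d \<le> Q d}"
  have "D \<noteq> {}"
  proof -
    obtain l where l: "\<forall>d\<ge>l. ennreal C1 < B 1 * ennreal (exp d)" using blow_up[OF posB[of 1]] by auto
    define d where "d = min d1 (- l)"
    have "P d \<le> P d1" by (rule P_mono) (simp add: d_def)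
    also note P1
    also have "ennreal C1 \<le> B 1 * ennreal (exp (- d))"
      using l by (auto simp: d_def intro: less_imp_le)
    also note b1
    finally show ?thesis unfolding D_def by blast
  qed
  have bdd: "bdd_above D"
  proof -
    obtain l where l: "\<forall>d\<ge>l. ennreal C2 < A 1 * ennreal (exp d)" using blow_up[OF posA[of 1]] by auto
    have "d \<le> max l (- d2)" if "d \<in> D" for d
    proof (rule ccontr)
      assume "\<not> ?thesis"
      then have d: "l \<le> d" "- d2 \<le> d" by auto
      have "ennreal C2 < A 1 * ennreal (exp d)" using l d by auto
      also note a1
      also have "P d \<le> Q d" using that by (simp add: D_def)
      also have "Q d \<le> Q (- d2)" by (rule Q_anti) (rule d)
      also note Q2
      finally show False by simp
    qed
    then show ?thesis by (rule bdd_aboveI)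
  qed
  define d0 where "d0 = Sup D"
  have below: "P d \<le> Q d" if d: "d < d0" for d
  proof -
    obtain d' where "d' \<in> D" "d < d'" using d less_cSup_iff[OF \<open>D \<noteq> {}\<close> bdd] unfolding d0_def by auto
    then have "P d \<le> P d'" "P d' \<le> Q d'" "Q d' \<le> Q d" by (auto simp: D_def intro: P_mono Q_anti)
    then show ?thesis by (meson order_trans)
  qed
  have above: "Q d \<le> P d" if "d0 < d" for d
  proof -
    have "d \<notin> D" using that cSup_upper[OF _ bdd] unfolding d0_def by (meson not_le)
    then show ?thesis by (simp add: D_def)
  qed
  have a_left: "a d x = (SUP n. a (d - 1 / real (Suc n)) x)" for d x
  proof (cases "0 < x")
    case True
    then show ?thesis unfolding a_def by (intro SUP_mult_exp_from_left) simp
  qed (simp add: a_def w0)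
  have b_left: "b (- d) x = (SUP n. b (- (d - 1 / real (Suc n))) x)" for d x
  proof (cases "0 < x")
    case True
    then show ?thesis unfolding b_def minus_minus by (intro SUP_mult_exp_from_left) simp
  qed (simp add: b_def w0)
  have left: "(\<integral>\<^sup>+x. a d0 x \<partial>lborel) + (\<integral>\<^sup>+x. min (b d0 x) (P d0) \<partial>lborel) \<le> 2 * ?J"
    unfolding P_def
  proof (rule balance_from_left[where a=a and b=b])
    show "a d0 x = (SUP n. a (d0 - 1 / real (Suc n)) x)" for x by (rule a_left)
    show "(SUP x. a d x) \<le> (SUP x. b d x)" if "d < d0" for d
      using below[OF that] unfolding P_def Q_def .
    show "(\<integral>\<^sup>+x. min (a d x) (min (SUP x. a d x) (SUP x. b d x)) \<partial>lborel)
        + (\<integral>\<^sup>+x. min (b d x) (min (SUP x. a d x) (SUP x. b d x)) \<partial>lborel) \<le> 2 * ?J" for d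
      using core[of d] unfolding P_def Q_def .
  qed (use a_mono b_anti in simp_all)
  have right: "(\<integral>\<^sup>+x. b (- (- d0)) x \<partial>lborel) + (\<integral>\<^sup>+x. min (a (- (- d0)) x) (SUP x. b (- (- d0)) x) \<partial>lborel) \<le> 2 * ?J"
  proof (rule balance_from_left[where a="\<lambda>d. b (- d)" and b="\<lambda>d. a (- d)" and ?d0.0 = "- d0"])
    fix d
    show "(\<integral>\<^sup>+x. min (b (- d) x) (min (SUP x. b (- d) x) (SUP x. a (- d) x)) \<partial>lborel)
        + (\<integral>\<^sup>+x. min (a (- d) x) (min (SUP x. b (- d) x) (SUP x. a (- d) x)) \<partial>lborel) \<le> 2 * ?J"
      using core[of "- d"] unfolding P_def[symmetric] Q_def[symmetric] by (simp only: min.commute add.commute)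
    assume "d < - d0"
    then show "(SUP x. b (- d) x) \<le> (SUP x. a (- d) x)"
      using above[of "- d"] by (simp add: P_def Q_def)
  next
    show "b (- (- d0)) x = (SUP n. b (- (- d0 - 1 / real (Suc n))) x)" for x by (rule b_left)
  qed (use a_mono b_anti in simp_all)
  have "(\<integral>\<^sup>+x. a d0 x \<partial>lborel) + (\<integral>\<^sup>+x. b d0 x \<partial>lborel) \<le> 2 * ?J"
  proof (cases "Q d0 \<le> P d0")
    case True
    have "b d0 x \<le> P d0" for x
      using True SUP_upper[of x UNIV "b d0"] unfolding Q_def by (auto intro: order_trans)
    then show ?thesis using left by (simp add: min_absorb1)
  next
    case False
    then have PQ: "P d0 \<le> Q d0" by simp
    have "a d0 x \<le> Q d0" for x
      using PQ SUP_upper[of x UNIV "a d0"] unfolding P_def by (auto intro: order_trans)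
    then show ?thesis using right unfolding minus_minus Q_def[symmetric] by (simp add: min_absorb1 add.commute)
  qed
  then show ?thesis unfolding int_a[symmetric] int_b[symmetric] by blast
qed


section \<open>The essential polar\<close>

lemma le_ess_polar:
  assumes "AE y in lborel. c * g y \<le> ennreal (exp (- (x \<bullet> y)))"
  shows "c \<le> ess_polar g x"
  unfolding ess_polar_def essinf_def using assms
  by (intro Sup_upper) (simp add: le_exp_divide_iff)

lemma AE_less_ess_polar:
  assumes "c < ess_polar g x"
  shows "AE y in lborel. c * g y \<le> ennreal (exp (- (x \<bullet> y)))"
proof -
  obtain e where e: "AE y in lborel. e \<le> ennreal (exp (- (x \<bullet> y))) / g y" "c < e"
    using assms unfolding ess_polar_def essinf_def less_Sup_iff by auto
  from e(1) show ?thesis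
  proof eventually_elim
    case (elim y)
    then show ?case using e(2) by (meson le_exp_divide_iff less_imp_le order_trans)
  qed
qed

text \<open>The polar is upper semicontinuous: an inequality that holds almost everywhere for each member
  of a convergent sequence holds almost everywhere for all of them at once, hence for the limit.\<close>

lemma borel_measurable_ess_polar[measurable]: "ess_polar g \<in> borel_measurable borel"
proof (rule borel_measurableI_ge)
  fix c
  have "closed {x. c \<le> ess_polar g x}"
    unfolding closed_sequential_limits
  proof (intro allI impI, elim conjE)
    fix X l assume X: "\<forall>n. X n \<in> {x. c \<le> ess_polar g x}" "X \<longlonglongrightarrow> l"
    have "c \<le> ess_polar g l"
    proof (rule dense_le)
      fix e assume "e < c"
      then have "\<forall>n. e < ess_polar g (X n)" using X(1) by (auto intro: less_le_trans)
      then have "AE y in lborel. \<forall>n. e * g y \<le> ennreal (exp (- (X n \<bullet> y)))"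
        unfolding AE_all_countable by (blast intro: AE_less_ess_polar)
      then have "AE y in lborel. e * g y \<le> ennreal (exp (- (l \<bullet> y)))"
      proof eventually_elim
        case (elim y)
        have lim: "(\<lambda>n. ennreal (exp (- (X n \<bullet> y)))) \<longlonglongrightarrow> ennreal (exp (- (l \<bullet> y)))"
          using X(2) by (intro tendsto_ennrealI tendsto_exp tendsto_minus tendsto_inner tendsto_const)
        show ?case by (rule LIMSEQ_le_const[OF lim]) (use elim in blast)
      qed
      then show "e \<le> ess_polar g l" by (rule le_ess_polar)
    qed
    then show "l \<in> {x. c \<le> ess_polar g x}" by simp
  qed
  then show "{x \<in> space borel. c \<le> ess_polar g x} \<in> sets borel" by simp
qed

text \<open>The exceptional null set in the definition of the essential infimum depends on \<open>x\<close>. It can be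
  chosen independently of \<open>x\<close>: a countable dense subset of the region below the graph of the polar
  determines all the inequalities, because each of them is a closed condition.\<close>

lemma AE_ess_polar_all:
  fixes g :: "real ^ 'n \<Rightarrow> ennreal"
  shows "AE y in lborel. \<forall>x. ess_polar g x * g y \<le> ennreal (exp (- (x \<bullet> y)))"
proof -
  define H where "H = {(x, c::real). 0 \<le> c \<and> ennreal c < ess_polar g x}"
  obtain D where D: "countable D" "D \<subseteq> H" "H \<subseteq> closure D"
    using separable by blast
  have "AE y in lborel. \<forall>xc\<in>D. ennreal (snd xc) * g y \<le> ennreal (exp (- (fst xc \<bullet> y)))"
    using D(1,2) by (subst AE_ball_countable) (auto simp: H_def intro!: AE_less_ess_polar)
  then show ?thesis
  proof eventually_elim
    case (elim y)
    define C where "C = {xc. ennreal (snd xc) * g y \<le> ennreal (exp (- (fst xc \<bullet> y)))} \<inter> {xc. 0 \<le> snd xc}"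
    have "closed C"
    proof (cases "g y")
      case (real r)
      have "C = {xc. snd xc * r \<le> exp (- (fst xc \<bullet> y))} \<inter> {xc. 0 \<le> snd xc}"
        using real unfolding C_def by (auto simp: ennreal_le_iff simp flip: ennreal_mult)
      also have "closed \<dots>"
        by (intro closed_Int closed_Collect_le continuous_intros)
      finally show ?thesis .
    next
      case top
      have "C = {xc. snd xc = 0}"
        using top unfolding C_def by (auto simp: ennreal_mult_top top_unique split: if_splits)
      also have "closed \<dots>" by (intro closed_Collect_eq continuous_intros)
      finally show ?thesis .
    qed
    moreover have "D \<subseteq> C" using elim D(2) by (auto simp: C_def H_def)
    ultimately have HC: "H \<subseteq> C" using D(3) closure_minimal by blast
    show ?case
    proof
      fix x
      show "ess_polar g x * g y \<le> ennreal (exp (- (x \<bullet> y)))"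
        unfolding le_exp_divide_iff[symmetric]
      proof (rule dense_le)
        fix z assume z: "z < ess_polar g x"
        then obtain c where c: "0 \<le> c" "z = ennreal c" by (cases z) auto
        then have "(x, c) \<in> C" using z HC by (auto simp: H_def)
        then show "z \<le> ennreal (exp (- (x \<bullet> y))) / g y"
          unfolding le_exp_divide_iff using c by (simp add: C_def)
      qed
    qed
  qed
qed

lemma AE_lborel_translate:
  fixes z :: "'a::euclidean_space"
  assumes "AE y in lborel. P y"
  shows "AE y in lborel. P (y - z)"
proof -
  have "AE y in distr lborel borel ((+) (- z)). P y"
    unfolding lborel_distr_plus by (rule assms)
  then have "AE y in lborel. P (- z + y)" by (rule AE_distrD[rotated]) simp
  then show ?thesis by simp
qed

lemma ess_polar_translate_ge:
  "ess_polar g x * ennreal (exp (- (x \<bullet> z))) \<le> ess_polar (translate z g) x"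
proof (rule le_ess_polar)
  from AE_lborel_translate[OF AE_ess_polar_all, of g z]
  show "AE y in lborel. ess_polar g x * ennreal (exp (- (x \<bullet> z))) * translate z g y \<le> ennreal (exp (- (x \<bullet> y)))"
  proof eventually_elim
    case (elim y)
    have "ess_polar g x * ennreal (exp (- (x \<bullet> z))) * translate z g y =
        ess_polar g x * g (y - z) * ennreal (exp (- (x \<bullet> z)))"
      by (simp add: translate_def mult_ac)
    also have "\<dots> \<le> ennreal (exp (- (x \<bullet> (y - z)))) * ennreal (exp (- (x \<bullet> z)))"
      using elim by (intro mult_right_mono) auto
    also have "\<dots> = ennreal (exp (- (x \<bullet> (y - z))) * exp (- (x \<bullet> z)))"
      by (rule ennreal_mult[symmetric]) simp_all
    also have "exp (- (x \<bullet> (y - z))) * exp (- (x \<bullet> z)) = exp (- (x \<bullet> y))"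
      unfolding exp_add[symmetric] by (simp add: inner_diff_right)
    finally show ?case .
  qed
qed

lemma translate_translate: "translate w (translate z g) = translate (w + z) g"
  by (simp add: translate_def fun_eq_iff algebra_simps)

lemma ess_polar_translate:
  "ess_polar (translate z g) x = ess_polar g x * ennreal (exp (- (x \<bullet> z)))"
proof (rule antisym[OF _ ess_polar_translate_ge])
  have e: "ennreal (exp (x \<bullet> z)) * ennreal (exp (- (x \<bullet> z))) = 1"
    by (simp add: exp_minus flip: ennreal_mult)
  have "translate (- z) (translate z g) = g"
    by (simp add: translate_def fun_eq_iff)
  then have "ess_polar (translate z g) x * ennreal (exp (x \<bullet> z)) \<le> ess_polar g x"
    using ess_polar_translate_ge[of "translate z g" x "- z"] by simp
  then have "ess_polar (translate z g) x * ennreal (exp (x \<bullet> z)) * ennreal (exp (- (x \<bullet> z)))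
     \<le> ess_polar g x * ennreal (exp (- (x \<bullet> z)))"
    by (rule mult_right_mono) simp
  then show "ess_polar (translate z g) x \<le> ess_polar g x * ennreal (exp (- (x \<bullet> z)))"
    unfolding mult.assoc e by simp
qed

definition min_polar_mass :: "(real ^ 'n \<Rightarrow> ennreal) \<Rightarrow> ennreal" where
  "min_polar_mass g = (INF z. \<integral>\<^sup>+x. ess_polar (translate z g) x \<partial>lborel)"

lemma min_polar_mass_translate: "min_polar_mass g \<le> min_polar_mass (translate z g)"
  unfolding min_polar_mass_def by (rule INF_mono) (auto simp: translate_translate)

section \<open>Heating in one direction\<close>

definition directional_heat :: "real \<Rightarrow> real ^ 'n \<Rightarrow> (real ^ 'n \<Rightarrow> ennreal) \<Rightarrow> real ^ 'n \<Rightarrow> ennreal" where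
  "directional_heat t b f x =
     (\<integral>\<^sup>+u. f (x - u *\<^sub>R b) * ennreal (exp (- u\<^sup>2 / (2 * t)) / sqrt (2 * pi * t)) \<partial>lborel)"

lemma borel_measurable_directional_heat[measurable]:
  assumes [measurable]: "f \<in> borel_measurable borel"
  shows "directional_heat t b f \<in> borel_measurable borel"
proof -
  have "(\<lambda>x. \<integral>\<^sup>+u. f (x - u *\<^sub>R b) * ennreal (exp (- u\<^sup>2 / (2 * t)) / sqrt (2 * pi * t)) \<partial>lborel) \<in> borel_measurable borel"
    by measurable
  then show ?thesis unfolding directional_heat_def[abs_def] .
qed

lemma directional_heat_translate:
  "directional_heat t b (translate z f) = translate z (directional_heat t b f)"
  by (simp add: directional_heat_def translate_def fun_eq_iff algebra_simps)

text \<open>A null set may contain whole lines, so the heated functions can differ; by Fubini's theorem they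
  do so only for almost no \<open>x\<close>, which the essential polar does not see.\<close>

lemma directional_heat_cong_AE:
  fixes f g :: "real ^ 'n \<Rightarrow> ennreal"
  assumes [measurable]: "N \<in> null_sets lborel" and eq: "\<And>y. y \<notin> N \<Longrightarrow> f y = g y"
  shows "AE x in lborel. directional_heat t b f x = directional_heat t b g x"
proof -
  have [measurable]: "N \<in> sets borel" using assms(1) by auto
  have "(\<integral>\<^sup>+x. (\<integral>\<^sup>+u. indicator N (x - u *\<^sub>R b) \<partial>lborel) \<partial>lborel)
      = (\<integral>\<^sup>+u. (\<integral>\<^sup>+x. indicator N (x - u *\<^sub>R b) \<partial>lborel) \<partial>(lborel :: real measure))"
    by (rule lborel_pair.Fubini') measurable
  also have "\<dots> = (\<integral>\<^sup>+u. 0 \<partial>(lborel :: real measure))"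
  proof (rule nn_integral_cong)
    fix u :: real
    have "AE x in lborel. x \<notin> N" using assms(1) by (rule AE_not_in)
    then have "AE x in lborel. x - u *\<^sub>R b \<notin> N" by (rule AE_lborel_translate)
    then show "(\<integral>\<^sup>+x. indicator N (x - u *\<^sub>R b) \<partial>lborel) = (0::ennreal)"
      by (subst nn_integral_0_iff_AE) (auto simp: indicator_def)
  qed
  finally have "AE x in lborel. (\<integral>\<^sup>+u. indicator N (x - u *\<^sub>R b) \<partial>(lborel :: real measure)) = (0::ennreal)"
    by (subst nn_integral_0_iff_AE[symmetric]) simp_all
  then show ?thesis
  proof eventually_elim
    case (elim x)
    then have "AE u in (lborel :: real measure). indicator N (x - u *\<^sub>R b) = (0::ennreal)"
      by (subst (asm) nn_integral_0_iff_AE) auto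
    then show ?case
      unfolding directional_heat_def
      by (intro nn_integral_cong_AE) (auto simp: indicator_def eq elim!: eventually_mono split: if_splits)
  qed
qed

text \<open>Completing the square gives \<open>2\<pi> exp(d\<^sup>2 / (2t))\<close> for the integral. It is the only point where the
  tilt \<open>d\<close>, which the proof does not control, enters, and it does so with the right sign.\<close>

lemma gaussian_laplace_ge:
  assumes "0 < t"
  shows "ennreal (2 * pi) \<le> (\<integral>\<^sup>+a. ennreal (sqrt (2 * pi * t) * exp (- (t * a\<^sup>2) / 2)) * ennreal (exp (d * a)) \<partial>lborel)"
proof -
  have "(\<integral>\<^sup>+a. ennreal (sqrt (2 * pi * t) * exp (- (t * a\<^sup>2) / 2)) * ennreal (exp (d * a)) \<partial>lborel)
    = (\<integral>\<^sup>+a. ennreal (sqrt (2 * pi * t) * exp (- (t * (d / t + a)\<^sup>2) / 2)) * ennreal (exp (d * (d / t + a))) \<partial>lborel)"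
    using nn_integral_real_affine[of "\<lambda>a. ennreal (sqrt (2 * pi * t) * exp (- (t * a\<^sup>2) / 2)) * ennreal (exp (d * a))" 1 "d / t"]
    by simp
  also have "\<dots> \<ge> (\<integral>\<^sup>+a. ennreal (sqrt (2 * pi * t)) * ennreal (exp (- a\<^sup>2 / (2 * (1 / t)))) \<partial>lborel)"
  proof (rule nn_integral_mono)
    fix a
    have "- a\<^sup>2 / (2 * (1 / t)) \<le> - (t * (d / t + a)\<^sup>2) / 2 + d * (d / t + a)"
    proof -
      have "- (t * (d / t + a)\<^sup>2) / 2 + d * (d / t + a) = - a\<^sup>2 / (2 * (1 / t)) + d\<^sup>2 / (2 * t)"
        using assms by (simp add: field_simps power2_eq_square)
      then show ?thesis using assms by simp
    qed
    then have "exp (- a\<^sup>2 / (2 * (1 / t))) \<le> exp (- (t * (d / t + a)\<^sup>2) / 2) * exp (d * (d / t + a))"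
      unfolding exp_add[symmetric] by (simp only: exp_le_cancel_iff)
    then have "sqrt (2 * pi * t) * exp (- a\<^sup>2 / (2 * (1 / t))) \<le> sqrt (2 * pi * t) * exp (- (t * (d / t + a)\<^sup>2) / 2) * exp (d * (d / t + a))"
      unfolding mult.assoc[of "sqrt (2 * pi * t)"] using assms by (intro mult_left_mono) auto
    then show "ennreal (sqrt (2 * pi * t)) * ennreal (exp (- a\<^sup>2 / (2 * (1 / t)))) \<le>
        ennreal (sqrt (2 * pi * t) * exp (- (t * (d / t + a)\<^sup>2) / 2)) * ennreal (exp (d * (d / t + a)))"
      using assms by (subst (1 2) ennreal_mult[symmetric]) (auto intro!: ennreal_leI)
  qed
  also have "(\<integral>\<^sup>+a. ennreal (sqrt (2 * pi * t)) * ennreal (exp (- a\<^sup>2 / (2 * (1 / t)))) \<partial>lborel)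
      = ennreal (sqrt (2 * pi * t)) * ennreal (sqrt (2 * pi * (1 / t)))"
    using assms by (subst nn_integral_cmult, measurable) (subst nn_integral_gaussian_real, simp_all)
  also have "\<dots> = ennreal (2 * pi)"
  proof -
    have "sqrt (2 * pi * t) * sqrt (2 * pi * (1 / t)) = sqrt ((2 * pi)\<^sup>2)"
      unfolding real_sqrt_mult[symmetric] using assms by (simp add: power2_eq_square)
    then have "sqrt (2 * pi * t) * sqrt (2 * pi * (1 / t)) = 2 * pi"
      by (simp only: real_sqrt_abs) simp
    then show ?thesis using assms by (subst ennreal_mult[symmetric]) simp_all
  qed
  finally show ?thesis .
qed

lemma le_exp_convex_combination:
  assumes "z \<le> ennreal (exp p)" "z \<le> ennreal (exp q)" "0 < \<theta>" "\<theta> < 1"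
  shows "z \<le> ennreal (exp (\<theta> * p + (1 - \<theta>) * q))"
proof -
  have "min p q \<le> \<theta> * p + (1 - \<theta>) * q"
  proof -
    have "\<theta> * min p q + (1 - \<theta>) * min p q \<le> \<theta> * p + (1 - \<theta>) * q"
      using assms(3,4) by (intro add_mono mult_left_mono) auto
    then show ?thesis by (simp add: algebra_simps)
  qed
  moreover have "z \<le> ennreal (exp (min p q))" using assms(1,2) by (simp add: min_def)
  ultimately show ?thesis by (meson ennreal_leI exp_le_cancel_iff order_trans)
qed

text \<open>The Steiner symmetrization argument. In the proof, \<open>f0\<close> is \<open>f\<close> modified on a null set so
  that its polarity with \<open>p\<close> holds everywhere, \<open>p\<close> and \<open>q\<close> are the polars before and after
  heating, \<open>k_int\<close> is the estimate of \<open>k\<close> from above and \<open>AK\<close> the one from below, integrated in the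
  space variable. The exceptional cases are those in which \<open>ball_harmonic_mean\<close> is not applicable:
  either the right-hand side is infinite or the left-hand side vanishes.\<close>

lemma min_polar_mass_le_polar_directional_heat:
  fixes f :: "real ^ 'n \<Rightarrow> ennreal"
  assumes f[measurable]: "f \<in> borel_measurable borel" and \<tau>: "0 < \<tau>"
  shows "min_polar_mass f \<le> (\<integral>\<^sup>+x. ess_polar (directional_heat \<tau> b f) x \<partial>lborel)"
proof (cases "(\<integral>\<^sup>+x. ess_polar (directional_heat \<tau> b f) x \<partial>lborel) = \<infinity> \<or> (AE x in lborel. ess_polar f x = 0)")
  case True
  then show ?thesis
  proof
    assume "AE x in lborel. ess_polar f x = 0"
    then have "(\<integral>\<^sup>+x. ess_polar f x \<partial>lborel) = 0" by (subst nn_integral_0_iff_AE) auto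
    moreover have "translate 0 f = f" by (simp add: translate_def fun_eq_iff)
    ultimately have "(\<integral>\<^sup>+x. ess_polar (translate 0 f) x \<partial>lborel) = 0" by simp
    then have "min_polar_mass f \<le> 0"
      unfolding min_polar_mass_def by (metis INF_lower UNIV_I)
    then show ?thesis by simp
  qed simp
next
  case False
  define p where "p = ess_polar f"
  define q where "q = ess_polar (directional_heat \<tau> b f)"
  have [measurable]: "p \<in> borel_measurable borel" "q \<in> borel_measurable borel"
    by (simp_all add: p_def q_def)
  have finq: "(\<integral>\<^sup>+x. q x \<partial>lborel) \<noteq> \<infinity>" and p0: "\<not> (AE x in lborel. p x = 0)"
    using False by (auto simp: p_def q_def)
  \<comment> \<open>On \<open>N\<close> the polarity may fail; there the function is set to \<open>0\<close>, which only changes it on a null set.\<close>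
  obtain N where N: "N \<in> null_sets lborel"
    and N': "{y \<in> space lborel. \<not> (\<forall>x. p x * f y \<le> ennreal (exp (- (x \<bullet> y))))} \<subseteq> N"
    using AE_ess_polar_all[of f] unfolding eventually_ae_filter p_def by auto
  have [measurable]: "N \<in> sets borel" using N by auto
  define f0 where "f0 y = (if y \<in> N then 0 else f y)" for y
  have [measurable]: "f0 \<in> borel_measurable borel" unfolding f0_def by measurable
  have pf0: "p x * f0 y \<le> ennreal (exp (- (x \<bullet> y)))" for x y
    using N' by (auto simp: f0_def)
  have heat_eq: "AE x in lborel. directional_heat \<tau> b f x = directional_heat \<tau> b f0 x"
    using N by (rule directional_heat_cong_AE) (simp add: f0_def)
  define g where "g u = ennreal (exp (- u\<^sup>2 / (2 * \<tau>)) / sqrt (2 * pi * \<tau>))" for u :: real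
  define \<gamma> where "\<gamma> a = ennreal (sqrt (2 * pi * \<tau>) * exp (- (\<tau> * a\<^sup>2) / 2))" for a :: real
  have [measurable]: "g \<in> borel_measurable borel" "\<gamma> \<in> borel_measurable borel"
    unfolding g_def \<gamma>_def by measurable
  define F where "F x u = f0 (x - u *\<^sub>R b) * g u" for x u
  define G where "G x s = p x * \<gamma> (x \<bullet> b + s)" for x s
  have heat0: "directional_heat \<tau> b f0 x = (\<integral>\<^sup>+u. F x u \<partial>lborel)" for x
    by (simp add: directional_heat_def F_def g_def)
  have [measurable]: "F x \<in> borel_measurable borel" for x unfolding F_def by measurable
  have [measurable]: "(\<lambda>x. G x s) \<in> borel_measurable borel" for s unfolding G_def by measurable
  have [measurable]: "(\<lambda>(s, x). G x s) \<in> borel_measurable (borel \<Otimes>\<^sub>M borel)" unfolding G_def by measurable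
  have g\<gamma>: "g u * \<gamma> a \<le> ennreal (exp (- (u * a)))" for u a
  proof -
    have "- u\<^sup>2 / (2 * \<tau>) + - (\<tau> * a\<^sup>2) / 2 = - (u * a) - (u - \<tau> * a)\<^sup>2 / (2 * \<tau>)"
      using \<tau> by (simp add: field_simps power2_eq_square)
    also have "\<dots> \<le> - (u * a)" using \<tau> by simp
    finally have "exp (- u\<^sup>2 / (2 * \<tau>)) * exp (- (\<tau> * a\<^sup>2) / 2) \<le> exp (- (u * a))"
      unfolding exp_add[symmetric] by (simp only: exp_le_cancel_iff)
    moreover have "g u * \<gamma> a = ennreal (exp (- u\<^sup>2 / (2 * \<tau>)) * exp (- (\<tau> * a\<^sup>2) / 2))"
      unfolding g_def \<gamma>_def using \<tau> by (subst ennreal_mult[symmetric]) simp_all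
    ultimately show ?thesis by (simp add: ennreal_leI)
  qed
  have FG: "F x u * G y s \<le> ennreal (exp (- (x \<bullet> y) - u * s))" for x u y s
  proof -
    have "F x u * G y s = (p y * f0 (x - u *\<^sub>R b)) * (g u * \<gamma> (y \<bullet> b + s))"
      by (simp add: F_def G_def mult_ac)
    also have "\<dots> \<le> ennreal (exp (- (y \<bullet> (x - u *\<^sub>R b)))) * ennreal (exp (- (u * (y \<bullet> b + s))))"
      by (intro mult_mono pf0 g\<gamma>) auto
    also have "\<dots> = ennreal (exp (- (y \<bullet> (x - u *\<^sub>R b))) * exp (- (u * (y \<bullet> b + s))))"
      by (rule ennreal_mult[symmetric]) simp_all
    also have "exp (- (y \<bullet> (x - u *\<^sub>R b))) * exp (- (u * (y \<bullet> b + s))) = exp (- (x \<bullet> y) - u * s)"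
      unfolding exp_add[symmetric] by (rule arg_cong[where f=exp]) (simp add: inner_diff_right inner_commute algebra_simps)
    finally show ?thesis .
  qed
  define k where "k z = (INF (x, u, v)\<in>{(x, u, v). v \<le> u}.
      ennreal (exp (- (x \<bullet> fst z) - (u - v) * snd z / 2)) / min (F x u) (F x v))" for z :: "(real^'n) \<times> real"
  have kb: "k \<in> borel_measurable borel"
    unfolding k_def by (rule borel_measurable_INF_continuous)
      (auto intro!: continuous_on_exp_divide continuous_intros)
  then have [measurable]: "k \<in> borel_measurable (borel \<Otimes>\<^sub>M borel)"
    by (simp add: borel_prod)
  have k_le: "k (y, r) * min (F x u) (F x v) \<le> ennreal (exp (- (x \<bullet> y) - (u - v) * r / 2))" if "v \<le> u" for x y u v r
    unfolding le_exp_divide_iff[symmetric] k_def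
    using that by (intro INF_lower2[of "(x, u, v)"]) auto
  define K where "K r = (\<integral>\<^sup>+x. k (x, r) \<partial>lborel)" for r
  have [measurable]: "K \<in> borel_measurable borel" unfolding K_def by measurable
  have K_anti: "K r' \<le> K r" if "r \<le> r'" for r r'
    unfolding K_def
  proof (rule nn_integral_mono)
    fix x
    show "k (x, r') \<le> k (x, r)"
      unfolding k_def using that
      by (intro INF_mono) (fastforce intro!: divide_right_mono_ennreal ennreal_leI mult_left_mono)
  qed
  have k_int: "(\<integral>\<^sup>+r. k (y, r) * indicator {0<..} r \<partial>lborel) \<le> ennreal pi * q y" for y
  proof -
    let ?k = "\<integral>\<^sup>+r. k (y, r) * indicator {0<..} r \<partial>lborel"
    have "?k * (\<integral>\<^sup>+u. F x u \<partial>lborel) \<le> ennreal pi * ennreal (exp (- (x \<bullet> y)))" for x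
    proof -
      have e: "ennreal (exp (x \<bullet> y)) * ennreal (exp (- (x \<bullet> y))) = 1"
        by (simp add: exp_minus flip: ennreal_mult)
      have "(\<integral>\<^sup>+u. F x u \<partial>lborel) * (\<integral>\<^sup>+r. k (y, r) * ennreal (exp (x \<bullet> y)) * indicator {0<..} r \<partial>lborel) \<le> ennreal pi"
      proof (rule polar_of_differences)
        fix u v r :: real assume uv: "v \<le> u"
        have "min (F x u) (F x v) * (k (y, r) * ennreal (exp (x \<bullet> y))) =
            k (y, r) * min (F x u) (F x v) * ennreal (exp (x \<bullet> y))" by (simp only: mult_ac)
        also have "\<dots> \<le> ennreal (exp (- (x \<bullet> y) - (u - v) * r / 2)) * ennreal (exp (x \<bullet> y))"
          by (intro mult_right_mono k_le uv) simp
        also have "\<dots> = ennreal (exp (- (x \<bullet> y) - (u - v) * r / 2) * exp (x \<bullet> y))"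
          by (rule ennreal_mult[symmetric]) simp_all
        also have "exp (- (x \<bullet> y) - (u - v) * r / 2) * exp (x \<bullet> y) = exp (- ((u - v) * r / 2))"
          unfolding exp_add[symmetric] by simp
        finally show "min (F x u) (F x v) * (k (y, r) * ennreal (exp (x \<bullet> y))) \<le> ennreal (exp (- ((u - v) * r / 2)))" .
      qed measurable
      also have "(\<integral>\<^sup>+r. k (y, r) * ennreal (exp (x \<bullet> y)) * indicator {0<..} r \<partial>lborel) = ?k * ennreal (exp (x \<bullet> y))"
        by (subst nn_integral_multc[symmetric], measurable) (rule nn_integral_cong, simp only: mult_ac)
      finally have "(\<integral>\<^sup>+u. F x u \<partial>lborel) * (?k * ennreal (exp (x \<bullet> y))) * ennreal (exp (- (x \<bullet> y))) \<le> ennreal pi * ennreal (exp (- (x \<bullet> y)))"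
        by (rule mult_right_mono) simp
      also have "(\<integral>\<^sup>+u. F x u \<partial>lborel) * (?k * ennreal (exp (x \<bullet> y))) * ennreal (exp (- (x \<bullet> y)))
          = ?k * (\<integral>\<^sup>+u. F x u \<partial>lborel) * (ennreal (exp (x \<bullet> y)) * ennreal (exp (- (x \<bullet> y))))" by (simp only: mult_ac)
      finally show ?thesis unfolding e by simp
    qed
    note 1 = this
    have pi1: "ennreal (1 / pi) * ennreal pi = 1" by (simp flip: ennreal_mult)
    have "ennreal (1 / pi) * ?k \<le> q y"
      unfolding q_def
    proof (rule le_ess_polar)
      from heat_eq show "AE x in lborel. ennreal (1 / pi) * ?k * directional_heat \<tau> b f x \<le> ennreal (exp (- (y \<bullet> x)))"
      proof eventually_elim
        case (elim x)
        have "ennreal (1 / pi) * ?k * directional_heat \<tau> b f x = ennreal (1 / pi) * (?k * (\<integral>\<^sup>+u. F x u \<partial>lborel))"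
          unfolding elim heat0 by (simp only: mult.assoc)
        also have "\<dots> \<le> ennreal (1 / pi) * (ennreal pi * ennreal (exp (- (x \<bullet> y))))"
          using 1 by (intro mult_left_mono) auto
        also have "\<dots> = ennreal (exp (- (y \<bullet> x)))"
          unfolding mult.assoc[symmetric] pi1 by (simp add: inner_commute)
        finally show ?case .
      qed
    qed
    then have "ennreal pi * (ennreal (1 / pi) * ?k) \<le> ennreal pi * q y" by (rule mult_left_mono) simp
    then show ?thesis using pi1 by (simp only: mult.assoc[symmetric] mult.commute[of "ennreal pi" "ennreal (1 / pi)"] mult_1_left)
  qed
  have K_int: "(\<integral>\<^sup>+r. K r * indicator {0<..} r \<partial>lborel) \<le> ennreal pi * (\<integral>\<^sup>+x. q x \<partial>lborel)"
  proof -
    have "(\<integral>\<^sup>+r. K r * indicator {0<..} r \<partial>lborel) = (\<integral>\<^sup>+r. (\<integral>\<^sup>+x. k (x, r) * indicator {0<..} r \<partial>lborel) \<partial>lborel)"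
      unfolding K_def by (intro nn_integral_cong, subst nn_integral_multc) auto
    also have "\<dots> = (\<integral>\<^sup>+x. (\<integral>\<^sup>+r. k (x, r) * indicator {0<..} r \<partial>lborel) \<partial>lborel)"
      by (rule lborel_pair.Fubini') measurable
    also have "\<dots> \<le> (\<integral>\<^sup>+x. ennreal pi * q x \<partial>lborel)"
      by (intro nn_integral_mono k_int)
    also have "\<dots> = ennreal pi * (\<integral>\<^sup>+x. q x \<partial>lborel)" by (rule nn_integral_cmult) simp
    finally show ?thesis .
  qed
  define A where "A s = (\<integral>\<^sup>+x. G x s \<partial>lborel)" for s
  have [measurable]: "A \<in> borel_measurable borel" unfolding A_def by measurable
  have A_pos: "0 < A s" for s
  proof (rule ccontr)
    assume "\<not> 0 < A s"
    then have "A s = 0" by (simp add: not_less)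
    then have "AE x in lborel. G x s = 0" unfolding A_def by (subst (asm) nn_integral_0_iff_AE) auto
    moreover have "\<gamma> a \<noteq> 0" for a unfolding \<gamma>_def using \<tau> by (simp add: ennreal_eq_0_iff not_le)
    ultimately have "AE x in lborel. p x = 0" by (simp add: G_def)
    then show False using p0 by simp
  qed
  have AK: "min (A s * ennreal (exp (d * s))) (A (- t) * ennreal (exp (- d * t))) \<le> K (2 * s * t / (s + t))"
    if s: "0 < s" and t: "0 < t" for s t d
  proof -
    define \<theta> where "\<theta> = t / (s + t)"
    define r where "r = 2 * s * t / (s + t)"
    have \<theta>: "0 < \<theta>" "\<theta> < 1" using s t by (auto simp: \<theta>_def)
    have rr: "r = 2 * (s * t / (s + t))" by (simp add: r_def)
    have Gm: "(\<lambda>x. G x s) \<in> borel_measurable lborel" for s by measurable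
    from rr have r2': "r / 2 = s * t / (s + t)" by linarith
    then have r1: "\<theta> * s = r / 2"
      unfolding \<theta>_def by (simp only: times_divide_eq_left times_divide_eq_right mult.commute)
    have "1 - \<theta> = s / (s + t)" using s t by (simp add: \<theta>_def field_simps)
    then have r2: "(1 - \<theta>) * t = r / 2" unfolding r2' by (simp only: times_divide_eq_left)
    \<comment> \<open>The weights are chosen so that \<open>u s\<close> and \<open>v t\<close> receive the same coefficient \<open>r / 2\<close>, which makes
      the bound depend on \<open>u - v\<close> and cancels the tilt \<open>d\<close>.\<close>
    have "min (\<integral>\<^sup>+x. G x s * ennreal (exp (d * s)) \<partial>lborel) (\<integral>\<^sup>+y. G y (- t) * ennreal (exp (- d * t)) \<partial>lborel)
       \<le> (\<integral>\<^sup>+x. k (x, r) \<partial>lborel)"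
    proof (rule prekopa_leindler[OF _ _ _ \<theta>])
      fix y y' l
      let ?m = "min (G y s * ennreal (exp (d * s)) * ennreal (exp ((1 - \<theta>) * l)))
          (G y' (- t) * ennreal (exp (- d * t)) * ennreal (exp (- \<theta> * l)))"
      show "?m \<le> k (\<theta> *\<^sub>R y + (1 - \<theta>) *\<^sub>R y', r)"
        unfolding k_def
      proof (rule INF_greatest, clarify, unfold le_exp_divide_iff fst_conv snd_conv)
        fix x u v assume "(v::real) \<le> u"
        let ?M = "min (F x u) (F x v)"
        have "?m * ?M \<le> G y s * ennreal (exp (d * s)) * ennreal (exp ((1 - \<theta>) * l)) * F x u"
          by (intro mult_mono) auto
        also have "\<dots> = (F x u * G y s) * ennreal (exp (d * s) * exp ((1 - \<theta>) * l))"
          by (subst ennreal_mult) (simp_all only: exp_ge_zero mult_ac)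
        also have "\<dots> \<le> ennreal (exp (- (x \<bullet> y) - u * s)) * ennreal (exp (d * s) * exp ((1 - \<theta>) * l))"
          by (intro mult_right_mono FG) simp
        also have "\<dots> = ennreal (exp (- (x \<bullet> y) - u * s + (d * s + (1 - \<theta>) * l)))"
          by (subst ennreal_mult[symmetric]) (simp_all only: exp_ge_zero exp_add mult_nonneg_nonneg)
        finally have m1: "?m * ?M \<le> ennreal (exp (- (x \<bullet> y) - u * s + (d * s + (1 - \<theta>) * l)))" .
        have "?m * ?M \<le> G y' (- t) * ennreal (exp (- d * t)) * ennreal (exp (- \<theta> * l)) * F x v"
          by (intro mult_mono) auto
        also have "\<dots> = (F x v * G y' (- t)) * ennreal (exp (- d * t) * exp (- \<theta> * l))"
          by (subst ennreal_mult) (simp_all only: exp_ge_zero mult_ac)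
        also have "\<dots> \<le> ennreal (exp (- (x \<bullet> y') - v * (- t))) * ennreal (exp (- d * t) * exp (- \<theta> * l))"
          by (intro mult_right_mono FG) simp
        also have "\<dots> = ennreal (exp (- (x \<bullet> y') - v * (- t) + (- d * t + - \<theta> * l)))"
          by (subst ennreal_mult[symmetric]) (simp_all only: exp_ge_zero exp_add mult_nonneg_nonneg)
        finally have m2: "?m * ?M \<le> ennreal (exp (- (x \<bullet> y') - v * (- t) + (- d * t + - \<theta> * l)))" .
        have "\<theta> * (- (x \<bullet> y) - u * s + (d * s + (1 - \<theta>) * l)) +
            (1 - \<theta>) * (- (x \<bullet> y') - v * (- t) + (- d * t + - \<theta> * l))
          = - (\<theta> * (x \<bullet> y) + (1 - \<theta>) * (x \<bullet> y')) - (u - d) * (\<theta> * s) + (v - d) * ((1 - \<theta>) * t)"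
          by (simp add: algebra_simps)
        also have "\<dots> = - (x \<bullet> (\<theta> *\<^sub>R y + (1 - \<theta>) *\<^sub>R y')) - (u - v) * r / 2"
        proof -
          obtain h where h: "r / 2 = h" by blast
          have "(u - v) * r / 2 = (u - v) * h" unfolding h[symmetric] by simp
          then show ?thesis unfolding r1 r2 h by (simp add: inner_add_right algebra_simps)
        qed
        finally show "?m * ?M \<le> ennreal (exp (- (x \<bullet> (\<theta> *\<^sub>R y + (1 - \<theta>) *\<^sub>R y')) - (u - v) * r / 2))"
          using le_exp_convex_combination[OF m1 m2 \<theta>] by (simp only:)
      qed
    qed measurable
    then show ?thesis
      unfolding A_def K_def r_def[symmetric] by (simp only: nn_integral_multc[OF Gm])
  qed
  obtain d where d: "(\<integral>\<^sup>+s. A s * ennreal (exp (d * s)) * indicator {0<..} s \<partial>lborel)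
      + (\<integral>\<^sup>+s. A (- s) * ennreal (exp (- d * s)) * indicator {0<..} s \<partial>lborel)
     \<le> 2 * (\<integral>\<^sup>+r. K r * indicator {0<..} r \<partial>lborel)"
  proof -
    have "(\<integral>\<^sup>+r. K r * indicator {0<..} r \<partial>lborel) \<noteq> \<infinity>"
      using K_int finq by (auto simp: top_unique ennreal_mult_eq_top_iff)
    then show ?thesis
      using that ball_harmonic_mean[of A "\<lambda>t. A (- t)" K] A_pos K_anti AK by auto
  qed
  \<comment> \<open>Integrating out \<open>s\<close> after the shift by \<open>x \<bullet> b\<close> leaves the polar of \<open>f\<close> translated by \<open>d b\<close>.\<close>
  have "ennreal (2 * pi) * (\<integral>\<^sup>+x. p x * ennreal (exp (- (x \<bullet> (d *\<^sub>R b)))) \<partial>lborel)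
      \<le> (\<integral>\<^sup>+s. A s * ennreal (exp (d * s)) \<partial>lborel)"
  proof -
    have "(\<integral>\<^sup>+s. A s * ennreal (exp (d * s)) \<partial>lborel) = (\<integral>\<^sup>+s. (\<integral>\<^sup>+x. G x s * ennreal (exp (d * s)) \<partial>lborel) \<partial>lborel)"
      unfolding A_def by (intro nn_integral_cong, subst nn_integral_multc) auto
    also have "\<dots> = (\<integral>\<^sup>+x. (\<integral>\<^sup>+s. G x s * ennreal (exp (d * s)) \<partial>lborel) \<partial>lborel)"
      by (rule lborel_pair.Fubini') measurable
    also have "\<dots> \<ge> (\<integral>\<^sup>+x. ennreal (2 * pi) * (p x * ennreal (exp (- (x \<bullet> (d *\<^sub>R b))))) \<partial>lborel)"
    proof (rule nn_integral_mono)
      fix x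
      let ?\<phi> = "\<lambda>s. \<gamma> (x \<bullet> b + s) * ennreal (exp (d * s))"
      have "(\<integral>\<^sup>+s. G x s * ennreal (exp (d * s)) \<partial>lborel) = p x * (\<integral>\<^sup>+s. ?\<phi> s \<partial>lborel)"
        unfolding G_def by (subst nn_integral_cmult[symmetric], measurable) (simp only: mult.assoc)
      also have "(\<integral>\<^sup>+s. ?\<phi> s \<partial>lborel) = (\<integral>\<^sup>+s. ?\<phi> (- (x \<bullet> b) + s) \<partial>lborel)"
        using nn_integral_real_affine[of ?\<phi> 1 "- (x \<bullet> b)"] by simp
      also have "\<dots> = (\<integral>\<^sup>+s. \<gamma> s * ennreal (exp (d * s)) * ennreal (exp (- (x \<bullet> (d *\<^sub>R b)))) \<partial>lborel)"
      proof (rule nn_integral_cong)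
        fix s
        have "exp (d * (- (x \<bullet> b) + s)) = exp (d * s) * exp (- (x \<bullet> (d *\<^sub>R b)))"
          unfolding exp_add[symmetric] by (simp add: algebra_simps)
        then show "?\<phi> (- (x \<bullet> b) + s) = \<gamma> s * ennreal (exp (d * s)) * ennreal (exp (- (x \<bullet> (d *\<^sub>R b))))"
          by (simp only: ennreal_mult exp_ge_zero mult.assoc) simp
      qed
      also have "\<dots> = (\<integral>\<^sup>+s. \<gamma> s * ennreal (exp (d * s)) \<partial>lborel) * ennreal (exp (- (x \<bullet> (d *\<^sub>R b))))"
        by (rule nn_integral_multc) measurable
      also have "p x * \<dots> \<ge> p x * (ennreal (2 * pi) * ennreal (exp (- (x \<bullet> (d *\<^sub>R b)))))"
        unfolding \<gamma>_def using gaussian_laplace_ge[OF \<tau>, of d]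
        by (intro mult_left_mono mult_right_mono) auto
      finally show "ennreal (2 * pi) * (p x * ennreal (exp (- (x \<bullet> (d *\<^sub>R b)))))
          \<le> (\<integral>\<^sup>+s. G x s * ennreal (exp (d * s)) \<partial>lborel)"
        by (simp only: mult_ac)
    qed
    also have "(\<integral>\<^sup>+x. ennreal (2 * pi) * (p x * ennreal (exp (- (x \<bullet> (d *\<^sub>R b))))) \<partial>lborel) =
        ennreal (2 * pi) * (\<integral>\<^sup>+x. p x * ennreal (exp (- (x \<bullet> (d *\<^sub>R b)))) \<partial>lborel)"
      by (rule nn_integral_cmult) measurable
    finally show ?thesis .
  qed
  also have "(\<integral>\<^sup>+s. A s * ennreal (exp (d * s)) \<partial>lborel) =
      (\<integral>\<^sup>+s. A s * ennreal (exp (d * s)) * indicator {0<..} s \<partial>lborel)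
      + (\<integral>\<^sup>+s. A (- s) * ennreal (exp (- d * s)) * indicator {0<..} s \<partial>lborel)"
    by (subst nn_integral_split_halves) simp_all
  also note d
  also have "2 * (\<integral>\<^sup>+r. K r * indicator {0<..} r \<partial>lborel) \<le> 2 * (ennreal pi * (\<integral>\<^sup>+x. q x \<partial>lborel))"
    using K_int by (rule mult_left_mono) simp
  also have "\<dots> = ennreal (2 * pi) * (\<integral>\<^sup>+x. q x \<partial>lborel)"
    by (simp add: ennreal_mult mult.assoc)
  finally have "(\<integral>\<^sup>+x. p x * ennreal (exp (- (x \<bullet> (d *\<^sub>R b)))) \<partial>lborel) \<le> (\<integral>\<^sup>+x. q x \<partial>lborel)"
    by (subst (asm) ennreal_mult_le_mult_iff) auto
  moreover have "min_polar_mass f \<le> (\<integral>\<^sup>+x. p x * ennreal (exp (- (x \<bullet> (d *\<^sub>R b)))) \<partial>lborel)"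
    unfolding min_polar_mass_def p_def ess_polar_translate[symmetric] by (rule INF_lower) simp
  ultimately show ?thesis unfolding q_def by (rule order_trans[rotated])
qed

theorem min_polar_mass_le_directional_heat:
  fixes f :: "real ^ 'n \<Rightarrow> ennreal"
  assumes f[measurable]: "f \<in> borel_measurable borel" and "0 < t"
  shows "min_polar_mass f \<le> min_polar_mass (directional_heat t b f)"
  unfolding min_polar_mass_def[of "directional_heat t b f"]
proof (rule INF_greatest)
  fix z
  have [measurable]: "translate z f \<in> borel_measurable borel"
    unfolding translate_def[abs_def] by measurable
  have "min_polar_mass f \<le> min_polar_mass (translate z f)" by (rule min_polar_mass_translate)
  also have "\<dots> \<le> (\<integral>\<^sup>+x. ess_polar (directional_heat t b (translate z f)) x \<partial>lborel)"
    using \<open>0 < t\<close> by (intro min_polar_mass_le_polar_directional_heat) auto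
  finally show "min_polar_mass f \<le> (\<integral>\<^sup>+x. ess_polar (translate z (directional_heat t b f)) x \<partial>lborel)"
    unfolding directional_heat_translate .
qed


section \<open>The heat flow\<close>

lemma nn_integral_lborel_affine:
  fixes f :: "'a::euclidean_space \<Rightarrow> ennreal"
  assumes [measurable]: "f \<in> borel_measurable borel" and c: "c \<noteq> 0"
  shows "(\<integral>\<^sup>+x. f x \<partial>lborel) = ennreal (\<bar>c\<bar> ^ DIM('a)) * (\<integral>\<^sup>+x. f (z + c *\<^sub>R x) \<partial>lborel)"
  by (subst lborel_affine[OF c, of z]) (simp add: nn_integral_density nn_integral_distr nn_integral_cmult)

lemma AE_lborel_scale:
  fixes P :: "'a::euclidean_space \<Rightarrow> bool"
  assumes "AE y in lborel. P y" and c: "c \<noteq> 0"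
  shows "AE y in lborel. P (c *\<^sub>R y)"
proof -
  have "AE y in density (distr lborel borel (\<lambda>x. 0 + c *\<^sub>R x)) (\<lambda>_. \<bar>c\<bar> ^ DIM('a)). P y"
    using assms(1) unfolding lborel_affine[OF c, of 0, symmetric] .
  then have "AE y in distr lborel borel (\<lambda>x. 0 + c *\<^sub>R x). P y"
    using c by (simp add: AE_density)
  then have "AE y in lborel. P (0 + c *\<^sub>R y)" by (rule AE_distrD[rotated]) simp
  then show ?thesis by simp
qed

lemma nn_integral_gaussian:
  assumes "0 < a"
  shows "(\<integral>\<^sup>+x. ennreal (exp (- (norm (x::real^'n))\<^sup>2 / (2 * a))) \<partial>lborel)
    = ennreal ((2 * pi * a) powr (real CARD('n) / 2))"
proof -
  have "(\<integral>\<^sup>+x. ennreal (exp (- (norm (x::real^'n))\<^sup>2 / (2 * a))) \<partial>lborel)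
     = (\<integral>\<^sup>+x. (\<Prod>b\<in>Basis. ennreal (exp (- ((x::real^'n) \<bullet> b)\<^sup>2 / (2 * a)))) \<partial>lborel)"
  proof (rule nn_integral_cong)
    fix x :: "real^'n"
    have "- (norm x)\<^sup>2 / (2 * a) = (\<Sum>b\<in>Basis. - (x \<bullet> b)\<^sup>2 / (2 * a))"
      unfolding power2_norm_eq_inner by (subst euclidean_inner) (simp add: power2_eq_square sum_negf flip: sum_divide_distrib)
    then show "ennreal (exp (- (norm x)\<^sup>2 / (2 * a))) = (\<Prod>b\<in>Basis. ennreal (exp (- (x \<bullet> b)\<^sup>2 / (2 * a))))"
      by (simp add: exp_sum prod_ennreal)
  qed
  also have "\<dots> = (\<Prod>b\<in>(Basis::(real^'n) set). \<integral>\<^sup>+x. ennreal (exp (- x\<^sup>2 / (2 * a))) \<partial>lborel)"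
    by (rule nn_integral_lborel_prod) auto
  also have "\<dots> = ennreal (sqrt (2 * pi * a) ^ CARD('n))"
    unfolding nn_integral_gaussian_real[OF assms] using assms by (simp add: ennreal_power)
  also have "sqrt (2 * pi * a) ^ CARD('n) = (2 * pi * a) powr (real CARD('n) / 2)"
    using assms by (simp add: powr_half_sqrt[symmetric] powr_realpow[symmetric] powr_powr)
  finally show ?thesis .
qed

definition heat_kernel :: "real \<Rightarrow> real ^ 'n \<Rightarrow> real" where
  "heat_kernel t x = exp (- (norm x)\<^sup>2 / (2 * t)) / (2 * pi * t) powr (real CARD('n) / 2)"

lemma borel_measurable_heat_kernel[measurable]: "heat_kernel t \<in> borel_measurable borel"
  unfolding heat_kernel_def[abs_def] by measurable

lemma heat_kernel_nonneg: "0 \<le> heat_kernel t x"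
  by (simp add: heat_kernel_def)

lemma heat_flow_0: "heat_flow 0 f = f"
  by (simp add: heat_flow_def fun_eq_iff)

lemma heat_flow_kernel:
  "0 < t \<Longrightarrow> heat_flow t f x = (\<integral>\<^sup>+u. f u * ennreal (heat_kernel t (x - u)) \<partial>lborel)"
  by (simp add: heat_flow_def heat_kernel_def)

lemma borel_measurable_heat_flow[measurable]:
  assumes [measurable]: "f \<in> borel_measurable borel" and "0 \<le> t"
  shows "heat_flow t f \<in> borel_measurable borel"
proof (cases "t = 0")
  case False
  then have "heat_flow t f = (\<lambda>x. \<integral>\<^sup>+u. f u * ennreal (heat_kernel t (x - u)) \<partial>lborel)"
    using assms(2) by (simp add: fun_eq_iff heat_flow_kernel)
  then show ?thesis by simp
qed (simp add: heat_flow_0)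

lemma nn_integral_heat_kernel:
  fixes y :: "real ^ 'n"
  assumes "0 < t"
  shows "(\<integral>\<^sup>+x. ennreal (heat_kernel t (x - y)) \<partial>lborel) = 1"
proof -
  let ?c = "(2 * pi * t) powr (real CARD('n) / 2)"
  have c: "0 < ?c" using assms by simp
  have "(\<integral>\<^sup>+x. ennreal (heat_kernel t (x - y)) \<partial>lborel) = (\<integral>\<^sup>+x. ennreal (heat_kernel t (x::real^'n)) \<partial>lborel)"
    using nn_integral_lborel_affine[of "\<lambda>x. ennreal (heat_kernel t (x - y))" 1 y] by simp
  also have "\<dots> = (\<integral>\<^sup>+x. ennreal (1 / ?c) * ennreal (exp (- (norm (x::real^'n))\<^sup>2 / (2 * t))) \<partial>lborel)"
    unfolding heat_kernel_def by (intro nn_integral_cong) (subst ennreal_mult[symmetric], simp_all)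
  also have "\<dots> = ennreal (1 / ?c) * ennreal ?c"
    by (subst nn_integral_cmult, measurable) (simp only: nn_integral_gaussian[OF assms])
  also have "\<dots> = 1" using c by (subst ennreal_mult[symmetric]) simp_all
  finally show ?thesis .
qed

lemma nn_integral_heat_flow:
  fixes f :: "real ^ 'n \<Rightarrow> ennreal"
  assumes [measurable]: "f \<in> borel_measurable borel" and t: "0 \<le> t"
  shows "(\<integral>\<^sup>+x. heat_flow t f x \<partial>lborel) = (\<integral>\<^sup>+x. f x \<partial>lborel)"
proof (cases "t = 0")
  case False
  then have t: "0 < t" using t by simp
  have "(\<integral>\<^sup>+x. heat_flow t f x \<partial>lborel) = (\<integral>\<^sup>+x. (\<integral>\<^sup>+u. f u * ennreal (heat_kernel t (x - u)) \<partial>lborel) \<partial>lborel)"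
    using t by (simp add: heat_flow_kernel)
  also have "\<dots> = (\<integral>\<^sup>+u. (\<integral>\<^sup>+x. f u * ennreal (heat_kernel t (x - u)) \<partial>lborel) \<partial>lborel)"
    by (rule lborel_pair.Fubini') measurable
  also have "\<dots> = (\<integral>\<^sup>+u. f u \<partial>lborel)"
    using t by (simp add: nn_integral_cmult nn_integral_heat_kernel)
  finally show ?thesis .
qed (simp add: heat_flow_0)

text \<open>Completing the square: the identity that makes the convolution of two centred Gaussian
  densities a Gaussian density.\<close>

lemma gaussian_exponents_add:
  fixes a b :: "'a::real_inner"
  assumes "0 < s" "0 < t"
  shows "(norm a)\<^sup>2 / (2 * s) + (norm b)\<^sup>2 / (2 * t) =
    (norm (a + b))\<^sup>2 / (2 * (s + t)) + (norm ((t / (s + t)) *\<^sub>R a - (s / (s + t)) *\<^sub>R b))\<^sup>2 / (2 * (s * t / (s + t)))"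
proof -
  define p q r where "p = a \<bullet> a" and "q = a \<bullet> b" and "r = b \<bullet> b"
  define w where "w = s + t"
  have w: "0 < w" using assms by (simp add: w_def)
  have n1: "(norm (a + b))\<^sup>2 = p + 2 * q + r"
    unfolding power2_norm_eq_inner p_def q_def r_def by (simp add: inner_add_left inner_add_right inner_commute)
  have n2: "(norm ((t / w) *\<^sub>R a - (s / w) *\<^sub>R b))\<^sup>2 = (t\<^sup>2 * p - 2 * s * t * q + s\<^sup>2 * r) / w\<^sup>2"
    unfolding power2_norm_eq_inner p_def q_def r_def using w
    by (simp add: inner_diff_left inner_diff_right inner_commute power2_eq_square field_simps)
  have "p / (2 * s) + r / (2 * t) = (p + 2 * q + r) / (2 * w) + ((t\<^sup>2 * p - 2 * s * t * q + s\<^sup>2 * r) / w\<^sup>2) / (2 * (s * t / w))"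
  proof -
    have "((t\<^sup>2 * p - 2 * s * t * q + s\<^sup>2 * r) / w\<^sup>2) / (2 * (s * t / w)) = (t\<^sup>2 * p - 2 * s * t * q + s\<^sup>2 * r) / (2 * s * t * w)"
      using w assms by (simp add: power2_eq_square)
    moreover have "p / (2 * s) + r / (2 * t) - (p + 2 * q + r) / (2 * w) = (t\<^sup>2 * p - 2 * s * t * q + s\<^sup>2 * r) / (2 * s * t * w)"
    proof -
      have "p / (2 * s) = p * t * w / (2 * s * t * w)" "r / (2 * t) = r * s * w / (2 * s * t * w)"
        "(p + 2 * q + r) / (2 * w) = (p + 2 * q + r) * s * t / (2 * s * t * w)"
        using w assms by simp_all
      then have "p / (2 * s) + r / (2 * t) - (p + 2 * q + r) / (2 * w) =
          (p * t * w + r * s * w - (p + 2 * q + r) * s * t) / (2 * s * t * w)"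
        by (simp only: add_divide_distrib[symmetric] diff_divide_distrib[symmetric])
      also have "p * t * w + r * s * w - (p + 2 * q + r) * s * t = t\<^sup>2 * p - 2 * s * t * q + s\<^sup>2 * r"
        by (simp add: w_def power2_eq_square algebra_simps)
      finally show ?thesis .
    qed
    ultimately show ?thesis by linarith
  qed
  then show ?thesis
    unfolding w_def[symmetric] n1 n2 unfolding power2_norm_eq_inner p_def r_def .
qed

lemma heat_kernel_convolution:
  fixes x v :: "real ^ 'n"
  assumes s: "0 < s" and t: "0 < t"
  shows "(\<integral>\<^sup>+u. ennreal (heat_kernel s (u - v)) * ennreal (heat_kernel t (x - u)) \<partial>lborel)
    = ennreal (heat_kernel (s + t) (x - v))"
proof -
  let ?n = "real CARD('n) / 2"
  define c where "c = s * t / (s + t)"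
  have c: "0 < c" using s t by (simp add: c_def)
  define m where "m = (t / (s + t)) *\<^sub>R v + (s / (s + t)) *\<^sub>R x"
  have st: "t / (s + t) + s / (s + t) = 1" using s t by (simp flip: add_divide_distrib)
  have pt: "heat_kernel s (u - v) * heat_kernel t (x - u) =  heat_kernel (s + t) (x - v) * heat_kernel c (u - m)" for u
  proof -
    have "(t / (s + t)) *\<^sub>R (u - v) - (s / (s + t)) *\<^sub>R (x - u) = (t / (s + t) + s / (s + t)) *\<^sub>R u - m"
      unfolding m_def by (simp only: scaleR_diff_right scaleR_add_left) simp
    then have e: "(t / (s + t)) *\<^sub>R (u - v) - (s / (s + t)) *\<^sub>R (x - u) = u - m" unfolding st by simp
    have "(norm (u - v))\<^sup>2 / (2 * s) + (norm (x - u))\<^sup>2 / (2 * t) = (norm (x - v))\<^sup>2 / (2 * (s + t)) + (norm (u - m))\<^sup>2 / (2 * c)"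
      using gaussian_exponents_add[OF s t, of "u - v" "x - u"] unfolding e c_def by simp
    then have "exp (- (norm (u - v))\<^sup>2 / (2 * s)) * exp (- (norm (x - u))\<^sup>2 / (2 * t)) =
        exp (- (norm (x - v))\<^sup>2 / (2 * (s + t))) * exp (- (norm (u - m))\<^sup>2 / (2 * c))"
      unfolding exp_add[symmetric] by simp
    moreover have "(2 * pi * s) powr ?n * (2 * pi * t) powr ?n = (2 * pi * (s + t)) powr ?n * (2 * pi * c) powr ?n"
    proof -
      have "(2 * pi * s) powr ?n * (2 * pi * t) powr ?n = ((2 * pi * s) * (2 * pi * t)) powr ?n"
        by (rule powr_mult[symmetric])
      also have "(2 * pi * s) * (2 * pi * t) = (2 * pi * (s + t)) * (2 * pi * c)"
        using s t by (simp add: c_def)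
      also have "\<dots> powr ?n = (2 * pi * (s + t)) powr ?n * (2 * pi * c) powr ?n"
        by (rule powr_mult)
      finally show ?thesis .
    qed
    ultimately show ?thesis
      unfolding heat_kernel_def times_divide_times_eq by simp
  qed
  have "(\<integral>\<^sup>+u. ennreal (heat_kernel s (u - v)) * ennreal (heat_kernel t (x - u)) \<partial>lborel)
     = (\<integral>\<^sup>+u. ennreal (heat_kernel (s + t) (x - v)) * ennreal (heat_kernel c (u - m)) \<partial>lborel)"
    using pt by (simp add: heat_kernel_nonneg flip: ennreal_mult)
  also have "\<dots> = ennreal (heat_kernel (s + t) (x - v))"
    by (simp add: nn_integral_cmult nn_integral_heat_kernel[OF c])
  finally show ?thesis .
qed

lemma heat_flow_semigroup:
  fixes f :: "real ^ 'n \<Rightarrow> ennreal"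
  assumes [measurable]: "f \<in> borel_measurable borel" and s: "0 \<le> s" and t: "0 < t"
  shows "heat_flow (s + t) f = heat_flow t (heat_flow s f)"
proof (cases "s = 0")
  case True
  then show ?thesis by (simp add: heat_flow_0)
next
  case False
  then have s: "0 < s" using s by simp
  show ?thesis
  proof
    fix x
    have "heat_flow t (heat_flow s f) x =
        (\<integral>\<^sup>+u. (\<integral>\<^sup>+v. f v * ennreal (heat_kernel s (u - v)) \<partial>lborel) * ennreal (heat_kernel t (x - u)) \<partial>lborel)"
      using s t by (simp add: heat_flow_kernel)
    also have "\<dots> = (\<integral>\<^sup>+u. (\<integral>\<^sup>+v. f v * ennreal (heat_kernel s (u - v)) * ennreal (heat_kernel t (x - u)) \<partial>lborel) \<partial>lborel)"
      by (intro nn_integral_cong nn_integral_multc[symmetric]) measurable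
    also have "\<dots> = (\<integral>\<^sup>+v. (\<integral>\<^sup>+u. f v * ennreal (heat_kernel s (u - v)) * ennreal (heat_kernel t (x - u)) \<partial>lborel) \<partial>lborel)"
      by (rule lborel_pair.Fubini') measurable
    also have "\<dots> = (\<integral>\<^sup>+v. f v * ennreal (heat_kernel (s + t) (x - v)) \<partial>lborel)"
      unfolding mult.assoc using s t by (simp add: nn_integral_cmult heat_kernel_convolution)
    finally show "heat_flow (s + t) f x = heat_flow t (heat_flow s f) x"
      using s t by (simp add: heat_flow_kernel)
  qed
qed

text \<open>Heating in the directions of \<open>S\<close> only, with all increments gathered in one integral so
  that the full flow can be reached by adding one basis vector at a time.\<close>

definition partial_heat :: "real \<Rightarrow> (real ^ 'n) set \<Rightarrow> (real ^ 'n \<Rightarrow> ennreal) \<Rightarrow> real ^ 'n \<Rightarrow> ennreal" where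
  "partial_heat t S f x = (\<integral>\<^sup>+w. f (x - (\<Sum>b\<in>S. w b *\<^sub>R b)) *
      (\<Prod>b\<in>S. ennreal (exp (- (w b)\<^sup>2 / (2 * t)) / sqrt (2 * pi * t))) \<partial>PiM S (\<lambda>_. lborel))"

lemma partial_heat_insert:
  fixes f :: "real ^ 'n \<Rightarrow> ennreal"
  assumes [measurable]: "f \<in> borel_measurable borel" and S: "finite S" "c \<notin> S"
  shows "partial_heat t (insert c S) f = directional_heat t c (partial_heat t S f)"
proof
  fix x
  interpret product_sigma_finite "\<lambda>_::real^'n. lborel :: real measure" by standard
  let ?g = "\<lambda>u::real. ennreal (exp (- u\<^sup>2 / (2 * t)) / sqrt (2 * pi * t))"
  have [simp]: "finite S" by (rule S)
  have "partial_heat t (insert c S) f x = (\<integral>\<^sup>+u. (\<integral>\<^sup>+w. f (x - (\<Sum>b\<in>insert c S. (w(c := u)) b *\<^sub>R b)) *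
      (\<Prod>b\<in>insert c S. ?g ((w(c := u)) b)) \<partial>PiM S (\<lambda>_. lborel)) \<partial>lborel)"
    unfolding partial_heat_def by (rule product_nn_integral_insert_rev[OF S]) measurable
  also have "\<dots> = (\<integral>\<^sup>+u. (\<integral>\<^sup>+w. f (x - u *\<^sub>R c - (\<Sum>b\<in>S. w b *\<^sub>R b)) *
      (\<Prod>b\<in>S. ?g (w b)) * ?g u \<partial>PiM S (\<lambda>_. lborel)) \<partial>lborel)"
  proof (intro nn_integral_cong)
    fix u w
    have "(\<Sum>b\<in>S. (w(c := u)) b *\<^sub>R b) = (\<Sum>b\<in>S. w b *\<^sub>R b)" "(\<Prod>b\<in>S. ?g ((w(c := u)) b)) = (\<Prod>b\<in>S. ?g (w b))"
      using S(2) by (auto intro!: sum.cong prod.cong)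
    then show "f (x - (\<Sum>b\<in>insert c S. (w(c := u)) b *\<^sub>R b)) * (\<Prod>b\<in>insert c S. ?g ((w(c := u)) b))
       = f (x - u *\<^sub>R c - (\<Sum>b\<in>S. w b *\<^sub>R b)) * (\<Prod>b\<in>S. ?g (w b)) * ?g u"
      by (simp only: sum.insert[OF S] prod.insert[OF S] fun_upd_same) (simp add: diff_diff_eq mult_ac)
  qed
  also have "\<dots> = directional_heat t c (partial_heat t S f) x"
    unfolding directional_heat_def partial_heat_def
    by (intro nn_integral_cong nn_integral_multc) measurable
  finally show "partial_heat t (insert c S) f x = directional_heat t c (partial_heat t S f) x" .
qed

lemma partial_heat_empty:
  fixes f :: "real ^ 'n \<Rightarrow> ennreal"
  shows "partial_heat t {} f = f"
proof
  interpret product_sigma_finite "\<lambda>_::real^'n. lborel :: real measure" by standard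
  show "partial_heat t {} f x = f x" for x :: "real^'n"
    unfolding partial_heat_def by (subst nn_integral_empty) simp_all
qed

lemma partial_heat_Basis:
  fixes f :: "real ^ 'n \<Rightarrow> ennreal"
  assumes [measurable]: "f \<in> borel_measurable borel" and t: "0 < t"
  shows "partial_heat t Basis f = heat_flow t f"
proof
  fix x
  let ?S = "\<lambda>w. \<Sum>b\<in>Basis. w b *\<^sub>R (b::real^'n)"
  let ?g = "\<lambda>u::real. exp (- u\<^sup>2 / (2 * t)) / sqrt (2 * pi * t)"
  have ker: "(\<Prod>b\<in>(Basis::(real^'n) set). ennreal (?g (w b))) = ennreal (heat_kernel t (?S w))" for w
  proof -
    have "(norm (?S w))\<^sup>2 = (\<Sum>b\<in>Basis. (w b)\<^sup>2)"
      unfolding power2_norm_eq_inner by (subst euclidean_inner) (simp add: power2_eq_square)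
    then have e: "exp (- (norm (?S w))\<^sup>2 / (2 * t)) = (\<Prod>b\<in>(Basis::(real^'n) set). exp (- (w b)\<^sup>2 / (2 * t)))"
      by (simp add: exp_sum[symmetric] sum_negf flip: sum_divide_distrib)
    have c: "(2 * pi * t) powr (real CARD('n) / 2) = sqrt (2 * pi * t) ^ CARD('n)"
      using t by (simp add: powr_half_sqrt[symmetric] powr_realpow[symmetric] powr_powr)
    have "(\<Prod>b\<in>(Basis::(real^'n) set). ennreal (?g (w b))) = ennreal (\<Prod>b\<in>(Basis::(real^'n) set). ?g (w b))"
      using t by (intro prod_ennreal) simp
    also have "(\<Prod>b\<in>(Basis::(real^'n) set). ?g (w b)) = heat_kernel t (?S w)"
      unfolding heat_kernel_def e c by (simp add: prod_dividef)
    finally show ?thesis .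
  qed
  have "heat_flow t f x = (\<integral>\<^sup>+u. f u * ennreal (heat_kernel t (x - u)) \<partial>lborel)"
    using t by (rule heat_flow_kernel)
  also have "\<dots> = (\<integral>\<^sup>+w. f (x - w) * ennreal (heat_kernel t w) \<partial>lborel)"
    using nn_integral_lborel_affine[of "\<lambda>u. f u * ennreal (heat_kernel t (x - u))" "-1" x] by simp
  also have "\<dots> = (\<integral>\<^sup>+w. f (x - ?S w) * ennreal (heat_kernel t (?S w)) \<partial>PiM Basis (\<lambda>_. lborel))"
    by (subst lborel_eq, subst nn_integral_distr) auto
  also have "\<dots> = partial_heat t Basis f x"
    unfolding partial_heat_def ker ..
  finally show "partial_heat t Basis f x = heat_flow t f x" by simp
qed

theorem min_polar_mass_le_heat_flow:
  fixes f :: "real ^ 'n \<Rightarrow> ennreal"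
  assumes [measurable]: "f \<in> borel_measurable borel" and t: "0 < t"
  shows "min_polar_mass f \<le> min_polar_mass (heat_flow t f)"
proof -
  have "partial_heat t S f \<in> borel_measurable borel \<and> min_polar_mass f \<le> min_polar_mass (partial_heat t S f)"
    if "finite S" for S :: "(real^'n) set"
    using that
  proof induction
    case empty
    then show ?case by (simp add: partial_heat_empty)
  next
    case (insert c S)
    then show ?case
      using t by (auto simp: partial_heat_insert intro: order_trans[OF _ min_polar_mass_le_directional_heat])
  qed
  from this[OF finite_Basis] show ?thesis using t by (simp add: partial_heat_Basis)
qed


section \<open>The Blaschke-Santalo inequality\<close>

lemma ess_polar_antimono:
  assumes "\<And>y. g y \<le> h y"
  shows "ess_polar h x \<le> ess_polar g x"
proof (rule le_ess_polar)
  from AE_ess_polar_all[of h]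
  show "AE y in lborel. ess_polar h x * g y \<le> ennreal (exp (- (x \<bullet> y)))"
  proof eventually_elim
    case (elim y)
    have "ess_polar h x * g y \<le> ess_polar h x * h y" using assms by (rule mult_left_mono) simp
    also have "\<dots> \<le> ennreal (exp (- (x \<bullet> y)))" using elim by blast
    finally show ?case .
  qed
qed

lemma min_polar_mass_antimono:
  assumes "\<And>y. g y \<le> h y"
  shows "min_polar_mass h \<le> min_polar_mass g"
  unfolding min_polar_mass_def
  by (intro INF_mono') (intro nn_integral_mono ess_polar_antimono, simp add: translate_def assms)

text \<open>An almost everywhere inequality between a constant and a continuous function holds everywhere, so
  the polar may be tested at the single point \<open>x / a\<close>, where the exponent is smallest.\<close>

lemma ess_polar_le_of_gaussian_le:
  fixes q :: "real ^ 'n \<Rightarrow> ennreal"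
  assumes a: "0 < a" and q: "\<And>y. C * ennreal (exp (- (a * (norm y)\<^sup>2) / 2)) \<le> q y"
  shows "ess_polar q x * C \<le> ennreal (exp (- (norm x)\<^sup>2 / (2 * a)))"
proof -
  let ?e = "\<lambda>y. exp (- (x \<bullet> y) + a * (norm y)\<^sup>2 / 2)"
  have "AE y in lborel. y \<in> {y. ess_polar q x * C \<le> ennreal (?e y)}"
    using AE_ess_polar_all[of q]
  proof eventually_elim
    case (elim y)
    have e: "ennreal (exp (- (a * (norm y)\<^sup>2) / 2)) * ennreal (exp (a * (norm y)\<^sup>2 / 2)) = 1"
      by (subst ennreal_mult[symmetric]) (simp_all flip: exp_add)
    have "ess_polar q x * C = ess_polar q x * (C * ennreal (exp (- (a * (norm y)\<^sup>2) / 2))) * ennreal (exp (a * (norm y)\<^sup>2 / 2))"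
      unfolding mult.assoc e by simp
    also have "\<dots> \<le> ess_polar q x * q y * ennreal (exp (a * (norm y)\<^sup>2 / 2))"
      by (intro mult_left_mono mult_right_mono q) auto
    also have "\<dots> \<le> ennreal (exp (- (x \<bullet> y))) * ennreal (exp (a * (norm y)\<^sup>2 / 2))"
      using elim by (intro mult_right_mono) auto
    also have "\<dots> = ennreal (?e y)" by (simp only: exp_add ennreal_mult exp_ge_zero)
    finally show ?case by simp
  qed
  then have "AE y in lebesgue. y \<in> {y. ess_polar q x * C \<le> ennreal (?e y)}"
    by (rule AE_completion)
  moreover have "closed {y. ess_polar q x * C \<le> ennreal (?e y)}"
    by (intro closed_Collect_le continuous_on_const continuous_on_ennreal continuous_intros) auto
  ultimately have "x /\<^sub>R a \<in> {y. ess_polar q x * C \<le> ennreal (?e y)}"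
    by (rule mem_closed_if_AE_lebesgue[rotated])
  then have "ess_polar q x * C \<le> ennreal (?e (x /\<^sub>R a))" by simp
  also have "- (x \<bullet> (x /\<^sub>R a)) + a * (norm (x /\<^sub>R a))\<^sup>2 / 2 = - (norm x)\<^sup>2 / (2 * a)"
    unfolding power2_norm_eq_inner using a by (simp add: field_simps)
  finally show ?thesis .
qed

text \<open>For \<open>norm u \<le> R\<close>, the inequality \<open>2 norm x norm u \<le> \<epsilon> (norm x)\<^sup>2 + (norm u)\<^sup>2 / \<epsilon>\<close> bounds the exponent
  of the heat kernel, up to a constant, by a multiple of \<open>(norm x)\<^sup>2\<close> slightly larger than the one
  at \<open>u = 0\<close>.\<close>

lemma heat_flow_ge_gaussian:
  fixes f :: "real ^ 'n \<Rightarrow> ennreal"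
  assumes [measurable]: "f \<in> borel_measurable borel" and R: "\<And>u. R < norm u \<Longrightarrow> f u = 0" "0 \<le> R"
    and \<epsilon>: "0 < \<epsilon>" and t: "0 < t"
  shows "(\<integral>\<^sup>+u. f u \<partial>lborel) * ennreal (exp (- ((1 + 1 / \<epsilon>) * R\<^sup>2 / (2 * t))) / (2 * pi * t) powr (real CARD('n) / 2))
      * ennreal (exp (- ((1 + \<epsilon>) / t * (norm x)\<^sup>2) / 2)) \<le> heat_flow t f x"
proof -
  let ?p = "(2 * pi * t) powr (real CARD('n) / 2)"
  let ?c = "exp (- ((1 + 1 / \<epsilon>) * R\<^sup>2 / (2 * t))) / ?p"
  let ?e = "exp (- ((1 + \<epsilon>) / t * (norm x)\<^sup>2) / 2)"
  have "(\<integral>\<^sup>+u. f u \<partial>lborel) * ennreal ?c * ennreal ?e = (\<integral>\<^sup>+u. f u * ennreal (?c * ?e) \<partial>lborel)"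
  proof -
    have "ennreal (?c * ?e) = ennreal ?c * ennreal ?e" by (rule ennreal_mult) simp_all
    then show ?thesis by (simp only:) (subst nn_integral_multc, measurable, simp only: mult.assoc)
  qed
  also have "\<dots> \<le> (\<integral>\<^sup>+u. f u * ennreal (heat_kernel t (x - u)) \<partial>lborel)"
  proof (rule nn_integral_mono)
    fix u
    show "f u * ennreal (?c * ?e) \<le> f u * ennreal (heat_kernel t (x - u))"
    proof (cases "R < norm u")
      case True
      then show ?thesis using R by simp
    next
      case False
      have "(norm (x - u))\<^sup>2 \<le> (norm x + norm u)\<^sup>2"
        by (intro power_mono norm_triangle_ineq4) simp
      also have "\<dots> \<le> (1 + \<epsilon>) * (norm x)\<^sup>2 + (1 + 1 / \<epsilon>) * (norm u)\<^sup>2"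
      proof -
        have "0 \<le> (\<epsilon> * norm x - norm u)\<^sup>2 / \<epsilon>" using \<epsilon> by simp
        also have "\<dots> = \<epsilon> * (norm x)\<^sup>2 + (norm u)\<^sup>2 / \<epsilon> - 2 * norm x * norm u"
          using \<epsilon> by (simp add: power2_eq_square field_simps)
        finally show ?thesis by (simp add: power2_sum algebra_simps)
      qed
      also have "\<dots> \<le> (1 + \<epsilon>) * (norm x)\<^sup>2 + (1 + 1 / \<epsilon>) * R\<^sup>2"
        using False \<epsilon> by (intro add_left_mono mult_left_mono power_mono) auto
      finally have "(norm (x - u))\<^sup>2 / (2 * t) \<le> ((1 + \<epsilon>) * (norm x)\<^sup>2 + (1 + 1 / \<epsilon>) * R\<^sup>2) / (2 * t)"
        using t by (intro divide_right_mono) auto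
      also have "\<dots> = (1 + 1 / \<epsilon>) * R\<^sup>2 / (2 * t) + (1 + \<epsilon>) / t * (norm x)\<^sup>2 / 2"
      proof -
        have "(A + B) / (2 * t) = B / (2 * t) + A / t / 2" for A B by (simp add: add_divide_distrib)
        then show ?thesis by (simp only: times_divide_eq_left)
      qed
      finally have "exp (- ((1 + 1 / \<epsilon>) * R\<^sup>2 / (2 * t))) * ?e \<le> exp (- (norm (x - u))\<^sup>2 / (2 * t))"
        unfolding exp_add[symmetric] by simp
      then have "exp (- ((1 + 1 / \<epsilon>) * R\<^sup>2 / (2 * t))) * ?e / ?p \<le> exp (- (norm (x - u))\<^sup>2 / (2 * t)) / ?p"
        by (rule divide_right_mono) simp
      then show ?thesis unfolding heat_kernel_def
        by (intro mult_left_mono ennreal_leI) simp_all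
    qed
  qed
  also have "\<dots> = heat_flow t f x" using t by (simp add: heat_flow_kernel)
  finally show ?thesis .
qed

text \<open>Monotonicity allows to replace \<open>f\<close> by its evolution at time \<open>t\<close>, and the latter by a Gaussian from
  below. The powers of \<open>t\<close> from the kernel and from the polar Gaussian cancel.\<close>

lemma blaschke_santalo_approx:
  fixes f :: "real ^ 'n \<Rightarrow> ennreal"
  assumes [measurable]: "f \<in> borel_measurable borel" and R: "\<And>u. R < norm u \<Longrightarrow> f u = 0" "0 \<le> R"
    and \<epsilon>: "0 < \<epsilon>" and t: "0 < t"
  shows "(\<integral>\<^sup>+u. f u \<partial>lborel) * min_polar_mass f
    \<le> ennreal (((2 * pi)\<^sup>2 * (1 + \<epsilon>)) powr (real CARD('n) / 2) * exp ((1 + 1 / \<epsilon>) * R\<^sup>2 / (2 * t)))"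
proof -
  let ?n = "real CARD('n) / 2"
  let ?q = "heat_flow t f"
  let ?I = "\<integral>\<^sup>+u. f u \<partial>lborel"
  define a where "a = (1 + \<epsilon>) / t"
  define E where "E = exp ((1 + 1 / \<epsilon>) * R\<^sup>2 / (2 * t))"
  define P where "P = (2 * pi * t) powr ?n"
  have pos: "0 < a" "0 < E" "0 < P" using \<epsilon> t by (auto simp: a_def E_def P_def)
  have q: "?I * ennreal (1 / (E * P)) * ennreal (exp (- (a * (norm x)\<^sup>2) / 2)) \<le> ?q x" for x
    using heat_flow_ge_gaussian[OF assms, of x] unfolding a_def E_def P_def
    by (simp add: exp_minus inverse_eq_divide)
  have [measurable]: "ess_polar ?q \<in> borel_measurable borel" by simp
  have "?I * min_polar_mass f \<le> ?I * (\<integral>\<^sup>+x. ess_polar ?q x \<partial>lborel)"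
  proof (rule mult_left_mono)
    have "translate 0 ?q = ?q" by (simp add: translate_def fun_eq_iff)
    then have "min_polar_mass ?q \<le> (\<integral>\<^sup>+x. ess_polar ?q x \<partial>lborel)"
      unfolding min_polar_mass_def by (metis INF_lower UNIV_I)
    then show "min_polar_mass f \<le> (\<integral>\<^sup>+x. ess_polar ?q x \<partial>lborel)"
      using min_polar_mass_le_heat_flow[OF assms(1) t] by (rule order_trans[rotated])
  qed simp
  also have "\<dots> = ennreal (E * P) * (\<integral>\<^sup>+x. ess_polar ?q x * (?I * ennreal (1 / (E * P))) \<partial>lborel)"
  proof -
    have "ennreal (E * P) * ennreal (1 / (E * P)) = 1"
      using pos by (subst ennreal_mult[symmetric]) simp_all
    then have "ennreal (E * P) * (X * (?I * ennreal (1 / (E * P)))) = ?I * X" for X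
      by (metis mult.assoc mult.commute mult_1_right)
    then show ?thesis by (simp add: nn_integral_multc)
  qed
  also have "\<dots> \<le> ennreal (E * P) * (\<integral>\<^sup>+x. ennreal (exp (- (norm (x::real^'n))\<^sup>2 / (2 * a))) \<partial>lborel)"
    using ess_polar_le_of_gaussian_le[OF pos(1) q] by (intro mult_left_mono nn_integral_mono) auto
  also have "\<dots> = ennreal (E * (P * (2 * pi * a) powr ?n))"
    unfolding nn_integral_gaussian[OF pos(1)] using pos by (subst ennreal_mult[symmetric]) (simp_all add: mult.assoc)
  also have "P * (2 * pi * a) powr ?n = ((2 * pi)\<^sup>2 * (1 + \<epsilon>)) powr ?n"
  proof -
    have "2 * pi * t * (2 * pi * a) = (2 * pi)\<^sup>2 * (1 + \<epsilon>)"
      using t by (simp add: a_def power2_eq_square)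
    then show ?thesis unfolding P_def by (simp only: powr_mult[symmetric])
  qed
  finally show ?thesis unfolding E_def by (simp only: mult.commute)
qed

text \<open>For a function supported in a ball, \<open>\<epsilon> = 1 / m\<close> and \<open>t = m\<^sup>2\<close> make both error factors tend to \<open>1\<close>.
  Truncating \<open>f\<close> increases the polar, so the bound passes to the limit of the masses; this
  includes functions of infinite integral, for which the product is then \<open>\<infinity> * 0 = 0\<close>.\<close>

theorem blaschke_santalo:
  fixes f :: "real ^ 'n \<Rightarrow> ennreal"
  assumes [measurable]: "f \<in> borel_measurable borel"
  shows "(\<integral>\<^sup>+u. f u \<partial>lborel) * min_polar_mass f \<le> ennreal ((2 * pi) powr real CARD('n))"
proof -
  let ?n = "real CARD('n) / 2"
  let ?f = "\<lambda>N y. f y * indicator (cball 0 (real N)) y"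
  have *: "(\<integral>\<^sup>+u. ?f N u \<partial>lborel) * min_polar_mass f \<le> ennreal ((2 * pi) powr real CARD('n))" for N :: nat
  proof -
    have "(\<integral>\<^sup>+u. ?f N u \<partial>lborel) * min_polar_mass f \<le> (\<integral>\<^sup>+u. ?f N u \<partial>lborel) * min_polar_mass (?f N)"
      by (intro mult_left_mono min_polar_mass_antimono) (auto split: split_indicator)
    also have "\<dots> \<le> ennreal ((2 * pi) powr real CARD('n))"
    proof (rule LIMSEQ_le_const)
      let ?b = "\<lambda>m. ((2 * pi)\<^sup>2 * (1 + 1 / real (Suc m))) powr ?n *
          exp ((1 / real (Suc m) + 1 / real (Suc m) * (1 / real (Suc m))) * ((real N)\<^sup>2 / 2))"
      have "?b \<longlonglongrightarrow> ((2 * pi)\<^sup>2 * (1 + 0)) powr ?n * exp ((0 + 0 * 0) * ((real N)\<^sup>2 / 2))"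
        by (intro tendsto_mult tendsto_powr tendsto_exp tendsto_add tendsto_const LIMSEQ_Suc[OF lim_1_over_n]) simp
      also have "((2 * pi)\<^sup>2 * (1 + 0)) powr ?n * exp ((0 + 0 * 0) * ((real N)\<^sup>2 / 2)) = (2 * pi) powr real CARD('n)"
      proof -
        have "((2 * pi)\<^sup>2) powr ?n = ((2 * pi) powr 2) powr ?n" by simp
        also have "\<dots> = (2 * pi) powr real CARD('n)" by (simp only: powr_powr) simp
        finally show ?thesis by simp
      qed
      finally show "(\<lambda>m. ennreal (?b m)) \<longlonglongrightarrow> ennreal ((2 * pi) powr real CARD('n))"
        by (rule tendsto_ennrealI)
      show "\<exists>M. \<forall>m\<ge>M. (\<integral>\<^sup>+u. ?f N u \<partial>lborel) * min_polar_mass (?f N) \<le> ennreal (?b m)"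
      proof (intro exI[of _ 0] allI impI)
        fix m
        let ?m = "real (Suc m)"
        have eq: "(1 + 1 / (1 / ?m)) * (real N)\<^sup>2 / (2 * ?m\<^sup>2) = (1 / ?m + 1 / ?m * (1 / ?m)) * ((real N)\<^sup>2 / 2)"
        proof -
          have "(1 + 1 / (1 / y)) * z / (2 * y\<^sup>2) = (1 / y + 1 / y * (1 / y)) * (z / 2)" if "0 < y" for y z :: real
            using that by (simp add: field_simps power2_eq_square)
          from this[of ?m "(real N)\<^sup>2"] show ?thesis by (simp only: of_nat_0_less_iff zero_less_Suc)
        qed
        have "(\<integral>\<^sup>+u. ?f N u \<partial>lborel) * min_polar_mass (?f N)
          \<le> ennreal (((2 * pi)\<^sup>2 * (1 + 1 / ?m)) powr ?n * exp ((1 + 1 / (1 / ?m)) * (real N)\<^sup>2 / (2 * ?m\<^sup>2)))"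
        proof (rule blaschke_santalo_approx)
          show "?f N \<in> borel_measurable borel"
            by (intro borel_measurable_times_ennreal borel_measurable_indicator assms) simp
        qed simp_all
        then show "(\<integral>\<^sup>+u. ?f N u \<partial>lborel) * min_polar_mass (?f N) \<le> ennreal (?b m)"
          unfolding eq .
      qed
    qed
    finally show ?thesis .
  qed
  have "(\<Union>N. cball 0 (real N)) = (UNIV :: (real^'n) set)"
    using real_arch_simple by (auto simp: set_eq_iff)
  then have "(\<integral>\<^sup>+u. f u \<partial>lborel) = (SUP N. \<integral>\<^sup>+u. ?f N u \<partial>lborel)"
    using nn_integral_incseq_sets[of f lborel "\<lambda>N. cball 0 (real N)"] by (simp add: incseq_def subset_cball)
  then show ?thesis using * by (simp add: SUP_mult_right_ennreal SUP_least)
qed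

text \<open>The Gaussian lies below its own polar since \<open>2 (x \<bullet> y) \<le> (norm x)\<^sup>2 + (norm y)\<^sup>2\<close>, and translating it away from
  the origin only increases the mass of the polar.\<close>

lemma volume_product_std_gaussian_ge:
  "ennreal ((2 * pi) powr real CARD('n)) \<le> volume_product (std_gaussian :: real ^ 'n \<Rightarrow> ennreal)"
proof -
  let ?g = "std_gaussian :: real ^ 'n \<Rightarrow> ennreal"
  let ?n = "real CARD('n) / 2"
  have int: "(\<integral>\<^sup>+x. ?g x \<partial>lborel) = ennreal ((2 * pi) powr ?n)"
    unfolding std_gaussian_def using nn_integral_gaussian[of 1] by simp
  have [measurable]: "?g \<in> borel_measurable borel" unfolding std_gaussian_def[abs_def] by measurable
  have polar: "?g x \<le> ess_polar ?g x" for x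
  proof (intro le_ess_polar AE_I2)
    fix y
    have "0 \<le> (norm (x - y))\<^sup>2" by simp
    also have "(norm (x - y))\<^sup>2 = (norm x)\<^sup>2 + (norm y)\<^sup>2 - 2 * (x \<bullet> y)"
      unfolding power2_norm_eq_inner by (simp add: inner_diff_left inner_diff_right inner_commute)
    finally have "exp (- (norm x)\<^sup>2 / 2) * exp (- (norm y)\<^sup>2 / 2) \<le> exp (- (x \<bullet> y))"
      unfolding exp_add[symmetric] by simp
    then show "?g x * ?g y \<le> ennreal (exp (- (x \<bullet> y)))"
      unfolding std_gaussian_def by (subst ennreal_mult[symmetric]) (simp_all add: ennreal_leI)
  qed
  have "ennreal ((2 * pi) powr ?n) \<le> (\<integral>\<^sup>+x. ess_polar (translate z ?g) x \<partial>lborel)" for z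
  proof -
    have "ennreal ((2 * pi) powr ?n) = (\<integral>\<^sup>+x. ?g (z + x) \<partial>lborel)"
      using nn_integral_lborel_affine[of ?g 1 z] int by simp
    also have "\<dots> \<le> (\<integral>\<^sup>+x. ess_polar (translate z ?g) x \<partial>lborel)"
    proof (rule nn_integral_mono)
      fix x
      have "(norm (z + x))\<^sup>2 = (norm x)\<^sup>2 + (norm z)\<^sup>2 + 2 * (x \<bullet> z)"
        unfolding power2_norm_eq_inner by (simp add: inner_add_left inner_add_right inner_commute)
      then have "exp (- (norm (z + x))\<^sup>2 / 2) \<le> exp (- (norm x)\<^sup>2 / 2) * exp (- (x \<bullet> z))"
        unfolding exp_add[symmetric] by (simp add: field_simps)
      then have "?g (z + x) \<le> ?g x * ennreal (exp (- (x \<bullet> z)))"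
        unfolding std_gaussian_def by (subst ennreal_mult[symmetric]) (simp_all add: ennreal_leI)
      also have "\<dots> \<le> ess_polar (translate z ?g) x"
        unfolding ess_polar_translate by (intro mult_right_mono polar) simp
      finally show "?g (z + x) \<le> ess_polar (translate z ?g) x" .
    qed
    finally show ?thesis .
  qed
  then have "ennreal ((2 * pi) powr ?n) \<le> (INF z. \<integral>\<^sup>+x. ess_polar (translate z ?g) x \<partial>lborel)"
    by (rule INF_greatest)
  then have "ennreal ((2 * pi) powr ?n) * ennreal ((2 * pi) powr ?n) \<le> volume_product ?g"
    unfolding volume_product_def int by (rule mult_left_mono) simp
  then show ?thesis by (simp flip: ennreal_mult powr_add)
qed

section \<open>The Fokker-Planck flow and monotonicity\<close>

text \<open>The dilation preserves the mass, and it transforms polars, up to a constant, by the inverse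
  dilation, whose Jacobian is that constant. Translations correspond to each other through \<open>z \<mapsto> l z\<close>.
  One inequality suffices, since the inverse dilation is of the same form.\<close>

lemma volume_product_le_scaling:
  fixes g :: "real ^ 'n \<Rightarrow> ennreal"
  assumes [measurable]: "g \<in> borel_measurable borel" and l: "0 < l"
  shows "volume_product g \<le> volume_product (\<lambda>x. ennreal (l ^ CARD('n)) * g (l *\<^sub>R x))"
proof -
  define c where "c = l ^ CARD('n)"
  have c: "0 < c" using l by (simp add: c_def)
  have cc: "ennreal (1 / c) * ennreal c = 1" using c by (subst ennreal_mult[symmetric]) simp_all
  let ?h = "\<lambda>x. ennreal c * g (l *\<^sub>R x)"
  have int: "(\<integral>\<^sup>+x. ?h x \<partial>lborel) = (\<integral>\<^sup>+x. g x \<partial>lborel)"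
    using l nn_integral_lborel_affine[of g l 0] by (simp add: c_def nn_integral_cmult)
  have polar: "ennreal (1 / c) * ess_polar g ((1 / l) *\<^sub>R x) \<le> ess_polar ?h x" for x
  proof (rule le_ess_polar)
    have "AE y in lborel. \<forall>x. ess_polar g x * g (l *\<^sub>R y) \<le> ennreal (exp (- (x \<bullet> (l *\<^sub>R y))))"
      using l by (intro AE_lborel_scale[OF AE_ess_polar_all]) simp
    then show "AE y in lborel. ennreal (1 / c) * ess_polar g ((1 / l) *\<^sub>R x) * ?h y \<le> ennreal (exp (- (x \<bullet> y)))"
    proof eventually_elim
      case (elim y)
      have "ennreal (1 / c) * ess_polar g ((1 / l) *\<^sub>R x) * ?h y =
          ennreal (1 / c) * ennreal c * (ess_polar g ((1 / l) *\<^sub>R x) * g (l *\<^sub>R y))" by (simp only: mult_ac)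
      also have "\<dots> \<le> ennreal (exp (- (((1 / l) *\<^sub>R x) \<bullet> (l *\<^sub>R y))))"
        unfolding cc mult_1_left by (rule elim[rule_format])
      also have "((1 / l) *\<^sub>R x) \<bullet> (l *\<^sub>R y) = x \<bullet> y" using l by simp
      finally show ?case .
    qed
  qed
  have "(INF z. \<integral>\<^sup>+x. ess_polar (translate z g) x \<partial>lborel) \<le> (\<integral>\<^sup>+x. ess_polar (translate z ?h) x \<partial>lborel)" for z
  proof -
    have "(INF z. \<integral>\<^sup>+x. ess_polar (translate z g) x \<partial>lborel) \<le> (\<integral>\<^sup>+x. ess_polar (translate (l *\<^sub>R z) g) x \<partial>lborel)"
      by (rule INF_lower) simp
    also have "\<dots> = ennreal ((1 / l) ^ CARD('n)) * (\<integral>\<^sup>+x. ess_polar (translate (l *\<^sub>R z) g) ((1 / l) *\<^sub>R x) \<partial>lborel)"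
      using l nn_integral_lborel_affine[of "ess_polar (translate (l *\<^sub>R z) g)" "1 / l" 0] by simp
    also have "\<dots> = (\<integral>\<^sup>+x. ennreal (1 / c) * ess_polar (translate (l *\<^sub>R z) g) ((1 / l) *\<^sub>R x) \<partial>lborel)"
      by (subst nn_integral_cmult) (simp_all add: c_def power_divide)
    also have "\<dots> \<le> (\<integral>\<^sup>+x. ess_polar (translate z ?h) x \<partial>lborel)"
    proof (rule nn_integral_mono)
      fix x
      have "((1 / l) *\<^sub>R x) \<bullet> (l *\<^sub>R z) = x \<bullet> z" using l by simp
      then show "ennreal (1 / c) * ess_polar (translate (l *\<^sub>R z) g) ((1 / l) *\<^sub>R x) \<le> ess_polar (translate z ?h) x"
        unfolding ess_polar_translate mult.assoc[symmetric] using polar[of x] by (simp add: mult_right_mono)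
    qed
    finally show ?thesis .
  qed
  then have "(INF z. \<integral>\<^sup>+x. ess_polar (translate z g) x \<partial>lborel) \<le> (INF z. \<integral>\<^sup>+x. ess_polar (translate z ?h) x \<partial>lborel)"
    by (rule INF_greatest)
  then show ?thesis
    unfolding volume_product_def c_def[symmetric] int by (rule mult_left_mono) simp
qed

lemma volume_product_scaling:
  fixes g :: "real ^ 'n \<Rightarrow> ennreal"
  assumes [measurable]: "g \<in> borel_measurable borel" and l: "0 < l"
  shows "volume_product (\<lambda>x. ennreal (l ^ CARD('n)) * g (l *\<^sub>R x)) = volume_product g"
proof (rule antisym)
  let ?h = "\<lambda>x. ennreal (l ^ CARD('n)) * g (l *\<^sub>R x)"
  have "volume_product ?h \<le> volume_product (\<lambda>x. ennreal ((1 / l) ^ CARD('n)) * ?h ((1 / l) *\<^sub>R x))"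
    using l by (intro volume_product_le_scaling) simp_all
  also have "(\<lambda>x. ennreal ((1 / l) ^ CARD('n)) * ?h ((1 / l) *\<^sub>R x)) = g"
  proof
    fix x
    have "ennreal ((1 / l) ^ CARD('n)) * ennreal (l ^ CARD('n)) = 1"
      using l by (subst ennreal_mult[symmetric]) (simp_all add: power_divide)
    then show "ennreal ((1 / l) ^ CARD('n)) * ?h ((1 / l) *\<^sub>R x) = g x"
      using l by (simp add: mult.assoc[symmetric])
  qed
  finally show "volume_product ?h \<le> volume_product g" .
qed (rule volume_product_le_scaling[OF assms])

lemma fokker_planck_flow_eq_scaled_heat_flow:
  fixes f :: "real ^ 'n \<Rightarrow> ennreal"
  assumes "0 \<le> t"
  shows "fokker_planck_flow t f = (\<lambda>x. ennreal (exp (t / 2) ^ CARD('n)) * heat_flow (exp t - 1) f (exp (t / 2) *\<^sub>R x))"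
proof
  fix x
  have "exp (real CARD('n) * t / 2) = exp (t / 2) ^ CARD('n)"
    by (simp flip: exp_of_nat_mult)
  then show "fokker_planck_flow t f x = ennreal (exp (t / 2) ^ CARD('n)) * heat_flow (exp t - 1) f (exp (t / 2) *\<^sub>R x)"
    unfolding fokker_planck_flow_def heat_flow_def by simp
qed

lemma volume_product_heat_flow:
  assumes "f \<in> borel_measurable borel" "0 \<le> t"
  shows "volume_product (heat_flow t f) = (\<integral>\<^sup>+x. f x \<partial>lborel) * min_polar_mass (heat_flow t f)"
  unfolding volume_product_def min_polar_mass_def[symmetric] nn_integral_heat_flow[OF assms] ..

lemma volume_product_heat_flow_mono:
  fixes f :: "real ^ 'n \<Rightarrow> ennreal"
  assumes [measurable]: "f \<in> borel_measurable borel" and st: "0 \<le> s" "s \<le> t"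
  shows "volume_product (heat_flow s f) \<le> volume_product (heat_flow t f)"
proof (cases "s = t")
  case False
  then have t: "0 < t - s" using st by simp
  have "min_polar_mass (heat_flow s f) \<le> min_polar_mass (heat_flow (t - s) (heat_flow s f))"
    using st t by (intro min_polar_mass_le_heat_flow) simp_all
  also have "heat_flow (t - s) (heat_flow s f) = heat_flow t f"
    using heat_flow_semigroup[OF assms(1) st(1) t] by simp
  finally show ?thesis
    using st by (simp add: volume_product_heat_flow mult_left_mono)
qed simp

theorem corollary1p6:
  fixes f :: "real ^ 'n \<Rightarrow> ennreal"
    and flow :: "real \<Rightarrow> (real ^ 'n \<Rightarrow> ennreal) \<Rightarrow> real ^ 'n \<Rightarrow> ennreal"
  assumes "f \<in> borel_measurable borel"
    and "flow = heat_flow \<or> flow = fokker_planck_flow"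
  shows "(\<forall>t\<ge>0. volume_product (flow t f) =
            (\<integral>\<^sup>+x. f x \<partial>lborel) *
            (INF z. \<integral>\<^sup>+x. ess_polar (translate z (flow t f)) x \<partial>lborel)) \<and>
         mono_on {0..} (\<lambda>t. volume_product (flow t f)) \<and>
         (\<forall>t\<ge>0. volume_product (flow t f)
            \<le> volume_product (std_gaussian :: real ^ 'n \<Rightarrow> ennreal))"
proof -
  note [measurable] = assms(1)
  have le_gauss: "volume_product (heat_flow t f) \<le> volume_product (std_gaussian :: real ^ 'n \<Rightarrow> ennreal)"
    if "0 \<le> t" for t
  proof -
    have "volume_product (heat_flow t f) \<le> ennreal ((2 * pi) powr real CARD('n))"
      unfolding volume_product_def min_polar_mass_def[symmetric]
      using that by (intro blaschke_santalo) simp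
    also note volume_product_std_gaussian_ge
    finally show ?thesis .
  qed
  have fp: "volume_product (fokker_planck_flow t f) = volume_product (heat_flow (exp t - 1) f)" if "0 \<le> t" for t
    unfolding fokker_planck_flow_eq_scaled_heat_flow[OF that]
    using that by (intro volume_product_scaling) simp_all
  have mass: "(\<integral>\<^sup>+x. flow t f x \<partial>lborel) = (\<integral>\<^sup>+x. f x \<partial>lborel)" if t: "0 \<le> t" for t
    using assms(2)
  proof
    assume "flow = heat_flow"
    then show ?thesis using t by (simp add: nn_integral_heat_flow)
  next
    assume flow: "flow = fokker_planck_flow"
    have "(\<integral>\<^sup>+x. flow t f x \<partial>lborel) = (\<integral>\<^sup>+x. heat_flow (exp t - 1) f x \<partial>lborel)"
      unfolding flow fokker_planck_flow_eq_scaled_heat_flow[OF t]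
      using t nn_integral_lborel_affine[of "heat_flow (exp t - 1) f" "exp (t / 2)" 0]
      by (simp add: nn_integral_cmult)
    then show ?thesis using t by (simp add: nn_integral_heat_flow)
  qed
  have "mono_on {0..} (\<lambda>t. volume_product (flow t f))"
    using assms(2) by (auto intro!: mono_onI volume_product_heat_flow_mono simp: fp)
  moreover have "\<forall>t\<ge>0. volume_product (flow t f) \<le> volume_product (std_gaussian :: real ^ 'n \<Rightarrow> ennreal)"
    using assms(2) by (auto simp: fp le_gauss)
  moreover have "\<forall>t\<ge>0. volume_product (flow t f) = (\<integral>\<^sup>+x. f x \<partial>lborel) *
      (INF z. \<integral>\<^sup>+x. ess_polar (translate z (flow t f)) x \<partial>lborel)"
    unfolding volume_product_def by (simp add: mass)
  ultimately show ?thesis by blast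
qed

end
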